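(* Let $G$ be a thick generalized quadrangle of finite order $(s,t)$ and let $\Gamma$ be the graph whose vertices are the chambers of $G$, two vertices being adjacent if the corresponding chambers are opposite. Then: (a) The independence number of $\Gamma$ is $\alpha(\Gamma)=(s+1)(t+1)$. (b) The independent sets of $\Gamma$ of cardinality $\alpha(\Gamma)$ are the sets $F(x)$ for a point or line $x$ of $G$ and, if $(s,t)=(2,2)$, additionally the independent sets $X$ described below. (c) Every maximal independent set of $\Gamma$ with fewer than $(s+1)(t+1)$ elements has at most $\max\{1+s+2t,\,1+t+2s\}$ elements. (d) If $G$ has an ovoid or a spread, then $\Gamma$ has chromatic number $st+1$; otherwise $\Gamma$ has chromatic number at least $st+2$.
   Context: A generalized quadrangle of order $(s,t)$ is a point-line incidence structure in which every line has exactly $s+1$ points, every point lies on exactly $t+1$ lines, two distinct points lie on at most one common line, and for every point $P$ and line $\ell$ with $P\notin\ell$ there is exactly one point on $\ell$ collinear with $P$. It is thick if $s,t\ge 2$. A chamber is an incident pair $\{P,\ell\}$ of a point $P$ and a line $\ell$. Two chambers $\{P,\ell\}$ and $\{P',\ell'\}$ are opposite if $\ell$ and $\ell'$ have no common point and there is no line containing both $P$ and $P'$. For a point $P$, $F(P)$ is the set of all chambers whose line is incident with $P$; for a line $\ell$, $F(\ell)$ is the set of all chambers whose point is incident with $\ell$. An ovoid is a set of points meeting every line in exactly one point; a spread is a set of lines partitioning the point set. The generalized quadrangle of order $(2,2)$ is unique: its points and lines are those of the non-degenerate parabolic quadric $Q(4,2)$ in $\mathrm{PG}(4,2)$. In that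 case, for a hyperbolic quadric $Q^+(3,2)\subseteq Q(4,2)$ obtained by intersecting $Q(4,2)$ with a suitable $3$-space, the set $X$ consists of the nine chambers $\{P,\ell\}$ where $P$ is a point of $Q^+(3,2)$ and $\ell$ is the unique line of $Q(4,2)$ through $P$ that is not contained in $Q^+(3,2)$. *)

theory Defs
  imports
    "HOL-Analysis.Cartesian_Space"
    "HOL-Library.Numeral_Type"
    "HOL-Library.Ramsey"
    "HOL-Library.Z2"
begin

section \<open>Generalized quadrangles\<close>

record ('p, 'l) incidence_structure =
  points :: "'p set"
  lines :: "'l set"
  inc :: "'p \<Rightarrow> 'l \<Rightarrow> bool"

definition collinear_points :: "('p, 'l) incidence_structure \<Rightarrow> 'p \<Rightarrow> 'p \<Rightarrow> bool" where
  "collinear_points G P Q \<longleftrightarrow> (\<exists>l\<in>lines G. inc G P l \<and> inc G Q l)"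

definition concurrent_lines :: "('p, 'l) incidence_structure \<Rightarrow> 'l \<Rightarrow> 'l \<Rightarrow> bool" where
  "concurrent_lines G l m \<longleftrightarrow> (\<exists>P\<in>points G. inc G P l \<and> inc G P m)"

text \<open>As usual, the point set is required to be nonempty; without this, the structure with no points
  and no lines would satisfy all the axioms. That a generalized quadrangle of order \<open>(s, t)\<close> with
  \<open>s, t \<ge> 2\<close> has finitely many points and lines follows from the axioms.\<close>

definition generalized_quadrangle :: "('p, 'l) incidence_structure \<Rightarrow> nat \<Rightarrow> nat \<Rightarrow> bool" where
  "generalized_quadrangle G s t \<longleftrightarrow>
     points G \<noteq> {} \<and>
     (\<forall>l\<in>lines G. card {P \<in> points G. inc G P l} = s + 1) \<and>
     (\<forall>P\<in>points G. card {l \<in> lines G. inc G P l} = t + 1) \<and>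
     (\<forall>P\<in>points G. \<forall>Q\<in>points G. \<forall>l\<in>lines G. \<forall>m\<in>lines G.
        P \<noteq> Q \<and> inc G P l \<and> inc G Q l \<and> inc G P m \<and> inc G Q m \<longrightarrow> l = m) \<and>
     (\<forall>P\<in>points G. \<forall>l\<in>lines G. \<not> inc G P l \<longrightarrow>
        (\<exists>!Q. Q \<in> points G \<and> inc G Q l \<and> collinear_points G P Q))"

definition thick_generalized_quadrangle :: "('p, 'l) incidence_structure \<Rightarrow> nat \<Rightarrow> nat \<Rightarrow> bool" where
  "thick_generalized_quadrangle G s t \<longleftrightarrow> generalized_quadrangle G s t \<and> s \<ge> 2 \<and> t \<ge> 2"

definition ovoid :: "('p, 'l) incidence_structure \<Rightarrow> 'p set \<Rightarrow> bool" where
  "ovoid G A \<longleftrightarrow> A \<subseteq> points G \<and> (\<forall>l\<in>lines G. \<exists>!P. P \<in> A \<and> inc G P l)"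

definition spread :: "('p, 'l) incidence_structure \<Rightarrow> 'l set \<Rightarrow> bool" where
  "spread G A \<longleftrightarrow> A \<subseteq> lines G \<and> (\<forall>P\<in>points G. \<exists>!l. l \<in> A \<and> inc G P l)"

definition incidence_isomorphism ::
    "('p, 'l) incidence_structure \<Rightarrow> ('q, 'm) incidence_structure \<Rightarrow> ('p \<Rightarrow> 'q) \<Rightarrow> ('l \<Rightarrow> 'm) \<Rightarrow> bool" where
  "incidence_isomorphism G H f g \<longleftrightarrow>
     bij_betw f (points G) (points H) \<and> bij_betw g (lines G) (lines H) \<and>
     (\<forall>P\<in>points G. \<forall>l\<in>lines G. inc G P l \<longleftrightarrow> inc H (f P) (g l))"


section \<open>Chambers and opposition\<close>

text \<open>A chamber, that is, an incident pair of a point and a line, is encoded as an ordered pair with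
  the point first.\<close>

definition chambers :: "('p, 'l) incidence_structure \<Rightarrow> ('p \<times> 'l) set" where
  "chambers G = {(P, l). P \<in> points G \<and> l \<in> lines G \<and> inc G P l}"

definition opposite :: "('p, 'l) incidence_structure \<Rightarrow> 'p \<times> 'l \<Rightarrow> 'p \<times> 'l \<Rightarrow> bool" where
  "opposite G c d \<longleftrightarrow>
     \<not> concurrent_lines G (snd c) (snd d) \<and> \<not> collinear_points G (fst c) (fst d)"

text \<open>The edge set of the graph with vertex set \<^term>\<open>chambers G\<close>. Opposition is symmetric, and no
  chamber is opposite to itself, so every edge is a set of two vertices.\<close>

definition opposition_edges :: "('p, 'l) incidence_structure \<Rightarrow> ('p \<times> 'l) set set" where
  "opposition_edges G = {{c, d} | c d. c \<in> chambers G \<and> d \<in> chambers G \<and> opposite G c d}"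

definition F_point :: "('p, 'l) incidence_structure \<Rightarrow> 'p \<Rightarrow> ('p \<times> 'l) set" where
  "F_point G P = {c \<in> chambers G. inc G P (snd c)}"

definition F_line :: "('p, 'l) incidence_structure \<Rightarrow> 'l \<Rightarrow> ('p \<times> 'l) set" where
  "F_line G l = {c \<in> chambers G. inc G (fst c) l}"


section \<open>Independent sets and colourings\<close>

text \<open>A graph is given by its vertex set \<open>V\<close> and its set \<open>E\<close> of two-element edges, as in
  \<^const>\<open>indep\<close>.\<close>

definition independent_set :: "'a set \<Rightarrow> 'a set set \<Rightarrow> 'a set \<Rightarrow> bool" where
  "independent_set V E S \<longleftrightarrow> S \<subseteq> V \<and> indep S E"

definition maximal_independent_set :: "'a set \<Rightarrow> 'a set set \<Rightarrow> 'a set \<Rightarrow> bool" where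
  "maximal_independent_set V E S \<longleftrightarrow>
     independent_set V E S \<and> (\<forall>T. independent_set V E T \<and> S \<subseteq> T \<longrightarrow> T = S)"

text \<open>The following two notions are meaningful for finite \<open>V\<close>.\<close>

definition independence_number :: "'a set \<Rightarrow> 'a set set \<Rightarrow> nat" where
  "independence_number V E = Max (card ` {S. independent_set V E S})"

definition proper_colouring :: "'a set \<Rightarrow> 'a set set \<Rightarrow> nat \<Rightarrow> ('a \<Rightarrow> nat) \<Rightarrow> bool" where
  "proper_colouring V E k f \<longleftrightarrow>
     f ` V \<subseteq> {..<k} \<and> (\<forall>u\<in>V. \<forall>v\<in>V. {u, v} \<in> E \<longrightarrow> f u \<noteq> f v)"

definition chromatic_number :: "'a set \<Rightarrow> 'a set set \<Rightarrow> nat" where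
  "chromatic_number V E = (LEAST k. \<exists>f. proper_colouring V E k f)"


section \<open>The quadric \<open>Q(4,2)\<close> and the sets \<open>X\<close>\<close>

text \<open>All non-degenerate parabolic quadrics of \<open>PG(4,2)\<close> are projectively equivalent to the one with
  the following equation.\<close>

definition parabolic_form :: "bit ^ 5 \<Rightarrow> bit" where
  "parabolic_form x = (x $ 0)\<^sup>2 + x $ 1 * x $ 2 + x $ 3 * x $ 4"

definition hyperbolic_form :: "bit ^ 4 \<Rightarrow> bit" where
  "hyperbolic_form x = x $ 0 * x $ 1 + x $ 2 * x $ 3"

text \<open>Points and lines of \<open>PG(4,2)\<close> are the subspaces of \<open>GF(2)\<^sup>5\<close> of dimension 1 and 2; incidence
  is inclusion.\<close>

definition Q42 :: "((bit ^ 5) set, (bit ^ 5) set) incidence_structure" where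
  "Q42 = \<lparr> points = {U. vec.subspace U \<and> vec.dim U = 1 \<and> (\<forall>x\<in>U. parabolic_form x = 0)},
           lines = {U. vec.subspace U \<and> vec.dim U = 2 \<and> (\<forall>x\<in>U. parabolic_form x = 0)},
           inc = (\<subseteq>) \<rparr>"

text \<open>The 3-spaces \<open>H\<close> of \<open>PG(4,2)\<close> (subspaces of dimension 4) that meet the quadric in a hyperbolic
  quadric \<open>Q\<^sup>+(3,2)\<close>: the form restricted to \<open>H\<close> is equivalent to the standard hyperbolic form.\<close>

definition hyperbolic_solid :: "(bit ^ 5) set \<Rightarrow> bool" where
  "hyperbolic_solid H \<longleftrightarrow> vec.subspace H \<and> vec.dim H = 4 \<and>
     (\<exists>f :: bit ^ 4 \<Rightarrow> bit ^ 5. Vector_Spaces.linear (*s) (*s) f \<and> bij_betw f UNIV H \<and>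
        (\<forall>x. parabolic_form (f x) = hyperbolic_form x))"

text \<open>A point or line of \<open>Q(4,2)\<close> belongs to the hyperbolic quadric cut out by \<open>H\<close> iff it is
  contained in \<open>H\<close>. Every point of the hyperbolic quadric lies on exactly one line of \<open>Q(4,2)\<close> not
  contained in \<open>H\<close>, so the set below has one chamber for each of the nine points.\<close>

definition X_Q42 :: "(bit ^ 5) set \<Rightarrow> ((bit ^ 5) set \<times> (bit ^ 5) set) set" where
  "X_Q42 H = {(P, l) \<in> chambers Q42. P \<subseteq> H \<and> \<not> l \<subseteq> H}"

text \<open>The sets \<open>X\<close> in a generalized quadrangle of order \<open>(2,2)\<close>, obtained by identifying it with
  \<open>Q(4,2)\<close> through an isomorphism.\<close>

definition X_set :: "('p, 'l) incidence_structure \<Rightarrow> ('p \<times> 'l) set \<Rightarrow> bool" where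
  "X_set G S \<longleftrightarrow> (\<exists>f g H. incidence_isomorphism G Q42 f g \<and> hyperbolic_solid H \<and>
     S = {(P, l) \<in> chambers G. (f P, g l) \<in> X_Q42 H})"

end

theory Submission
  imports Defs
begin

text \<open>Let \<open>S\<close> be a maximal independent set. As a point off a line is collinear with only one point of
  it, a line \<open>l\<close> with two chambers of \<open>S\<close> meets all lines of \<open>S\<close>, so by maximality all chambers on \<open>l\<close>
  are in \<open>S\<close>; the dual holds for points. Two such lines force \<open>S = F(P)\<close>, two such points \<open>S = F(l)\<close>, and a
  single such line or point leaves room for few chambers only. Otherwise the chambers of \<open>S\<close> have
  distinct points and distinct lines. If four of the points are on a line, then the remaining ones are
  pairwise collinear, and \<open>S\<close> is small; dually for lines. If this does not occur, then there are no
  triangles sharing an edge in the collinearity graph on \<open>S\<close> nor in its complement, because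
  non-collinear points of \<open>S\<close> are on concurrent lines of \<open>S\<close>. A Ramsey argument gives \<open>|S| \<le> 9\<close>, which
  is small enough unless \<open>s = t = 2\<close>. In that case \<open>|S| \<ge> 8\<close> puts the points of \<open>S\<close> on a \<open>3 \<times> 3\<close> grid, with
  the tangent lines of the grid as lines of \<open>S\<close>. Non-collinearity with four points of the grid provides
  coordinates that identify the quadrangle with \<open>Q(4,2)\<close> and the grid with a hyperbolic quadric.\<close>

section \<open>Thick generalized quadrangles and duality\<close>

text \<open>The constants fit as follows. A line of \<open>S\<close> carrying several chambers has
  \<open>s + 1\<close> of them; the other lines of \<open>S\<close> meet it either in at most two
  points, with at most \<open>t\<close> further lines each, or in at least three, which puts the
  remaining points on one line. This gives \<open>1 + s + 2 * t\<close> or \<open>2 * s + 2\<close>.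
  The Ramsey bound 9 exceeds the maximum in (c) only for \<open>s = t = 2\<close>, where that
  maximum is 7. So sizes 8 and 9 remain, and 8 has to be excluded for (c): this is why the grid
  arguments assume at least 8 chambers. Duality halves the work, but \<open>X\<close> is not visibly
  self-dual; a dual grid is ruled out by counting alone.

  For (d), the number of chambers is \<open>s * t + 1\<close> times the independence number, so a
  colouring with \<open>s * t + 1\<close> colours partitions the chambers into maximum independent
  sets. A partition into sets \<open>F(P)\<close> is an ovoid, one into sets \<open>F(l)\<close> a
  spread. A colour class \<open>X\<close> need not be refuted: its existence makes the quadrangle
  isomorphic to \<open>Q(4,2)\<close>, where an elliptic quadric is an ovoid.\<close>

definition dual_structure :: "('p, 'l) incidence_structure \<Rightarrow> ('l, 'p) incidence_structure" where
  "dual_structure G = \<lparr>points = lines G, lines = points G, inc = (\<lambda>l P. inc G P l)\<rparr>"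

lemma dual_simps [simp]:
  "points (dual_structure G) = lines G"
  "lines (dual_structure G) = points G"
  "inc (dual_structure G) l P = inc G P l"
  by (simp_all add: dual_structure_def)

lemma collinear_points_dual [simp]: "collinear_points (dual_structure G) = concurrent_lines G"
  by (intro ext) (simp add: collinear_points_def concurrent_lines_def)

lemma concurrent_lines_dual [simp]: "concurrent_lines (dual_structure G) = collinear_points G"
  by (intro ext) (simp add: collinear_points_def concurrent_lines_def)

lemma collinear_points_sym: "collinear_points G P Q \<longleftrightarrow> collinear_points G Q P"
  by (auto simp: collinear_points_def)

lemma concurrent_lines_sym: "concurrent_lines G l m \<longleftrightarrow> concurrent_lines G m l"
  by (auto simp: concurrent_lines_def)

lemma collinear_pointsI:
  "l \<in> lines G \<Longrightarrow> inc G P l \<Longrightarrow> inc G Q l \<Longrightarrow> collinear_points G P Q"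
  by (auto simp: collinear_points_def)

lemma concurrent_linesI:
  "P \<in> points G \<Longrightarrow> inc G P l \<Longrightarrow> inc G P m \<Longrightarrow> concurrent_lines G l m"
  by (auto simp: concurrent_lines_def)

lemma opposite_sym: "opposite G c d \<longleftrightarrow> opposite G d c"
  by (metis opposite_def collinear_points_sym concurrent_lines_sym)

lemma opposition_edges_iff:
  "c \<in> chambers G \<Longrightarrow> d \<in> chambers G \<Longrightarrow> {c, d} \<in> opposition_edges G \<longleftrightarrow> opposite G c d"
  unfolding opposition_edges_def mem_Collect_eq doubleton_eq_iff using opposite_sym by metis

lemma swap_chambers: "prod.swap ` chambers G = chambers (dual_structure G)"
  by (auto simp: chambers_def image_iff)

lemma swap_in_chambers_dual [simp]:
  "prod.swap c \<in> chambers (dual_structure G) \<longleftrightarrow> c \<in> chambers G"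
  by (cases c) (auto simp: chambers_def)

lemma opposite_dual [simp]:
  "opposite (dual_structure G) (prod.swap c) (prod.swap d) = opposite G c d"
  by (auto simp: opposite_def)

abbreviation ind_chambers :: "('p, 'l) incidence_structure \<Rightarrow> ('p \<times> 'l) set \<Rightarrow> bool" where
  "ind_chambers G \<equiv> independent_set (chambers G) (opposition_edges G)"

abbreviation max_ind_chambers :: "('p, 'l) incidence_structure \<Rightarrow> ('p \<times> 'l) set \<Rightarrow> bool" where
  "max_ind_chambers G \<equiv> maximal_independent_set (chambers G) (opposition_edges G)"

locale thick_gq =
  fixes G :: "('p, 'l) incidence_structure" and s t :: nat
  assumes thick: "thick_generalized_quadrangle G s t"
begin

abbreviation pts :: "'l \<Rightarrow> 'p set" where "pts l \<equiv> {P \<in> points G. inc G P l}"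
abbreviation lns :: "'p \<Rightarrow> 'l set" where "lns P \<equiv> {l \<in> lines G. inc G P l}"
abbreviation coll :: "'p \<Rightarrow> 'p \<Rightarrow> bool" where "coll \<equiv> collinear_points G"
abbreviation conc :: "'l \<Rightarrow> 'l \<Rightarrow> bool" where "conc \<equiv> concurrent_lines G"

lemma s_ge_2: "s \<ge> 2" and t_ge_2: "t \<ge> 2"
  using thick by (auto simp: thick_generalized_quadrangle_def)

lemma gq: "generalized_quadrangle G s t"
  using thick by (auto simp: thick_generalized_quadrangle_def)

lemma points_nonempty: "points G \<noteq> {}"
  using gq by (auto simp: generalized_quadrangle_def)

lemma card_pts: "l \<in> lines G \<Longrightarrow> card (pts l) = s + 1"
  using gq unfolding generalized_quadrangle_def by blast

lemma card_lns: "P \<in> points G \<Longrightarrow> card (lns P) = t + 1"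
  using gq unfolding generalized_quadrangle_def by blast

lemma finite_pts: "l \<in> lines G \<Longrightarrow> finite (pts l)"
  using card_pts by (metis card.infinite Suc_eq_plus1 nat.distinct(1))

lemma finite_lns: "P \<in> points G \<Longrightarrow> finite (lns P)"
  using card_lns by (metis card.infinite Suc_eq_plus1 nat.distinct(1))

lemma line_unique:
  "\<lbrakk>P \<in> points G; Q \<in> points G; l \<in> lines G; m \<in> lines G; P \<noteq> Q;
    inc G P l; inc G Q l; inc G P m; inc G Q m\<rbrakk> \<Longrightarrow> l = m"
  using gq unfolding generalized_quadrangle_def by blast

lemma projection_unique:
  "P \<in> points G \<Longrightarrow> l \<in> lines G \<Longrightarrow> \<not> inc G P l
    \<Longrightarrow> \<exists>!Q. Q \<in> points G \<and> inc G Q l \<and> coll P Q"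
  using gq unfolding generalized_quadrangle_def by blast

lemma no_triangle:
  assumes "P \<in> points G" "l \<in> lines G" "Q \<in> points G" "R \<in> points G"
    "inc G Q l" "inc G R l" "Q \<noteq> R" "coll P Q" "coll P R"
  shows "inc G P l"
  using projection_unique[of P l] assms by blast

lemma projection:
  assumes "P \<in> points G" "l \<in> lines G"
  obtains Q where "Q \<in> points G" "inc G Q l" "coll P Q"
proof (cases "inc G P l")
  case True
  then show ?thesis using that assms collinear_pointsI by metis
next
  case False
  then show ?thesis using that projection_unique[OF assms] by blast
qed

lemma lns_nonempty: "P \<in> points G \<Longrightarrow> \<exists>l \<in> lines G. inc G P l"
  using card_lns[of P] by (metis (no_types, lifting) Collect_empty_eq add_is_0 card.empty one_neq_zero)

lemma pts_nonempty: "l \<in> lines G \<Longrightarrow> \<exists>P \<in> points G. inc G P l"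
  using card_pts[of l] by (metis (no_types, lifting) Collect_empty_eq add_is_0 card.empty one_neq_zero)

lemma coll_refl: "P \<in> points G \<Longrightarrow> coll P P"
  using lns_nonempty by (auto simp: collinear_points_def)

lemma lines_nonempty: "lines G \<noteq> {}"
  using points_nonempty lns_nonempty by blast

text \<open>Only the last axiom needs work: the line through \<open>P\<close> meeting
  \<open>l\<close> joins \<open>P\<close> to its projection onto \<open>l\<close>, and a second such
  line would make \<open>P\<close> collinear with two points of \<open>l\<close>.\<close>

lemma dual: "thick_gq (dual_structure G) t s"
proof -
  have "\<exists>!m. m \<in> lines G \<and> inc G P m \<and> conc l m"
    if Pl: "l \<in> lines G" "P \<in> points G" "\<not> inc G P l" for l P
  proof -
    obtain Q where Q: "Q \<in> points G" "inc G Q l" "coll P Q"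
      using projection[OF Pl(2,1)] by blast
    then obtain m where m: "m \<in> lines G" "inc G P m" "inc G Q m"
      by (auto simp: collinear_points_def)
    show ?thesis
    proof (intro ex1I[of _ m] conjI)
      fix n assume n: "n \<in> lines G \<and> inc G P n \<and> conc l n"
      then obtain R where R: "R \<in> points G" "inc G R l" "inc G R n"
        by (auto simp: concurrent_lines_def)
      have "coll P R" using collinear_pointsI[of n G P R] n R by simp
      then have "R = Q" using no_triangle[of P l R Q] Pl R Q by auto
      moreover have "Q \<noteq> P" using Q Pl by auto
      ultimately show "n = m"
        using line_unique[of P Q n m] m n R Q Pl by simp
    qed (use m Q concurrent_linesI[of Q G l m] in auto)
  qed
  moreover have "P = Q" if "l \<in> lines G" "m \<in> lines G" "P \<in> points G" "Q \<in> points G"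
    "l \<noteq> m \<and> inc G P l \<and> inc G P m \<and> inc G Q l \<and> inc G Q m" for P Q l m
    using line_unique that by blast
  ultimately have "generalized_quadrangle (dual_structure G) t s"
    unfolding generalized_quadrangle_def
    using lines_nonempty card_pts card_lns by simp
  then show ?thesis
    by unfold_locales (simp add: thick_generalized_quadrangle_def s_ge_2 t_ge_2)
qed

lemma point_unique:
  "\<lbrakk>P \<in> points G; Q \<in> points G; l \<in> lines G; m \<in> lines G; l \<noteq> m;
    inc G P l; inc G Q l; inc G P m; inc G Q m\<rbrakk> \<Longrightarrow> P = Q"
  using line_unique by blast

lemma no_triangle_lines:
  assumes "l \<in> lines G" "P \<in> points G" "m \<in> lines G" "n \<in> lines G"
    "inc G P m" "inc G P n" "m \<noteq> n" "conc l m" "conc l n"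
  shows "inc G P l"
  using thick_gq.no_triangle[OF dual, of l P m n] assms by simp

section \<open>Counting points, lines and chambers\<close>

lemma bij_betw_off_line:
  assumes l: "l \<in> lines G"
  shows "bij_betw (\<lambda>(R, m, Q). Q) (SIGMA R:pts l. SIGMA m:lns R - {l}. pts m - {R}) (points G - pts l)"
proof (rule bij_betwI')
  fix x y
  assume "x \<in> (SIGMA R:pts l. SIGMA m:lns R - {l}. pts m - {R})"
     and "y \<in> (SIGMA R:pts l. SIGMA m:lns R - {l}. pts m - {R})"
  moreover obtain R m Q R' m' Q' where "x = (R, m, Q)" "y = (R', m', Q')"
    by (cases x, cases y)
  ultimately have xy: "x = (R, m, Q)" "y = (R', m', Q')"
    "R \<in> pts l" "m \<in> lns R" "m \<noteq> l" "Q \<in> pts m" "Q \<noteq> R"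
    "R' \<in> pts l" "m' \<in> lns R'" "m' \<noteq> l" "Q' \<in> pts m'" "Q' \<noteq> R'"
    by auto
  have "R = R' \<and> m = m'" if "Q = Q'"
  proof -
    have "\<not> inc G Q l" using xy l point_unique[of Q R l m] by auto
    moreover have "coll Q R" "coll Q R'" using xy that by (auto intro: collinear_pointsI)
    ultimately have "R = R'" using no_triangle[of Q l R R'] xy l by auto
    then show ?thesis using line_unique[of Q R m m'] xy that by auto
  qed
  then show "(case x of (R, m, Q) \<Rightarrow> Q) = (case y of (R, m, Q) \<Rightarrow> Q) \<longleftrightarrow> x = y"
    using xy by auto
next
  fix x assume "x \<in> (SIGMA R:pts l. SIGMA m:lns R - {l}. pts m - {R})"
  then show "(case x of (R, m, Q) \<Rightarrow> Q) \<in> points G - pts l"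
    using l point_unique by fastforce
next
  fix Q assume Q: "Q \<in> points G - pts l"
  then obtain R where "R \<in> pts l" "coll Q R" using projection l by blast
  then obtain m where "m \<in> lns R" "inc G Q m" by (auto simp: collinear_points_def)
  then show "\<exists>x\<in>SIGMA R:pts l. SIGMA m:lns R - {l}. pts m - {R}. Q = (case x of (R, m, Q) \<Rightarrow> Q)"
    using Q \<open>R \<in> pts l\<close> by (intro bexI[of _ "(R, m, Q)"]) auto
qed

text \<open>A point off \<open>l\<close> determines its projection \<open>R\<close> on
  \<open>l\<close> and the line joining it to \<open>R\<close>, so there are
  \<open>(s + 1) * t * s\<close> of them. Finiteness comes out of the same bijection, as the axioms
  speak only of single lines and single points.\<close>

lemma finite_points: "finite (points G)"
  and card_points: "card (points G) = (s + 1) * (s * t + 1)"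
proof -
  obtain l where l: "l \<in> lines G" using lines_nonempty by blast
  let ?A = "SIGMA R:pts l. SIGMA m:lns R - {l}. pts m - {R}"
  have fin: "finite (pts m - {R})" if "m \<in> lines G" for m R using finite_pts[OF that] by simp
  have finL: "finite (SIGMA m:lns R - {l}. pts m - {R})" if "R \<in> points G" for R
    using finite_lns[OF that] fin by (intro finite_SigmaI) auto
  have finA: "finite ?A" using finite_pts[OF l] finL by (intro finite_SigmaI[of "pts l"]) auto
  have c1: "card (SIGMA m:lns R - {l}. pts m - {R}) = t * s" if "R \<in> pts l" for R
  proof -
    have "card (SIGMA m:lns R - {l}. pts m - {R}) = (\<Sum>m\<in>lns R - {l}. card (pts m - {R}))"
      using finite_lns that fin by (intro card_SigmaI) auto
    also have "\<dots> = (\<Sum>m\<in>lns R - {l}. s)"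
      using that card_pts finite_pts by (intro sum.cong refl) (subst card_Diff_singleton, auto)
    also have "\<dots> = card (lns R - {l}) * s" by simp
    also have "card (lns R - {l}) = t"
      using that l card_lns[of R] by (subst card_Diff_singleton) auto
    finally show ?thesis .
  qed
  have "card ?A = (\<Sum>R\<in>pts l. card (SIGMA m:lns R - {l}. pts m - {R}))"
    using finite_pts[OF l] finL by (intro card_SigmaI) auto
  also have "\<dots> = (\<Sum>R\<in>pts l. t * s)" using c1 by (intro sum.cong) auto
  also have "\<dots> = (s + 1) * (t * s)" using card_pts[OF l] by simp
  finally have cA: "card ?A = (s + 1) * (t * s)" .
  have fin_off: "finite (points G - pts l)" and c_off: "card (points G - pts l) = (s + 1) * (t * s)"
    using bij_betw_off_line[OF l] finA cA by (auto simp: bij_betw_finite dest: bij_betw_same_card)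
  show fP: "finite (points G)" using fin_off finite_pts[OF l]
    by (metis (no_types, lifting) Diff_infinite_finite)
  have "card (points G) = card (pts l) + card (points G - pts l)"
    using fP by (subst card_Un_disjoint[symmetric]) (auto intro: arg_cong[where f = card])
  then show "card (points G) = (s + 1) * (s * t + 1)"
    using card_pts[OF l] c_off by (simp add: algebra_simps)
qed

lemma card_chambers: "card (chambers G) = (s * t + 1) * ((s + 1) * (t + 1))"
  and finite_chambers: "finite (chambers G)"
proof -
  have *: "chambers G = (SIGMA P:points G. lns P)" by (auto simp: chambers_def)
  have "card (chambers G) = (\<Sum>P\<in>points G. card (lns P))"
    unfolding * using finite_points finite_lns by (intro card_SigmaI) auto
  also have "\<dots> = (\<Sum>P\<in>points G. t + 1)" using card_lns by (intro sum.cong) auto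
  also have "\<dots> = (s + 1) * (s * t + 1) * (t + 1)" by (simp only: sum_constant card_points of_nat_id)
  finally show "card (chambers G) = (s * t + 1) * ((s + 1) * (t + 1))"
    by (simp only: ac_simps)
  show "finite (chambers G)"
    unfolding * using finite_points finite_lns by (intro finite_SigmaI) auto
qed

lemma card_lines: "card (lines G) = (t + 1) * (s * t + 1)"
  using thick_gq.card_points[OF dual] by (simp add: mult.commute)

section \<open>Independent sets of chambers and their duals\<close>

lemma not_opposite_self: "c \<in> chambers G \<Longrightarrow> \<not> opposite G c c"
  using coll_refl by (auto simp: opposite_def chambers_def)

lemma ind_chambers_iff:
  "ind_chambers G S \<longleftrightarrow> S \<subseteq> chambers G \<and> (\<forall>c\<in>S. \<forall>d\<in>S. \<not> opposite G c d)"
  unfolding independent_set_def indep_def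
  using opposition_edges_iff not_opposite_self by (metis subset_iff)

lemma finite_ind_chambers: "ind_chambers G S \<Longrightarrow> finite S"
  using finite_chambers finite_subset by (auto simp: ind_chambers_iff)

lemma max_ind_chambers_memI:
  assumes "max_ind_chambers G S" "c \<in> chambers G" "\<And>d. d \<in> S \<Longrightarrow> \<not> opposite G c d"
  shows "c \<in> S"
proof -
  have "ind_chambers G (insert c S)"
    using assms not_opposite_self unfolding maximal_independent_set_def ind_chambers_iff
    by (metis insert_iff insert_subset opposite_sym)
  then show ?thesis
    using assms(1) unfolding maximal_independent_set_def by blast
qed

lemma max_ind_chambers_ind: "max_ind_chambers G S \<Longrightarrow> ind_chambers G S"
  by (simp add: maximal_independent_set_def)

lemma finite_max_ind_chambers: "max_ind_chambers G S \<Longrightarrow> finite S"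
  by (simp add: finite_ind_chambers max_ind_chambers_ind)

lemma max_ind_chambers_chamber:
  assumes "max_ind_chambers G S" "(P, l) \<in> S"
  shows "P \<in> points G \<and> l \<in> lines G \<and> inc G P l"
  using assms(2) max_ind_chambers_ind[OF assms(1)] unfolding ind_chambers_iff
  by (auto simp: chambers_def)

lemma max_ind_chambers_not_opposite:
  assumes "max_ind_chambers G S" "(P, l) \<in> S" "(Q, m) \<in> S"
  shows "coll P Q \<or> conc l m"
  using assms(2,3) max_ind_chambers_ind[OF assms(1)] unfolding ind_chambers_iff
  by (force simp: opposite_def)

lemma ind_chambers_dual:
  "ind_chambers (dual_structure G) (prod.swap ` S) \<longleftrightarrow> ind_chambers G S"
  by (simp only: ind_chambers_iff thick_gq.ind_chambers_iff[OF dual] image_subset_iff subset_eq ball_simps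
      swap_in_chambers_dual opposite_dual)

lemma max_ind_chambers_dual:
  assumes "max_ind_chambers G S"
  shows "max_ind_chambers (dual_structure G) (prod.swap ` S)"
  unfolding maximal_independent_set_def
proof (intro conjI allI impI)
  show "ind_chambers (dual_structure G) (prod.swap ` S)"
    using assms ind_chambers_dual max_ind_chambers_ind by blast
  fix T assume T: "ind_chambers (dual_structure G) T \<and> prod.swap ` S \<subseteq> T"
  have T': "T = prod.swap ` (prod.swap ` T)" by (simp add: image_image)
  then have "ind_chambers G (prod.swap ` T)" using T ind_chambers_dual by metis
  moreover have "S \<subseteq> prod.swap ` T" using T by (force simp: image_iff)
  ultimately have "prod.swap ` T = S"
    using assms by (auto simp: maximal_independent_set_def)
  then show "T = prod.swap ` S" using T' by simp
qed

end

section \<open>Lines and points carrying several chambers\<close>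

context thick_gq begin

lemma F_point_dual: "F_point (dual_structure G) l = prod.swap ` F_line G l"
  by (auto simp: F_point_def F_line_def image_iff chambers_def)

lemma ind_F_point: "P \<in> points G \<Longrightarrow> ind_chambers G (F_point G P)"
  by (auto simp: ind_chambers_iff F_point_def opposite_def intro: concurrent_linesI)

lemma ind_F_line: "l \<in> lines G \<Longrightarrow> ind_chambers G (F_line G l)"
  by (auto simp: ind_chambers_iff F_line_def opposite_def intro: collinear_pointsI)

lemma card_F_point:
  assumes "P \<in> points G"
  shows "card (F_point G P) = (s + 1) * (t + 1)"
proof -
  have "F_point G P = prod.swap ` (SIGMA l:lns P. pts l)"
    by (auto simp: F_point_def chambers_def)
  then have "card (F_point G P) = card (SIGMA l:lns P. pts l)"
    by (simp add: card_image)
  also have "\<dots> = (\<Sum>l\<in>lns P. card (pts l))"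
    using finite_lns[OF assms] finite_pts by (intro card_SigmaI) auto
  finally show ?thesis
    using card_pts card_lns[OF assms] by simp
qed

lemma card_F_line:
  assumes "l \<in> lines G"
  shows "card (F_line G l) = (s + 1) * (t + 1)"
  using thick_gq.card_F_point[OF dual, of l] assms
  by (simp add: F_point_dual card_image)

text \<open>A point off \<open>l\<close> is collinear with only one point of \<open>l\<close>, so two chambers of \<open>S\<close> on \<open>l\<close>
  force every line of \<open>S\<close> to meet \<open>l\<close>.\<close>

lemma full_line:
  assumes S: "max_ind_chambers G S" and "(P, l) \<in> S" "(Q, l) \<in> S" "P \<noteq> Q"
  shows full_line_conc: "\<And>R m. (R, m) \<in> S \<Longrightarrow> conc l m"
    and full_line_mem: "\<And>R. R \<in> points G \<Longrightarrow> inc G R l \<Longrightarrow> (R, l) \<in> S"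
proof -
  note PQ = assms(2-4) max_ind_chambers_chamber[OF S assms(2)] max_ind_chambers_chamber[OF S assms(3)]
  show conc: "conc l m" if "(R, m) \<in> S" for R m
  proof (rule ccontr)
    assume n: "\<not> conc l m"
    then have "coll R P" "coll R Q"
      using max_ind_chambers_not_opposite[OF S] PQ that concurrent_lines_sym by metis+
    then have "inc G R l" using no_triangle[of R l P Q] PQ max_ind_chambers_chamber[OF S that] by blast
    then show False using n max_ind_chambers_chamber[OF S that] concurrent_linesI by metis
  qed
  show "(R, l) \<in> S" if "R \<in> points G" "inc G R l" for R
    by (rule max_ind_chambers_memI[OF S])
       (use that PQ conc in \<open>auto simp: chambers_def opposite_def\<close>)
qed

text \<open>Every line of \<open>S\<close> meets both \<open>l\<close> and \<open>m\<close>, hence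
  passes through their common point \<open>R\<close>, since there are no triangles of lines. So
  \<open>S\<close> lies in the independent set \<open>F_point G R\<close>, and maximality gives
  equality.\<close>

lemma two_full_lines:
  assumes S: "max_ind_chambers G S"
    and l: "(P, l) \<in> S" "(Q, l) \<in> S" "P \<noteq> Q"
    and m: "(P', m) \<in> S" "(Q', m) \<in> S" "P' \<noteq> Q'" and "l \<noteq> m"
  shows "\<exists>R \<in> points G. S = F_point G R"
proof -
  have lm: "l \<in> lines G" "m \<in> lines G"
    using max_ind_chambers_chamber[OF S] l m by blast+
  obtain R where R: "R \<in> points G" "inc G R l" "inc G R m"
    using full_line_conc[OF S l m(1)] by (auto simp: concurrent_lines_def)
  have "S \<subseteq> F_point G R"
  proof
    fix c assume c: "c \<in> S"
    obtain X n where X: "c = (X, n)" by force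
    have "conc n l" "conc n m"
      using full_line_conc[OF S l] full_line_conc[OF S m] c X concurrent_lines_sym by metis+
    then have "inc G R n"
      using no_triangle_lines[of n R l m] R lm max_ind_chambers_chamber[OF S] c X \<open>l \<noteq> m\<close> by blast
    then show "c \<in> F_point G R"
      using max_ind_chambers_chamber[OF S] c X by (auto simp: F_point_def chambers_def)
  qed
  then have "F_point G R = S"
    using S ind_F_point[OF R(1)] by (auto simp: maximal_independent_set_def)
  then show ?thesis using R by blast
qed

text \<open>All lines of \<open>S\<close> meet \<open>l\<close> and all points of \<open>S\<close>
  are collinear with \<open>X\<close>, so \<open>X\<close> is on \<open>l\<close>. A chamber with
  line other than \<open>l\<close> and point other than \<open>X\<close> would give a triangle
  formed by \<open>X\<close>, its point and the intersection of its line with \<open>l\<close>. What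
  remains are the chambers on \<open>l\<close> and those at \<open>X\<close>.\<close>

lemma full_line_full_point:
  assumes S: "max_ind_chambers G S"
    and l: "(P, l) \<in> S" "(Q, l) \<in> S" "P \<noteq> Q"
    and m: "(X, m) \<in> S" "(X, n) \<in> S" "m \<noteq> n"
    and inj_line: "\<And>R R' k. (R, k) \<in> S \<Longrightarrow> (R', k) \<in> S \<Longrightarrow> k \<noteq> l \<Longrightarrow> R = R'"
    and inj_point: "\<And>R k k'. (R, k) \<in> S \<Longrightarrow> (R, k') \<in> S \<Longrightarrow> R \<noteq> X \<Longrightarrow> k = k'"
  shows "card S \<le> 1 + s + 2 * t"
proof -
  have c: "P \<in> points G" "l \<in> lines G" "X \<in> points G" "m \<in> lines G" "n \<in> lines G"
    "inc G X m" "inc G X n"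
    using max_ind_chambers_chamber[OF S] l m by blast+
  have coll: "coll X R" if "(R, k) \<in> S" for R k
    using thick_gq.full_line_conc[OF dual max_ind_chambers_dual[OF S], of m X n k R] that m by force
  have mem: "(X, k) \<in> S" if "k \<in> lines G" "inc G X k" for k
    using thick_gq.full_line_mem[OF dual max_ind_chambers_dual[OF S], of m X n k] that m by force
  have Xl: "inc G X l"
    using no_triangle_lines[of l X m n] c m full_line_conc[OF S l] by metis
  have "S \<subseteq> (\<lambda>R. (R, l)) ` pts l \<union> Pair X ` lns X"
  proof
    fix d assume d: "d \<in> S"
    obtain R k where Rk: "d = (R, k)" by force
    note Rkc = max_ind_chambers_chamber[OF S d[unfolded Rk]]
    show "d \<in> (\<lambda>R. (R, l)) ` pts l \<union> Pair X ` lns X"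
    proof (rule ccontr)
      assume "\<not> ?thesis"
      then have ne: "k \<noteq> l" "R \<noteq> X" using Rkc Rk by auto
      have nXk: "\<not> inc G X k"
        using inj_line[of R k X] mem[of k] d Rk ne Rkc by blast
      have nRl: "\<not> inc G R l"
        using inj_point[of R k l] full_line_mem[OF S l, of R] d Rk ne Rkc by blast
      obtain Y where Y: "Y \<in> points G" "inc G Y l" "inc G Y k"
        using full_line_conc[OF S l] d Rk by (auto simp: concurrent_lines_def)
      have "coll X Y" using collinear_pointsI c Xl Y by metis
      then show False
        using no_triangle[of X k R Y] coll d Rk Rkc Y c nXk nRl by auto
    qed
  qed
  then have "card S \<le> card ((\<lambda>R. (R, l)) ` pts l \<union> Pair X ` lns X)"
    using finite_pts finite_lns c by (intro card_mono) auto
  also have "\<dots> \<le> card ((\<lambda>R. (R, l)) ` pts l) + card (Pair X ` lns X)"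
    by (rule card_Un_le)
  also have "\<dots> = (s + 1) + (t + 1)"
    using c card_pts card_lns by (subst (1 2) card_image) (auto simp: inj_on_def)
  finally show ?thesis using t_ge_2 by simp
qed

lemma card_le_if_on_line:
  assumes "n \<in> lines G" "inj_on fst T" "\<And>c. c \<in> T \<Longrightarrow> fst c \<in> points G \<and> inc G (fst c) n"
  shows "card T \<le> s + 1"
proof -
  have "card T = card (fst ` T)" using assms by (simp add: card_image)
  also have "\<dots> \<le> card (pts n)" using assms finite_pts by (intro card_mono) auto
  finally show ?thesis using card_pts assms by simp
qed

lemma card_le_if_pairwise_coll:
  assumes "inj_on fst T" "\<And>c. c \<in> T \<Longrightarrow> fst c \<in> points G"
    and coll: "\<And>c d. c \<in> T \<Longrightarrow> d \<in> T \<Longrightarrow> coll (fst c) (fst d)"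
  shows "card T \<le> s + 1"
proof (cases "card T \<le> 1")
  case False
  then obtain c d where cd: "c \<in> T" "d \<in> T" "c \<noteq> d"
    by (metis card_le_Suc0_iff_eq card.infinite One_nat_def zero_le)
  then obtain n where n: "n \<in> lines G" "inc G (fst c) n" "inc G (fst d) n"
    using coll[of c d] by (auto simp: collinear_points_def)
  have "fst c \<noteq> fst d" using cd assms(1) by (auto simp: inj_on_def)
  then have "inc G (fst e) n" if "e \<in> T" for e
    using no_triangle[of "fst e" n "fst c" "fst d"] n cd that assms by blast
  then show ?thesis using card_le_if_on_line[OF n(1) assms(1)] assms(2) by blast
qed (use s_ge_2 in simp)

text \<open>The chambers off \<open>l\<close> are sorted by the foot in which their line meets
  \<open>l\<close>. Lines with different feet are disjoint, so their points are collinear. With at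
  most two feet there are at most \<open>2 * t\<close> such chambers; three feet force all the
  points onto one line \<open>n\<close>, which leaves at most \<open>s + 1\<close>.\<close>

lemma one_full_line:
  assumes S: "max_ind_chambers G S"
    and l: "(P, l) \<in> S" "(Q, l) \<in> S" "P \<noteq> Q"
    and inj_line: "\<And>R R' k. (R, k) \<in> S \<Longrightarrow> (R', k) \<in> S \<Longrightarrow> k \<noteq> l \<Longrightarrow> R = R'"
    and inj_point: "inj_on fst S"
  shows "card S \<le> max (1 + s + 2 * t) (1 + t + 2 * s)"
proof -
  define T where "T = {c \<in> S. snd c \<noteq> l}"
  note chS = max_ind_chambers_chamber[OF S]
  have ll: "l \<in> lines G" using chS l by blast
  have finS: "finite S" by (rule finite_max_ind_chambers[OF S])
  have injT: "inj_on fst T" using inj_point by (auto simp: T_def inj_on_def)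
  have injTs: "inj_on snd T" using inj_line by (auto simp: T_def inj_on_def)
  have "S \<subseteq> (\<lambda>R. (R, l)) ` pts l \<union> T" using chS by (force simp: T_def)
  then have "card S \<le> card ((\<lambda>R. (R, l)) ` pts l \<union> T)"
    using finite_pts ll finS by (intro card_mono) (auto simp: T_def)
  also have "\<dots> \<le> card ((\<lambda>R. (R, l)) ` pts l) + card T" by (rule card_Un_le)
  also have "card ((\<lambda>R. (R, l)) ` pts l) = s + 1"
    using card_pts[OF ll] by (subst card_image) (auto simp: inj_on_def)
  finally have cS: "card S \<le> s + 1 + card T" .
  have "\<forall>c\<in>T. \<exists>R. R \<in> points G \<and> inc G R l \<and> inc G R (snd c)"
    using full_line_conc[OF S l] by (force simp: T_def concurrent_lines_def)
  then obtain ft where ft: "\<And>c. c \<in> T \<Longrightarrow> ft c \<in> points G \<and> inc G (ft c) l \<and> inc G (ft c) (snd c)"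
    by metis
  have chT: "fst c \<in> points G \<and> snd c \<in> lines G \<and> inc G (fst c) (snd c) \<and> snd c \<noteq> l" if "c \<in> T" for c
    using chS[of "fst c" "snd c"] that by (auto simp: T_def)
  \<comment> \<open>A chamber whose point is its own foot would share that point with a chamber on
    \<open>l\<close>.\<close>
  have ft_ne: "fst c \<noteq> ft c" if "c \<in> T" for c
  proof
    assume e: "fst c = ft c"
    have "(fst c, l) \<in> S" using full_line_mem[OF S l] ft[OF that] e by simp
    then have "(fst c, l) = c" using inj_point that by (auto simp: T_def inj_on_def)
    then have "snd c = l" by (metis snd_conv)
    then show False using that by (auto simp: T_def)
  qed
  have coll_T: "coll (fst c) (fst d)" if "c \<in> T" "d \<in> T" "ft c \<noteq> ft d" for c d
  proof (rule ccontr)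
    assume "\<not> ?thesis"
    then have "conc (snd c) (snd d)"
      using max_ind_chambers_not_opposite[OF S, of "fst c" "snd c" "fst d" "snd d"] that
      by (auto simp: T_def)
    moreover have "conc (snd c) l" using ft[OF that(1)] concurrent_linesI[of "ft c" G] by simp
    ultimately have "inc G (ft d) (snd c)"
      using no_triangle_lines[of "snd c" "ft d" "snd d" l] ft[of d] chT[of c] chT[of d] that ll by simp
    then show False
      using point_unique[of "ft c" "ft d" "snd c" l] ft[of c] ft[of d] chT[of c] that ll by simp
  qed
  consider (few) "card (ft ` T) \<le> 2" | (many) "card (ft ` T) \<ge> 3" by linarith
  then have "card T \<le> 2 * t \<or> card T \<le> s + 1"
  proof cases
    case few
    have "card {c \<in> T. ft c = R} \<le> t" if R: "R \<in> ft ` T" for R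
    proof -
      have Rc: "R \<in> points G" "inc G R l" using ft R by auto
      have "card {c \<in> T. ft c = R} = card (snd ` {c \<in> T. ft c = R})"
        by (rule card_image[symmetric]) (use injTs in \<open>auto simp: inj_on_def\<close>)
      also have "\<dots> \<le> card (lns R - {l})"
        using Rc finite_lns chT ft by (intro card_mono) auto
      also have "\<dots> = t" using Rc ll card_lns by (subst card_Diff_singleton) auto
      finally show ?thesis .
    qed
    moreover have "T = (\<Union>R\<in>ft ` T. {c \<in> T. ft c = R})" by auto
    moreover have finT: "finite T" using finS by (simp add: T_def)
    ultimately have "card T \<le> (\<Sum>R\<in>ft ` T. t)"
      using card_UN_le[of "ft ` T" "\<lambda>R. {c \<in> T. ft c = R}"]
        sum_mono[of "ft ` T" "\<lambda>R. card {c \<in> T. ft c = R}" "\<lambda>_. t"] by simp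
    also have "\<dots> \<le> 2 * t" using few by simp
    finally show ?thesis by blast
  next
    case many
    then obtain A where A: "A \<subseteq> ft ` T" "card A = 3" by (metis obtain_subset_with_card_n)
    obtain x y z where xyz: "A = {x, y, z}" "x \<noteq> y" "x \<noteq> z" "y \<noteq> z"
      using A(2) unfolding card_3_iff by auto
    obtain c1 where c1: "c1 \<in> T" "x = ft c1" using A(1) xyz(1) by auto
    obtain c2 where c2: "c2 \<in> T" "y = ft c2" using A(1) xyz(1) by auto
    obtain c3 where c3: "c3 \<in> T" "z = ft c3" using A(1) xyz(1) by auto
    have c: "c1 \<in> T" "c2 \<in> T" "c3 \<in> T" "ft c1 \<noteq> ft c2" "ft c1 \<noteq> ft c3" "ft c2 \<noteq> ft c3"
      using c1 c2 c3 xyz by simp_all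
    obtain n where n: "n \<in> lines G" "inc G (fst c1) n" "inc G (fst c2) n"
      using coll_T[of c1 c2] c by (auto simp: collinear_points_def)
    have distinct: "fst c \<noteq> fst d" if "c \<in> T" "d \<in> T" "ft c \<noteq> ft d" for c d
      using that injT by (auto simp: inj_on_def)
    have on_n: "inc G (fst d) n"
      if "d \<in> T" "a \<in> T" "b \<in> T" "ft a \<noteq> ft b" "ft d \<noteq> ft a" "ft d \<noteq> ft b"
        "inc G (fst a) n" "inc G (fst b) n" for a b d
      using no_triangle[of "fst d" n "fst a" "fst b"] that coll_T[of d a] coll_T[of d b]
        chT[of a] chT[of b] chT[of d] distinct[of a b] n(1) by simp
    have c3n: "inc G (fst c3) n"
      using on_n[of c3 c1 c2] c n by simp
    have "inc G (fst d) n" if "d \<in> T" for d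
    proof -
      \<comment> \<open>The three feet are distinct, so \<open>d\<close> shares its foot with at
        most one of them; the other two points already determine \<open>n\<close>.\<close>
      consider "ft d \<noteq> ft c1" "ft d \<noteq> ft c2" | "ft d \<noteq> ft c1" "ft d \<noteq> ft c3"
        | "ft d \<noteq> ft c2" "ft d \<noteq> ft c3"
        using c(4-6) by (cases "ft d = ft c1"; cases "ft d = ft c2") auto
      then show ?thesis
        by cases (use on_n[OF that, of c1 c2] on_n[OF that, of c1 c3] on_n[OF that, of c2 c3] c n c3n in simp_all)
    qed
    then show ?thesis using card_le_if_on_line[OF n(1) injT] chT by blast
  qed
  then show ?thesis using cS t_ge_2 by auto
qed

end

section \<open>Chambers with distinct points and distinct lines\<close>

lemma card_ge_2_obtain:
  assumes "card X \<ge> 2"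
  obtains a b where "a \<in> X" "b \<in> X" "a \<noteq> b"
proof -
  have "finite X" using assms by (metis card.infinite not_numeral_le_zero)
  then show ?thesis
    using assms that card_le_Suc0_iff_eq[of X] by force
qed

lemma card_ge_3_obtain:
  assumes "card X \<ge> 3"
  obtains a b c where "a \<in> X" "b \<in> X" "c \<in> X" "a \<noteq> b" "a \<noteq> c" "b \<noteq> c"
proof -
  obtain A where A: "A \<subseteq> X" "card A = 3" using assms by (metis obtain_subset_with_card_n)
  then obtain x y z where "A = {x, y, z}" "x \<noteq> y" "x \<noteq> z" "y \<noteq> z" unfolding card_3_iff by auto
  then show ?thesis using that[of x y z] A by simp
qed

text \<open>Diamonds need not be induced: \<open>c\<close> and \<open>d\<close> may be related.\<close>

definition diamond_free :: "'a set \<Rightarrow> ('a \<Rightarrow> 'a \<Rightarrow> bool) \<Rightarrow> bool" where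
  "diamond_free S R \<longleftrightarrow> (\<forall>a\<in>S. \<forall>b\<in>S. \<forall>c\<in>S. \<forall>d\<in>S.
     a \<noteq> b \<and> a \<noteq> c \<and> a \<noteq> d \<and> b \<noteq> c \<and> b \<noteq> d \<and> c \<noteq> d \<and> R a b \<and> R a c \<and> R b c \<and> R a d \<and> R b d \<longrightarrow> False)"

lemma diamond_freeD:
  "diamond_free S R \<Longrightarrow> a \<in> S \<Longrightarrow> b \<in> S \<Longrightarrow> c \<in> S \<Longrightarrow> d \<in> S \<Longrightarrow> a \<noteq> b \<Longrightarrow> a \<noteq> c \<Longrightarrow> a \<noteq> d \<Longrightarrow> b \<noteq> c
    \<Longrightarrow> b \<noteq> d \<Longrightarrow> c \<noteq> d \<Longrightarrow> R a b \<Longrightarrow> R a c \<Longrightarrow> R b c \<Longrightarrow> R a d \<Longrightarrow> R b d \<Longrightarrow> False"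
  unfolding diamond_free_def by blast

definition neighbourhood :: "'a set \<Rightarrow> ('a \<Rightarrow> 'a \<Rightarrow> bool) \<Rightarrow> 'a \<Rightarrow> 'a set" where
  "neighbourhood S R v = {x \<in> S. x \<noteq> v \<and> R v x}"

context
  fixes S :: "'a set" and R :: "'a \<Rightarrow> 'a \<Rightarrow> bool"
  assumes fin: "finite S" and sym: "\<And>x y. R x y = R y x"
    and R_free: "diamond_free S R" and N_free: "diamond_free S (\<lambda>x y. \<not> R x y)"
begin

text \<open>Two such neighbours \<open>y\<close>, \<open>z\<close> would form a diamond on the edge
  from \<open>v\<close> to \<open>x\<close>.\<close>

lemma card_neighbours_in_neighbourhood:
  assumes "v \<in> S" "x \<in> neighbourhood S R v"
  shows "card {y \<in> neighbourhood S R v. y \<noteq> x \<and> R x y} \<le> 1"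
proof (rule ccontr)
  assume "\<not> ?thesis"
  then have "card {y \<in> neighbourhood S R v. y \<noteq> x \<and> R x y} \<ge> 2" by simp
  then obtain y z where "y \<in> {y \<in> neighbourhood S R v. y \<noteq> x \<and> R x y}"
    "z \<in> {y \<in> neighbourhood S R v. y \<noteq> x \<and> R x y}" "y \<noteq> z"
    by (rule card_ge_2_obtain)
  then show False
    using diamond_freeD[OF R_free, of v x y z] assms by (auto simp: neighbourhood_def)
qed

text \<open>Among three vertices of the neighbourhood, two edges would share an end and form a
  diamond with \<open>v\<close>. So there are two non-edges sharing an end, and these together with
  \<open>x\<close> form a diamond in the complement.\<close>

lemma card_non_neighbours_in_neighbourhood:
  assumes "v \<in> S" "x \<in> neighbourhood S R v"
  shows "card {y \<in> neighbourhood S R v. y \<noteq> x \<and> \<not> R x y} \<le> 2"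
proof (rule ccontr)
  assume "\<not> ?thesis"
  then have "card {y \<in> neighbourhood S R v. y \<noteq> x \<and> \<not> R x y} \<ge> 3" by simp
  then obtain y z w where yzw: "y \<in> {y \<in> neighbourhood S R v. y \<noteq> x \<and> \<not> R x y}"
    "z \<in> {y \<in> neighbourhood S R v. y \<noteq> x \<and> \<not> R x y}"
    "w \<in> {y \<in> neighbourhood S R v. y \<noteq> x \<and> \<not> R x y}" "y \<noteq> z" "y \<noteq> w" "z \<noteq> w"
    by (rule card_ge_3_obtain)
  then have "\<not> (R y z \<and> R y w)" "\<not> (R y z \<and> R z w)" "\<not> (R y w \<and> R z w)"
    using diamond_freeD[OF R_free, of v y z w] diamond_freeD[OF R_free, of v z y w]
      diamond_freeD[OF R_free, of v w y z] assms sym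
    by (auto simp: neighbourhood_def)
  then consider "\<not> R y z" "\<not> R y w" | "\<not> R y z" "\<not> R z w" | "\<not> R y w" "\<not> R z w" by blast
  then show False
    using diamond_freeD[OF N_free, of x y z w] diamond_freeD[OF N_free, of x z y w]
      diamond_freeD[OF N_free, of x w y z] assms yzw sym
    by cases (auto simp: neighbourhood_def)
qed

lemma card_neighbourhood_split:
  assumes "x \<in> neighbourhood S R v"
  shows "card (neighbourhood S R v) = 1 + card {y \<in> neighbourhood S R v. y \<noteq> x \<and> R x y} +
    card {y \<in> neighbourhood S R v. y \<noteq> x \<and> \<not> R x y}"
proof -
  have f: "finite (neighbourhood S R v)" using fin by (simp add: neighbourhood_def)
  have e: "neighbourhood S R v = {x} \<union> ({y \<in> neighbourhood S R v. y \<noteq> x \<and> R x y} \<union>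
    {y \<in> neighbourhood S R v. y \<noteq> x \<and> \<not> R x y})" using assms by auto
  have "card (neighbourhood S R v) = card {x} + card ({y \<in> neighbourhood S R v. y \<noteq> x \<and> R x y} \<union>
    {y \<in> neighbourhood S R v. y \<noteq> x \<and> \<not> R x y})"
    by (subst (1) e, rule card_Un_disjoint) (use f in auto)
  also have "card ({y \<in> neighbourhood S R v. y \<noteq> x \<and> R x y} \<union>
    {y \<in> neighbourhood S R v. y \<noteq> x \<and> \<not> R x y}) = card {y \<in> neighbourhood S R v. y \<noteq> x \<and> R x y} +
    card {y \<in> neighbourhood S R v. y \<noteq> x \<and> \<not> R x y}"
    by (rule card_Un_disjoint) (use f in auto)
  finally show ?thesis by simp
qed

lemma card_neighbourhood_le_4:
  assumes "v \<in> S"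
  shows "card (neighbourhood S R v) \<le> 4"
proof (cases "neighbourhood S R v = {}")
  case False
  then obtain x where "x \<in> neighbourhood S R v" by blast
  then show ?thesis
    using card_neighbours_in_neighbourhood[OF assms] card_non_neighbours_in_neighbourhood[OF assms]
      card_neighbourhood_split by fastforce
qed simp

text \<open>A neighbourhood has at most \<open>1 + 1 + 2\<close> vertices. With four of them the
  bounds are sharp, so the neighbourhood pairs off into edges; geometrically these are two lines
  through \<open>v\<close>.\<close>

lemma neighbour_in_neighbourhood:
  assumes "v \<in> S" "x \<in> neighbourhood S R v" "card (neighbourhood S R v) \<ge> 4"
  obtains y where "y \<in> neighbourhood S R v" "y \<noteq> x" "R x y"
proof -
  have "card {y \<in> neighbourhood S R v. y \<noteq> x \<and> R x y} \<noteq> 0"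
    using card_non_neighbours_in_neighbourhood[OF assms(1,2)] card_neighbourhood_split[OF assms(2)] assms(3)
    by linarith
  then have "{y \<in> neighbourhood S R v. y \<noteq> x \<and> R x y} \<noteq> {}" by (metis card.empty)
  then show ?thesis using that by blast
qed

end

lemma card_le_neighbourhoods:
  assumes "finite S" "v \<in> S"
  shows "card S \<le> 1 + card (neighbourhood S R v) + card (neighbourhood S (\<lambda>x y. \<not> R x y) v)"
proof -
  have "S \<subseteq> {v} \<union> (neighbourhood S R v \<union> neighbourhood S (\<lambda>x y. \<not> R x y) v)"
    by (auto simp: neighbourhood_def)
  then have "card S \<le> card ({v} \<union> (neighbourhood S R v \<union> neighbourhood S (\<lambda>x y. \<not> R x y) v))"
    using assms(1) by (intro card_mono) (auto simp: neighbourhood_def)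
  also have "\<dots> \<le> card {v} + card (neighbourhood S R v \<union> neighbourhood S (\<lambda>x y. \<not> R x y) v)"
    by (rule card_Un_le)
  also have "\<dots> \<le> 1 + (card (neighbourhood S R v) + card (neighbourhood S (\<lambda>x y. \<not> R x y) v))"
    using card_Un_le[of "neighbourhood S R v" "neighbourhood S (\<lambda>x y. \<not> R x y) v"] by simp
  finally show ?thesis by simp
qed

text \<open>This is the upper bound in \<open>R(K\<^sub>4 - e, K\<^sub>4 - e) = 10\<close>.\<close>

lemma card_le_9_if_diamond_free:
  assumes "finite S" and sym: "\<And>x y. R x y = R y x"
    and "diamond_free S R" "diamond_free S (\<lambda>x y. \<not> R x y)"
  shows "card S \<le> 9"
proof (cases "S = {}")
  case False
  then obtain v where v: "v \<in> S" by blast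
  have "card (neighbourhood S R v) \<le> 4"
    by (rule card_neighbourhood_le_4) (use assms v in auto)
  moreover have "card (neighbourhood S (\<lambda>x y. \<not> R x y) v) \<le> 4"
    by (rule card_neighbourhood_le_4) (use assms v in auto)
  ultimately show ?thesis using card_le_neighbourhoods[OF assms(1) v, of R] by linarith
qed simp

section \<open>Diamonds in matchings of chambers\<close>

context thick_gq begin

text \<open>A point off \<open>m\<close> is collinear with at most one point of \<open>T\<close>, so
  its line in \<open>S\<close> meets the lines of the other chambers of \<open>T\<close>. If two
  chambers of \<open>U\<close> had non-collinear points, their lines would meet in some
  \<open>X\<close>, and two lines of \<open>K\<close> met by both would pass through
  \<open>X\<close> as well; but lines of \<open>K\<close> are disjoint. So \<open>U\<close> is
  pairwise collinear, and \<open>T\<close> and \<open>U\<close> have at most \<open>s + 1\<close>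
  elements each.\<close>

lemma four_on_line:
  assumes S: "max_ind_chambers G S" and inj: "inj_on fst S" "inj_on snd S"
    and m: "m \<in> lines G" and T4: "card {c \<in> S. inc G (fst c) m} \<ge> 4"
  shows "card S \<le> 2 * (s + 1)"
proof -
  define T where "T = {c \<in> S. inc G (fst c) m}"
  define U where "U = S - T"
  define K where "K = {a \<in> T. snd a \<noteq> m}"
  have finS: "finite S" by (rule finite_max_ind_chambers[OF S])
  have ch: "fst c \<in> points G \<and> snd c \<in> lines G \<and> inc G (fst c) (snd c)" if "c \<in> S" for c
    using max_ind_chambers_chamber[OF S, of "fst c" "snd c"] that by simp
  have rel: "coll (fst c) (fst d) \<or> conc (snd c) (snd d)" if "c \<in> S" "d \<in> S" for c d
    using max_ind_chambers_not_opposite[OF S, of "fst c" "snd c" "fst d" "snd d"] that by simp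
  have TS: "c \<in> S" "inc G (fst c) m" if "c \<in> T" for c using that by (auto simp: T_def)
  have US: "c \<in> S" "\<not> inc G (fst c) m" if "c \<in> U" for c using that by (auto simp: T_def U_def)
  have KT: "c \<in> T" "snd c \<noteq> m" if "c \<in> K" for c using that by (auto simp: K_def)
  have fne: "fst a \<noteq> fst b" and sne: "snd a \<noteq> snd b" if "a \<in> S" "b \<in> S" "a \<noteq> b" for a b
    using inj that by (auto simp: inj_on_def)
  have one_coll: "a = b" if "c \<in> U" "a \<in> T" "b \<in> T" "coll (fst c) (fst a)" "coll (fst c) (fst b)" for a b c
  proof (rule ccontr)
    assume "a \<noteq> b"
    then show False
      using no_triangle[of "fst c" m "fst a" "fst b"] that US[of c] TS[of a] TS[of b] ch[of a] ch[of b]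
        ch[of c] fne[of a b] m by simp
  qed
  have concm: "conc (snd a) m" if "a \<in> T" for a
    using concurrent_linesI[of "fst a" G "snd a" m] TS[OF that] ch[of a] by simp
  have disj: "\<not> conc (snd a) (snd b)" if "a \<in> K" "b \<in> K" "a \<noteq> b" for a b
  proof
    assume c: "conc (snd a) (snd b)"
    note ab = KT[OF that(1)] KT[OF that(2)]
    note abS = TS[OF ab(1)] TS[OF ab(3)]
    have "inc G (fst b) (snd a)"
      using no_triangle_lines[of "snd a" "fst b" "snd b" m] c concm[OF ab(1)] ab abS ch[of a] ch[of b] m
      by simp
    then show False
      using line_unique[of "fst a" "fst b" "snd a" m] ab abS ch[of a] ch[of b] m fne[of a b] that by simp
  qed
  have T4: "card T \<ge> 4" and finT: "finite T" using T4 finS by (simp_all add: T_def)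
  have "card {a \<in> T. snd a = m} \<le> 1"
    using finT inj(2) TS(1) unfolding inj_on_def by (simp add: card_le_Suc0_iff_eq)
  moreover have "card T = card K + card {a \<in> T. snd a = m}"
    using finT by (subst card_Un_disjoint[symmetric]) (auto simp: K_def intro: arg_cong[where f = card])
  ultimately have K3: "card K \<ge> 3" using T4 by linarith
  have finK: "finite K" using finT by (simp add: K_def)
  \<comment> \<open>If \<open>m\<close> is itself a line of \<open>S\<close>, then \<open>K\<close>
    has at least three elements and every line of \<open>U\<close> meets all lines of
    \<open>K\<close>: a line of \<open>U\<close> missing one of them would meet \<open>m\<close> and
    two others of \<open>K\<close>, hence equal \<open>m\<close>. If it is not, then
    \<open>K = T\<close>, and each of \<open>c\<close> and \<open>d\<close> excludes at most one of
    at least four chambers.\<close>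
  have common: "\<exists>a b. a \<in> K \<and> b \<in> K \<and> a \<noteq> b \<and> conc (snd c) (snd a) \<and> conc (snd c) (snd b) \<and>
    conc (snd d) (snd a) \<and> conc (snd d) (snd b)" if cd: "c \<in> U" "d \<in> U" for c d
  proof (cases "\<exists>a0\<in>T. snd a0 = m")
    case True
    then obtain a0 where a0: "a0 \<in> T" "snd a0 = m" by blast
    have all: "conc (snd c) (snd a)" if c: "c \<in> U" and a: "a \<in> K" for a c
    proof (rule ccontr)
      assume n: "\<not> conc (snd c) (snd a)"
      note cS = US[OF c] and aT = KT[OF a]
      have ca: "coll (fst c) (fst a)" using rel[of c a] n cS TS[OF aT(1)] by blast
      have conc_if: "conc (snd c) (snd b)" if "b \<in> T" "b \<noteq> a" for b
        using one_coll[of c a b] ca c aT that rel[of c b] cS TS[of b] by blast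
      have cm: "conc (snd c) m" using conc_if[of a0] a0 aT by auto
      have "card (K - {a}) \<ge> 2" using K3 a finK by simp
      then obtain b b' where b: "b \<in> K - {a}" "b' \<in> K - {a}" "b \<noteq> b'" by (rule card_ge_2_obtain)
      have on: "inc G (fst e) (snd c)" if "e \<in> K - {a}" for e
        using no_triangle_lines[of "snd c" "fst e" "snd e" m] conc_if[of e] cm KT[of e] TS[of e] ch[of e]
          ch[of c] cS m that by simp
      have "snd c = m"
        using line_unique[of "fst b" "fst b'" "snd c" m] on[OF b(1)] on[OF b(2)] KT[of b] KT[of b'] TS[of b]
          TS[of b'] ch[of b] ch[of b'] ch[of c] cS m b fne[of b b'] by simp
      then show False using cS ch[of c] by simp
    qed
    have "card K \<ge> 2" using K3 by simp
    then obtain a b where "a \<in> K" "b \<in> K" "a \<noteq> b" by (rule card_ge_2_obtain)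
    then show ?thesis using all cd by blast
  next
    case False
    then have KeqT: "K = T" by (auto simp: K_def)
    define M where "M = {a \<in> K. conc (snd c) (snd a) \<and> conc (snd d) (snd a)}"
    have le1: "card {a \<in> T. coll (fst e) (fst a)} \<le> 1" if "e \<in> U" for e
      using one_coll[OF that] finT by (auto simp: card_le_Suc0_iff_eq)
    have "T \<subseteq> M \<union> ({a \<in> T. coll (fst c) (fst a)} \<union> {a \<in> T. coll (fst d) (fst a)})"
      using rel[OF US(1)[OF cd(1)] TS(1)] rel[OF US(1)[OF cd(2)] TS(1)] KeqT unfolding M_def by blast
    then have "card T \<le> card (M \<union> ({a \<in> T. coll (fst c) (fst a)} \<union> {a \<in> T. coll (fst d) (fst a)}))"
      using finT KeqT by (intro card_mono) (auto simp: M_def)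
    also have "\<dots> \<le> card M + card ({a \<in> T. coll (fst c) (fst a)} \<union> {a \<in> T. coll (fst d) (fst a)})"
      by (rule card_Un_le)
    also have "\<dots> \<le> card M + (card {a \<in> T. coll (fst c) (fst a)} + card {a \<in> T. coll (fst d) (fst a)})"
      using card_Un_le by simp
    also have "\<dots> \<le> card M + 2" using le1[OF cd(1)] le1[OF cd(2)] by simp
    finally have "card M \<ge> 2" using T4 by simp
    then obtain a b where "a \<in> M" "b \<in> M" "a \<noteq> b" by (rule card_ge_2_obtain)
    then show ?thesis unfolding M_def by blast
  qed
  have coll_U: "coll (fst c) (fst d)" if cd: "c \<in> U" "d \<in> U" for c d
  proof (rule ccontr)
    assume n: "\<not> coll (fst c) (fst d)"
    note cS = US[OF cd(1)] and dS = US[OF cd(2)]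
    have "c \<noteq> d" using n coll_refl ch[OF cS(1)] by auto
    have "conc (snd c) (snd d)" using rel[of c d] n cS dS by blast
    then obtain X where X: "X \<in> points G" "inc G X (snd c)" "inc G X (snd d)"
      by (auto simp: concurrent_lines_def)
    obtain a b where ab: "a \<in> K" "b \<in> K" "a \<noteq> b" "conc (snd c) (snd a)" "conc (snd c) (snd b)"
      "conc (snd d) (snd a)" "conc (snd d) (snd b)" using common[OF cd] by blast
    have on: "inc G X (snd e)" if "e \<in> K" "conc (snd c) (snd e)" "conc (snd d) (snd e)" for e
      using no_triangle_lines[of "snd e" X "snd c" "snd d"] X that KT[of e] TS[of e] ch[of e] ch[of c]
        ch[of d] cS dS sne[of c d] \<open>c \<noteq> d\<close> concurrent_lines_sym[of G] by simp
    have "conc (snd a) (snd b)"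
      using concurrent_linesI[of X G] on[of a] on[of b] ab X by simp
    then show False using disj ab by blast
  qed
  have "card T \<le> s + 1"
    by (rule card_le_if_on_line[OF m]) (use inj TS ch in \<open>auto simp: inj_on_def\<close>)
  moreover have "card U \<le> s + 1"
    by (rule card_le_if_pairwise_coll) (use inj US ch coll_U in \<open>auto simp: inj_on_def\<close>)
  moreover have "card S = card T + card U"
    using finS by (subst card_Un_disjoint[symmetric]) (auto simp: U_def T_def intro: arg_cong[where f = card])
  ultimately show ?thesis by simp
qed

text \<open>The ends of the shared edge span a line, and the other two points are on it because
  there are no triangles.\<close>

lemma four_on_line_if_diamond:
  assumes S: "max_ind_chambers G S" and inj: "inj_on fst S"
    and "\<not> diamond_free S (\<lambda>c d. coll (fst c) (fst d))"
  shows "\<exists>m\<in>lines G. card {c \<in> S. inc G (fst c) m} \<ge> 4"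
proof -
  have ch: "fst c \<in> points G" if "c \<in> S" for c
    using max_ind_chambers_chamber[OF S, of "fst c" "snd c"] that by simp
  obtain a b c d where abcd: "a \<in> S" "b \<in> S" "c \<in> S" "d \<in> S"
    "a \<noteq> b" "a \<noteq> c" "a \<noteq> d" "b \<noteq> c" "b \<noteq> d" "c \<noteq> d"
    "coll (fst a) (fst b)" "coll (fst a) (fst c)" "coll (fst b) (fst c)" "coll (fst a) (fst d)"
    "coll (fst b) (fst d)"
    using assms(3) unfolding diamond_free_def by metis
  obtain m where m: "m \<in> lines G" "inc G (fst a) m" "inc G (fst b) m"
    using abcd(11) by (auto simp: collinear_points_def)
  have "fst a \<noteq> fst b" using inj abcd by (auto simp: inj_on_def)
  then have on: "inc G (fst e) m" if "e \<in> S" "coll (fst a) (fst e)" "coll (fst b) (fst e)" for e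
    using no_triangle[of "fst e" m "fst a" "fst b"] m that ch abcd collinear_points_sym[of G] by metis
  have "card {a, b, c, d} \<le> card {c \<in> S. inc G (fst c) m}"
    using abcd on m finite_max_ind_chambers[OF S] by (intro card_mono) auto
  moreover have "card {a, b, c, d} = 4" using abcd by simp
  ultimately show ?thesis using m by auto
qed

lemma matching_bound_if_diamond:
  assumes S: "max_ind_chambers G S" and inj: "inj_on fst S" "inj_on snd S"
    and "\<not> diamond_free S (\<lambda>c d. coll (fst c) (fst d))"
  shows "card S \<le> 2 * (s + 1)"
  using four_on_line_if_diamond[OF S inj(1) assms(4)] four_on_line[OF S inj] by blast

lemma inj_swap_prod: "inj (prod.swap :: 'a \<times> 'b \<Rightarrow> _)"
  by (simp add: inj_on_def)

lemma inj_swap: "inj_on snd S \<Longrightarrow> inj_on fst (prod.swap ` S)" "inj_on fst S \<Longrightarrow> inj_on snd (prod.swap ` S)"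
  by (auto simp: inj_on_def)

text \<open>Non-collinear points of \<open>S\<close> belong to concurrent lines of \<open>S\<close>,
  so a diamond in the complement is a diamond of collinearity in the dual quadrangle.\<close>

lemma matching_bound_if_dual_diamond:
  assumes S: "max_ind_chambers G S" and inj: "inj_on fst S" "inj_on snd S"
    and "\<not> diamond_free S (\<lambda>c d. \<not> coll (fst c) (fst d))"
  shows "card S \<le> 2 * (t + 1)"
proof -
  have rel: "conc (snd c) (snd d)" if "c \<in> S" "d \<in> S" "\<not> coll (fst c) (fst d)" for c d
    using max_ind_chambers_not_opposite[OF S, of "fst c" "snd c" "fst d" "snd d"] that by simp
  obtain a b c d where abcd: "a \<in> S" "b \<in> S" "c \<in> S" "d \<in> S"
    "a \<noteq> b" "a \<noteq> c" "a \<noteq> d" "b \<noteq> c" "b \<noteq> d" "c \<noteq> d"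
    "\<not> coll (fst a) (fst b)" "\<not> coll (fst a) (fst c)" "\<not> coll (fst b) (fst c)" "\<not> coll (fst a) (fst d)"
    "\<not> coll (fst b) (fst d)"
    using assms(4) unfolding diamond_free_def by metis
  have "\<not> diamond_free (prod.swap ` S)
     (\<lambda>c d. collinear_points (dual_structure G) (fst c) (fst d))"
  proof
    assume "diamond_free (prod.swap ` S) (\<lambda>c d. collinear_points (dual_structure G) (fst c) (fst d))"
    from diamond_freeD[OF this, of "prod.swap a" "prod.swap b" "prod.swap c" "prod.swap d"]
    show False using abcd rel by (simp add: inj_eq[OF inj_swap_prod])
  qed
  then have "card (prod.swap ` S) \<le> 2 * (t + 1)"
    using thick_gq.matching_bound_if_diamond[OF dual max_ind_chambers_dual[OF S]] inj_swap inj by blast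
  then show ?thesis by (simp add: card_image)
qed

lemma matching_bound:
  assumes S: "max_ind_chambers G S" and inj: "inj_on fst S" "inj_on snd S"
  shows "card S \<le> max (1 + s + 2 * t) (1 + t + 2 * s) \<or>
    card S \<le> 9 \<and> diamond_free S (\<lambda>c d. coll (fst c) (fst d)) \<and> diamond_free S (\<lambda>c d. \<not> coll (fst c) (fst d))"
proof (cases "diamond_free S (\<lambda>c d. coll (fst c) (fst d)) \<and> diamond_free S (\<lambda>c d. \<not> coll (fst c) (fst d))")
  case True
  have "card S \<le> 9"
    by (rule card_le_9_if_diamond_free[of S "\<lambda>c d. coll (fst c) (fst d)"])
      (use True finite_max_ind_chambers[OF S] in \<open>auto simp: collinear_points_sym\<close>)
  then show ?thesis using True by blast
next
  case False
  then have "card S \<le> 2 * (s + 1) \<or> card S \<le> 2 * (t + 1)"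
    using matching_bound_if_diamond[OF S inj] matching_bound_if_dual_diamond[OF S inj] by blast
  then show ?thesis using s_ge_2 t_ge_2 by auto
qed

theorem max_ind_chambers_cases:
  assumes S: "max_ind_chambers G S" and large: "card S > max (1 + s + 2 * t) (1 + t + 2 * s)"
  shows "S \<in> F_point G ` points G \<union> F_line G ` lines G \<or>
    s = 2 \<and> t = 2 \<and> card S \<le> 9 \<and> inj_on fst S \<and> inj_on snd S \<and>
    diamond_free S (\<lambda>c d. coll (fst c) (fst d)) \<and> diamond_free S (\<lambda>c d. \<not> coll (fst c) (fst d))"
proof -
  define FL where "FL l \<longleftrightarrow> (\<exists>P Q. (P, l) \<in> S \<and> (Q, l) \<in> S \<and> P \<noteq> Q)" for l
  define FP where "FP P \<longleftrightarrow> (\<exists>l m. (P, l) \<in> S \<and> (P, m) \<in> S \<and> l \<noteq> m)" for P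
  note S' = max_ind_chambers_dual[OF S]
  have cS': "card (prod.swap ` S) = card S" by (simp add: card_image)
  have mem': "(l, P) \<in> prod.swap ` S \<longleftrightarrow> (P, l) \<in> S" for l P by force
  consider (two_lines) l m where "FL l" "FL m" "l \<noteq> m"
    | (two_points) P Q where "FP P" "FP Q" "P \<noteq> Q"
    | (line_point) l P where "FL l" "FP P" "\<And>m. FL m \<Longrightarrow> m = l" "\<And>Q. FP Q \<Longrightarrow> Q = P"
    | (line) l where "FL l" "\<And>m. FL m \<Longrightarrow> m = l" "\<And>P. \<not> FP P"
    | (point) P where "FP P" "\<And>Q. FP Q \<Longrightarrow> Q = P" "\<And>l. \<not> FL l"
    | (none) "\<And>P. \<not> FP P" "\<And>l. \<not> FL l"
    by (cases "\<exists>l. FL l"; cases "\<exists>P. FP P") metis+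
  then show ?thesis
  proof cases
    case two_lines
    then show ?thesis using two_full_lines[OF S] unfolding FL_def by blast
  next
    case two_points
    then obtain l m l' m' where *: "(P, l) \<in> S" "(P, m) \<in> S" "l \<noteq> m" "(Q, l') \<in> S" "(Q, m') \<in> S" "l' \<noteq> m'"
      unfolding FP_def by blast
    then have "\<exists>n\<in>points (dual_structure G). prod.swap ` S = F_point (dual_structure G) n"
      using thick_gq.two_full_lines[OF dual S', of l P m l' Q m'] two_points(3) unfolding mem' by simp
    then obtain n where n: "n \<in> lines G" "prod.swap ` S = prod.swap ` F_line G n"
      by (auto simp: F_point_dual)
    then have "S = F_line G n" by (simp add: inj_image_eq_iff[OF inj_swap_prod])
    then show ?thesis using n by blast
  next
    case line_point
    obtain P1 Q1 l1 m1 where *: "(P1, l) \<in> S" "(Q1, l) \<in> S" "P1 \<noteq> Q1" "(P, l1) \<in> S" "(P, m1) \<in> S" "l1 \<noteq> m1"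
      using line_point(1,2) unfolding FL_def FP_def by blast
    moreover have "R = R'" if "(R, k) \<in> S" "(R', k) \<in> S" "k \<noteq> l" for R R' k
      using line_point(3)[of k] that unfolding FL_def by blast
    moreover have "k = k'" if "(R, k) \<in> S" "(R, k') \<in> S" "R \<noteq> P" for R k k'
      using line_point(4)[of R] that unfolding FP_def by blast
    ultimately have "card S \<le> 1 + s + 2 * t"
      by (rule full_line_full_point[OF S])
    then show ?thesis using large by simp
  next
    case line
    have "inj_on fst S"
      using line(3) unfolding FP_def inj_on_def by force
    moreover obtain P Q where "(P, l) \<in> S" "(Q, l) \<in> S" "P \<noteq> Q" using line(1) unfolding FL_def by blast
    moreover have "R = R'" if "(R, k) \<in> S" "(R', k) \<in> S" "k \<noteq> l" for R R' k
      using line(2)[of k] that unfolding FL_def by blast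
    ultimately have "card S \<le> max (1 + s + 2 * t) (1 + t + 2 * s)"
      using one_full_line[OF S, of P l Q] by blast
    then show ?thesis using large by simp
  next
    case point
    have "inj_on snd S"
      using point(3) unfolding FL_def inj_on_def by force
    moreover obtain l m where "(P, l) \<in> S" "(P, m) \<in> S" "l \<noteq> m" using point(1) unfolding FP_def by blast
    moreover have "m = l" if "(Q, l) \<in> S" "(Q, m) \<in> S" "Q \<noteq> P" for l m Q
      using that point(2) unfolding FP_def by blast
    ultimately have "card (prod.swap ` S) \<le> max (1 + t + 2 * s) (1 + s + 2 * t)"
      using thick_gq.one_full_line[OF dual S', of l P m] unfolding mem' using inj_swap(1) by blast
    then show ?thesis using large cS' by simp
  next
    case none
    have "inj_on snd S"
      using none unfolding FL_def inj_on_def by force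
    moreover have "inj_on fst S"
      using none unfolding FP_def inj_on_def by force
    \<comment> \<open>The threshold in \<open>large\<close> is 7 for \<open>s = t = 2\<close> and at
      least 9 for all other orders.\<close>
    moreover have "s = 2 \<and> t = 2" if "card S \<le> 9" using that large s_ge_2 t_ge_2 by linarith
    ultimately show ?thesis using matching_bound[OF S] large by (meson not_le)
  qed
qed

end

section \<open>Grids in generalized quadrangles of order (2, 2)\<close>

text \<open>Neither \<open>b\<close> nor \<open>c\<close> is related to \<open>a\<close> or
  \<open>a'\<close>, as this would give a diamond with \<open>v\<close>. If \<open>b\<close> and
  \<open>c\<close> were unrelated too, they would be the shared edge of a complementary diamond with
  \<open>a\<close> and \<open>a'\<close>. This later forces points of \<open>S\<close> onto a common
  line.\<close>

lemma diamond_free_neighbourhood_edge: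
  assumes fin: "finite S" and sym: "\<And>x y. R x y = R y x"
    and R_free: "diamond_free S R" and N_free: "diamond_free S (\<lambda>x y. \<not> R x y)"
    and v: "v \<in> S" and mem: "a \<in> neighbourhood S R v" "a' \<in> neighbourhood S R v"
      "b \<in> neighbourhood S R v" "c \<in> neighbourhood S R v"
    and ne: "a \<noteq> a'" "a \<noteq> b" "a \<noteq> c" "a' \<noteq> b" "a' \<noteq> c" "b \<noteq> c" and "R a a'"
  shows "R b c"
proof (rule ccontr)
  assume n: "\<not> R b c"
  have no: "\<not> R x z" if "x \<in> neighbourhood S R v" "y \<in> neighbourhood S R v" "z \<in> neighbourhood S R v"
    "x \<noteq> y" "x \<noteq> z" "y \<noteq> z" "R x y" for x y z
    using diamond_freeD[OF R_free, of v x y z] that v by (auto simp: neighbourhood_def)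
  have "\<not> R a b" "\<not> R a c" "\<not> R a' b" "\<not> R a' c"
    using no[of a a' b] no[of a a' c] no[of a' a b] no[of a' a c] mem ne \<open>R a a'\<close> sym[of a a'] by auto
  then show False
    using diamond_freeD[OF N_free, of b c a a'] mem ne n sym by (auto simp: neighbourhood_def)
qed

text \<open>Labels for the three points of a line of order 2. In coordinates they become the three
  nonzero vectors over GF(2) in the plane, with \<open>I2\<close> as the sum of \<open>I0\<close>
  and \<open>I1\<close>.\<close>

datatype idx = I0 | I1 | I2

lemma UNIV_idx: "UNIV = {I0, I1, I2}"
  using idx.exhaust by auto

lemma forall_idx: "(\<forall>i. P i) \<longleftrightarrow> P I0 \<and> P I1 \<and> P I2"
  by (metis idx.exhaust)

instance idx :: finite
  by standard (simp add: UNIV_idx)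

lemma card_idx: "card (UNIV :: idx set) = 3"
  by (simp add: UNIV_idx)

definition grid :: "('p, 'l) incidence_structure \<Rightarrow> (idx \<Rightarrow> idx \<Rightarrow> 'p) \<Rightarrow> bool" where
  "grid G a \<longleftrightarrow> (\<forall>i j. a i j \<in> points G) \<and> (\<forall>i j i' j'. a i j = a i' j' \<longrightarrow> i = i' \<and> j = j') \<and>
     (\<forall>i. \<exists>l\<in>lines G. \<forall>j. inc G (a i j) l) \<and> (\<forall>j. \<exists>l\<in>lines G. \<forall>i. inc G (a i j) l)"

definition grid_points :: "(idx \<Rightarrow> idx \<Rightarrow> 'p) \<Rightarrow> 'p set" where
  "grid_points a = {a i j | i j. True}"

text \<open>The grids of \<open>Q(4,2)\<close> are its hyperbolic quadrics, so these will turn out to be the sets \<open>X\<close>.\<close>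

definition grid_chambers :: "('p, 'l) incidence_structure \<Rightarrow> (idx \<Rightarrow> idx \<Rightarrow> 'p) \<Rightarrow> ('p \<times> 'l) set" where
  "grid_chambers G a = {(P, l) \<in> chambers G. P \<in> grid_points a \<and>
     (\<exists>Q\<in>points G. inc G Q l \<and> Q \<notin> grid_points a)}"

lemma grid_transpose: "grid G a \<Longrightarrow> grid G (\<lambda>i j. a j i)"
  unfolding grid_def by blast

lemma grid_points_transpose: "grid_points (\<lambda>i j. a j i) = grid_points a"
  unfolding grid_points_def by blast

lemma grid_points_mem: "a i j \<in> grid_points a"
  by (auto simp: grid_points_def)

lemma card_grid_points:
  assumes "grid G a"
  shows "card (grid_points a) = 9" "finite (grid_points a)"
proof -
  have e: "grid_points a = (\<lambda>(i, j). a i j) ` UNIV" by (auto simp: grid_points_def)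
  have "inj (\<lambda>(i, j). a i j)" using assms by (auto simp: grid_def inj_on_def)
  then show "card (grid_points a) = 9"
    unfolding e by (subst card_image) (simp_all add: card_idx UNIV_Times_UNIV[symmetric] card_cartesian_product
        del: UNIV_Times_UNIV)
  show "finite (grid_points a)" unfolding e by simp
qed

locale gq22 = thick_gq G 2 2 for G :: "('p, 'l) incidence_structure"
begin

lemma pts_eq:
  assumes "l \<in> lines G" "P \<in> pts l" "Q \<in> pts l" "R \<in> pts l" "P \<noteq> Q" "P \<noteq> R" "Q \<noteq> R"
  shows "pts l = {P, Q, R}"
  by (rule card_subset_eq[symmetric]) (use assms card_pts[OF assms(1)] finite_pts[OF assms(1)] in auto)

lemma third_point:
  assumes "l \<in> lines G" "P \<in> points G" "Q \<in> points G" "inc G P l" "inc G Q l" "P \<noteq> Q"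
  obtains R where "R \<in> points G" "inc G R l" "R \<noteq> P" "R \<noteq> Q" "pts l = {P, Q, R}"
proof -
  have "card (pts l - {P, Q}) = 1"
    using assms card_pts[OF assms(1)] by (subst card_Diff_subset) auto
  then obtain R where "pts l - {P, Q} = {R}" by (auto simp: card_1_singleton_iff)
  then have "R \<in> pts l" "R \<noteq> P" "R \<noteq> Q" by auto
  then show ?thesis using that[of R] pts_eq[of l P Q R] assms by auto
qed

context
  fixes a :: "idx \<Rightarrow> idx \<Rightarrow> 'p"
  assumes grid: "grid G a"
begin

lemma grid_point: "a i j \<in> points G"
  using grid by (simp add: grid_def)

lemma grid_inj: "a i j = a i' j' \<longleftrightarrow> i = i' \<and> j = j'"
  using grid by (auto simp: grid_def)

lemma grid_points_subset: "grid_points a \<subseteq> points G"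
  using grid_point by (auto simp: grid_points_def)

lemma row_pts:
  assumes "l \<in> lines G" "\<And>j. inc G (a i j) l"
  shows "pts l = {a i j | j. True}"
proof -
  have "pts l = {a i I0, a i I1, a i I2}"
    by (rule pts_eq) (use assms grid_point grid_inj in auto)
  also have "\<dots> = a i ` UNIV" by (simp add: UNIV_idx)
  finally show ?thesis by auto
qed

lemma row_obtain:
  obtains l where "l \<in> lines G" "\<And>j. inc G (a i j) l"
  using grid unfolding grid_def by blast

lemma column_obtain:
  obtains l where "l \<in> lines G" "\<And>i. inc G (a i j) l"
  using grid unfolding grid_def by blast

text \<open>A grid point collinear with a point in another row and column would be collinear with
  two points of that row.\<close>

lemma grid_coll: "coll (a i j) (a i' j') \<longleftrightarrow> i = i' \<or> j = j'"
proof
  assume c: "coll (a i j) (a i' j')"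
  show "i = i' \<or> j = j'"
  proof (rule ccontr)
    assume n: "\<not> ?thesis"
    obtain l where l: "l \<in> lines G" "\<And>j. inc G (a i' j) l" using row_obtain by blast
    obtain k where k: "k \<in> lines G" "\<And>i. inc G (a i j) k" using column_obtain by blast
    have "coll (a i j) (a i' j)" using k collinear_pointsI[of k G] by blast
    then have "inc G (a i j) l"
      using no_triangle[of "a i j" l "a i' j" "a i' j'"] c l n grid_point grid_inj by simp
    then show False using row_pts[OF l] grid_point n grid_inj by fastforce
  qed
next
  assume "i = i' \<or> j = j'"
  moreover obtain l where "l \<in> lines G" "\<And>j. inc G (a i j) l" using row_obtain by blast
  moreover obtain k where "k \<in> lines G" "\<And>i. inc G (a i j) k" using column_obtain by blast
  ultimately show "coll (a i j) (a i' j')" by (metis collinear_pointsI)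
qed

end

lemma grid_line_cases:
  assumes grid: "grid G a" and l: "l \<in> lines G" and P: "P \<in> grid_points a" "Q \<in> grid_points a" "P \<noteq> Q"
    "inc G P l" "inc G Q l"
  obtains (row) i where "\<And>j. inc G (a i j) l" | (column) j where "\<And>i. inc G (a i j) l"
proof -
  obtain i j i' j' where ij: "P = a i j" "Q = a i' j'" using P by (auto simp: grid_points_def)
  have "i = i' \<or> j = j'" using grid_coll[OF grid] ij P l collinear_pointsI by metis
  then show ?thesis
  proof
    assume e: "i = i'"
    obtain k where k: "k \<in> lines G" "\<And>j. inc G (a i j) k" using row_obtain[OF grid] by metis
    have "l = k" using line_unique[of P Q l k] l k ij e P grid_point[OF grid] by simp
    then show ?thesis using row k by blast
  next
    assume e: "j = j'"
    obtain k where k: "k \<in> lines G" "\<And>i. inc G (a i j) k" using column_obtain[OF grid] by metis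
    have "l = k" using line_unique[of P Q l k] l k ij e P grid_point[OF grid] by simp
    then show ?thesis using column k by blast
  qed
qed

lemma grid_line_subset:
  assumes "grid G a" and l: "l \<in> lines G" and "P \<in> grid_points a" "Q \<in> grid_points a" "P \<noteq> Q"
    "inc G P l" "inc G Q l"
  shows "pts l \<subseteq> grid_points a"
  using assms
proof (cases rule: grid_line_cases)
  case (row i)
  then have "pts l = {a i j | j. True}" by (rule row_pts[OF assms(1) l])
  then show ?thesis by (auto simp: grid_points_def)
next
  case (column j)
  then have "pts l = {a i j | i. True}" by (rule row_pts[OF grid_transpose[OF assms(1)] l])
  then show ?thesis by (auto simp: grid_points_def)
qed

lemma grid_chambers_D:
  assumes "(P, l) \<in> grid_chambers G a"
  shows "P \<in> grid_points a" "P \<in> points G" "l \<in> lines G" "inc G P l"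
  using assms by (auto simp: grid_chambers_def chambers_def)

lemma tangent_unique_point:
  assumes "grid G a" "(P, l) \<in> grid_chambers G a" "Q \<in> grid_points a" "inc G Q l"
  shows "Q = P"
  using grid_line_subset[OF assms(1), of l P Q] assms grid_chambers_D[OF assms(2)]
  by (auto simp: grid_chambers_def)

text \<open>Of the \<open>t + 1 = 3\<close> lines on a grid point, two are its row and its column.
  The third leaves the grid: another grid point on it would be in the same row or column.\<close>

lemma tangent_lines:
  assumes grid: "grid G a" and P: "P \<in> grid_points a"
  shows "\<exists>l. {l. (P, l) \<in> grid_chambers G a} = {l}"
proof -
  obtain i j where ij: "P = a i j" using P by (auto simp: grid_points_def)
  have Pp: "P \<in> points G" using P grid_points_subset[OF grid] by blast
  obtain r where r: "r \<in> lines G" "\<And>j. inc G (a i j) r" using row_obtain[OF grid] by metis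
  obtain c where c: "c \<in> lines G" "\<And>i. inc G (a i j) c" using column_obtain[OF grid] by metis
  obtain i' where i': "i' \<noteq> i" by (metis idx.distinct(1))
  have rpts: "pts r = {a i j | j. True}" by (rule row_pts[OF grid r])
  have cpts: "pts c = {a i j | i. True}" by (rule row_pts[OF grid_transpose[OF grid] c])
  have "a i' j \<notin> pts r" unfolding rpts using i' grid_inj[OF grid] by auto
  then have rc: "r \<noteq> c" using c grid_point[OF grid] by auto
  have "{l. (P, l) \<in> grid_chambers G a} = lns P - {r, c}"
  proof (intro equalityI subsetI)
    fix l assume "l \<in> {l. (P, l) \<in> grid_chambers G a}"
    then have l: "(P, l) \<in> grid_chambers G a" by simp
    have "pts r \<subseteq> grid_points a" "pts c \<subseteq> grid_points a"
      unfolding rpts cpts by (auto simp: grid_points_def)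
    then have "l \<noteq> r" "l \<noteq> c" using l by (auto simp: grid_chambers_def)
    then show "l \<in> lns P - {r, c}" using grid_chambers_D[OF l] by simp
  next
    fix l assume l: "l \<in> lns P - {r, c}"
    have "\<exists>Q\<in>points G. inc G Q l \<and> Q \<notin> grid_points a"
    proof (rule ccontr)
      assume "\<not> ?thesis"
      moreover have "card (pts l - {P}) = 2"
        using l card_pts Pp by (subst card_Diff_singleton) auto
      then have "pts l - {P} \<noteq> {}" by (metis card.empty zero_neq_numeral)
      ultimately obtain Q where Q: "Q \<in> pts l" "Q \<noteq> P" "Q \<in> grid_points a" by blast
      then obtain k m where km: "Q = a k m" by (auto simp: grid_points_def)
      have "coll (a i j) (a k m)" using l Q km ij collinear_pointsI[of l G "a i j" "a k m"] by simp
      then consider "i = k" | "j = m" using grid_coll[OF grid] by blast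
      then show False
        using line_unique[of P Q l r] line_unique[of P Q l c] l Q km ij r c Pp by cases auto
    qed
    then show "l \<in> {l. (P, l) \<in> grid_chambers G a}"
      using l P Pp by (auto simp: grid_chambers_def chambers_def)
  qed
  moreover have "card (lns P - {r, c}) = 1"
    using card_lns[OF Pp] r c ij rc by (subst card_Diff_subset) auto
  ultimately show ?thesis by (metis card_1_singletonE)
qed

lemma card_grid_chambers:
  assumes grid: "grid G a"
  shows "card (grid_chambers G a) = 9"
proof -
  have "bij_betw fst (grid_chambers G a) (grid_points a)"
    unfolding bij_betw_def
  proof
    show "inj_on fst (grid_chambers G a)"
    proof (rule inj_onI)
      fix x y assume xy: "x \<in> grid_chambers G a" "y \<in> grid_chambers G a" "fst x = fst y"
      obtain P l m where e: "x = (P, l)" "y = (P, m)" using xy(3) by (metis prod.collapse)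
      obtain k where "{l. (P, l) \<in> grid_chambers G a} = {k}"
        using tangent_lines[OF grid] grid_chambers_D(1) xy(1) e by metis
      then have "l = k" "m = k" using e xy by blast+
      then show "x = y" using e by simp
    qed
    show "fst ` grid_chambers G a = grid_points a"
    proof
      show "fst ` grid_chambers G a \<subseteq> grid_points a" using grid_chambers_D(1) by force
      show "grid_points a \<subseteq> fst ` grid_chambers G a"
      proof
        fix P assume "P \<in> grid_points a"
        then obtain l where "{l. (P, l) \<in> grid_chambers G a} = {l}" using tangent_lines[OF grid] by blast
        then have "(P, l) \<in> grid_chambers G a" by blast
        then show "P \<in> fst ` grid_chambers G a" by force
      qed
    qed
  qed
  then show ?thesis using card_grid_points[OF grid] by (simp add: bij_betw_same_card)
qed

text \<open>The line joining a grid point to the projection of that point onto a tangent line is again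
  tangent.\<close>

lemma ind_grid_chambers:
  assumes grid: "grid G a"
  shows "ind_chambers G (grid_chambers G a)"
  unfolding ind_chambers_iff
proof (intro conjI ballI)
  show "grid_chambers G a \<subseteq> chambers G" by (auto simp: grid_chambers_def)
  fix c d assume cd: "c \<in> grid_chambers G a" "d \<in> grid_chambers G a"
  obtain P l Q m where e: "c = (P, l)" "d = (Q, m)" by (metis surj_pair)
  note P = cd(1)[unfolded e] and Q = cd(2)[unfolded e]
  note P' = grid_chambers_D[OF P] and Q' = grid_chambers_D[OF Q]
  have "conc l m" if n: "\<not> coll P Q"
  proof -
    obtain Z where Z: "Z \<in> points G" "inc G Z l" "coll Q Z"
      using projection[OF Q'(2) P'(3)] by blast
    then have "Z \<noteq> P" using n collinear_points_sym[of G] by metis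
    then have Zn: "Z \<notin> grid_points a" using tangent_unique_point[OF grid P] Z by blast
    obtain k where k: "k \<in> lines G" "inc G Q k" "inc G Z k"
      using Z by (auto simp: collinear_points_def)
    have "(Q, k) \<in> grid_chambers G a"
      using k Q' Z Zn by (auto simp: grid_chambers_def chambers_def)
    moreover obtain k' where "{l. (Q, l) \<in> grid_chambers G a} = {k'}"
      using tangent_lines[OF grid Q'(1)] by blast
    ultimately have "k = k'" "m = k'" using Q by blast+
    then have "k = m" by simp
    then show ?thesis using concurrent_linesI[of Z G] Z k by blast
  qed
  then show "\<not> opposite G c d" by (auto simp: opposite_def e)
qed

text \<open>The collinear pairs give three transversals, and \<open>z i\<close> is the third point
  of the transversal \<open>k i\<close>. For \<open>i \<noteq> j\<close>, \<open>z i\<close> is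
  collinear with neither \<open>x j\<close> nor \<open>y j\<close>, so its projection onto
  \<open>k j\<close> can only be \<open>z j\<close>. Thus the three points \<open>z i\<close> are
  pairwise collinear and form the third row.\<close>

lemma grid_of_skew_lines:
  assumes m: "m \<in> lines G" and n: "n \<in> lines G" and skew: "\<not> conc m n"
    and x: "\<And>i. x i \<in> points G" "\<And>i. inc G (x i) m" "\<And>i j. x i = x j \<longleftrightarrow> i = j"
    and y: "\<And>i. y i \<in> points G" "\<And>i. inc G (y i) n" "\<And>i j. y i = y j \<longleftrightarrow> i = j"
    and xy: "\<And>i. coll (x i) (y i)"
  obtains a where "grid G a" "a I0 = x" "a I1 = y"
proof -
  have xny: "x i \<noteq> y j" for i j
  proof
    assume "x i = y j"
    then show False using skew concurrent_linesI[of "x i" G m n] x y by metis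
  qed
  have "\<forall>i. \<exists>l. l \<in> lines G \<and> inc G (x i) l \<and> inc G (y i) l"
    using xy by (auto simp: collinear_points_def)
  then obtain k where k: "\<And>i. k i \<in> lines G" "\<And>i. inc G (x i) (k i)" "\<And>i. inc G (y i) (k i)"
    by metis
  have "\<exists>z. z \<in> points G \<and> inc G z (k i) \<and> z \<noteq> x i \<and> z \<noteq> y i \<and> pts (k i) = {x i, y i, z}" for i
    using third_point[of "k i" "x i" "y i"] k x y xny by metis
  then have "\<exists>z. \<forall>i. z i \<in> points G \<and> inc G (z i) (k i) \<and> z i \<noteq> x i \<and> z i \<noteq> y i \<and>
      pts (k i) = {x i, y i, z i}"
    by (intro choice allI)
  then obtain z where z: "\<And>i. z i \<in> points G" "\<And>i. inc G (z i) (k i)" "\<And>i. z i \<noteq> x i"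
    "\<And>i. z i \<noteq> y i" "\<And>i. pts (k i) = {x i, y i, z i}"
    by blast
  have zx: "\<not> coll (z i) (x j)" if "i \<noteq> j" for i j
  proof
    assume c: "coll (z i) (x j)"
    have "coll (x j) (x i)" using x m collinear_pointsI[of m G] by blast
    then have "inc G (x j) (k i)"
      using no_triangle[of "x j" "k i" "z i" "x i"] c collinear_points_sym[of G] x z k by simp
    then have "k i = m" using line_unique[of "x i" "x j" "k i" m] x k m that by simp
    then show False using skew concurrent_linesI[of "y i" G m n] k y by metis
  qed
  have zy: "\<not> coll (z i) (y j)" if "i \<noteq> j" for i j
  proof
    assume c: "coll (z i) (y j)"
    have "coll (y j) (y i)" using y n collinear_pointsI[of n G] by blast
    then have "inc G (y j) (k i)"
      using no_triangle[of "y j" "k i" "z i" "y i"] c collinear_points_sym[of G] y z k by simp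
    then have "k i = n" using line_unique[of "y i" "y j" "k i" n] y k n that by simp
    then show False using skew concurrent_linesI[of "x i" G m n] k x by metis
  qed
  have zz: "coll (z i) (z j)" if "i \<noteq> j" for i j
  proof -
    obtain Q where Q: "Q \<in> points G" "inc G Q (k j)" "coll (z i) Q"
      using projection[of "z i" "k j"] z k by blast
    then have "Q \<in> {x j, y j, z j}" using z(5)[of j] by blast
    then show ?thesis using zx[OF that] zy[OF that] Q by auto
  qed
  have z_inj: "z i = z j \<longleftrightarrow> i = j" for i j
    using zx[of i j] collinear_pointsI[of "k j" G "z j" "x j"] k z by metis
  have zxy: "z i \<noteq> x j" "z i \<noteq> y j" for i j
    using zx[of i j] zy[of i j] z(3,4)[of i] coll_refl[of "z i"] z(1)[of i] by metis+
  obtain l where l: "l \<in> lines G" "inc G (z I0) l" "inc G (z I1) l"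
    using zz[of I0 I1] by (auto simp: collinear_points_def)
  have "inc G (z I2) l"
    using no_triangle[of "z I2" l "z I0" "z I1"] z(1) l zz[of I2 I0] zz[of I2 I1] z_inj by simp
  then have l': "inc G (z i) l" for i using l by (cases i) auto
  define a where "a i = (case i of I0 \<Rightarrow> x | I1 \<Rightarrow> y | I2 \<Rightarrow> z)" for i
  have "grid G a"
    unfolding grid_def
  proof (intro conjI allI impI)
    show "a i j \<in> points G" for i j using x y z by (cases i) (auto simp: a_def)
    show "i = i'" "j = j'" if "a i j = a i' j'" for i j i' j'
      using that x(3) y(3) z_inj zxy xny xny[symmetric] zxy[symmetric]
      by (cases i; cases i'; simp add: a_def)+
    show "\<exists>l\<in>lines G. \<forall>j. inc G (a i j) l" for i
      using x m y n l l' by (cases i) (auto simp: a_def)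
    show "\<exists>l\<in>lines G. \<forall>i. inc G (a i j) l" for j
      using k z by (intro bexI[of _ "k j"]) (auto simp: a_def forall_idx)
  qed
  then show ?thesis using that[of a] by (simp add: a_def)
qed

end

section \<open>Large matchings come from grids\<close>

context gq22 begin

context
  fixes S :: "('p \<times> 'l) set"
  assumes S: "max_ind_chambers G S" and injf: "inj_on fst S" and injs: "inj_on snd S"
    and S8: "card S \<ge> 8"
begin

abbreviation (input) fcoll :: "'p \<times> 'l \<Rightarrow> 'p \<times> 'l \<Rightarrow> bool" where
  "fcoll \<equiv> \<lambda>c d. coll (fst c) (fst d)"

lemma finS: "finite S"
  by (rule finite_max_ind_chambers[OF S])

lemma S_chamber: "c \<in> S \<Longrightarrow> fst c \<in> points G \<and> snd c \<in> lines G \<and> inc G (fst c) (snd c)"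
  using max_ind_chambers_chamber[OF S, of "fst c" "snd c"] by simp

lemma S_not_opposite: "c \<in> S \<Longrightarrow> d \<in> S \<Longrightarrow> coll (fst c) (fst d) \<or> conc (snd c) (snd d)"
  using max_ind_chambers_not_opposite[OF S, of "fst c" "snd c" "fst d" "snd d"] by simp

lemma R_free: "diamond_free S fcoll" and N_free: "diamond_free S (\<lambda>c d. \<not> fcoll c d)"
  using matching_bound[OF S injf injs] S8 by auto

lemma R_sym: "fcoll c d = fcoll d c"
  by (rule collinear_points_sym)

lemma fst_ne: "c \<in> S \<Longrightarrow> d \<in> S \<Longrightarrow> c \<noteq> d \<Longrightarrow> fst c \<noteq> fst d"
  using injf by (auto simp: inj_on_def)

lemma R_edge:
  assumes "v \<in> S" "a \<in> S" "a' \<in> S" "b \<in> S" "c \<in> S" "fcoll v a" "fcoll v a'" "fcoll v b" "fcoll v c" "fcoll a a'"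
    "distinct [v, a, a', b, c]"
  shows "fcoll b c"
proof -
  have "a \<noteq> v" "a' \<noteq> v" "b \<noteq> v" "c \<noteq> v" using assms(11) by auto
  then show ?thesis
    using diamond_free_neighbourhood_edge[OF finS R_sym R_free N_free, of v a a' b c] assms
    by (simp add: neighbourhood_def)
qed

text \<open>The two lines through \<open>v\<close> form a cross. Its line \<open>m\<close> through
  \<open>p\<close>, \<open>p'\<close> and the line \<open>n\<close> through \<open>u\<close>,
  \<open>q\<close> are skew and span a grid. A point of \<open>S\<close> not collinear with
  \<open>v\<close> is collinear with one of \<open>p\<close>, \<open>p'\<close> and one of
  \<open>q\<close>, \<open>q'\<close>, and \<open>R_edge\<close> places it on a line with two known
  grid points.\<close>

lemma grid_of_cross:
  assumes mem: "v \<in> S" "p \<in> S" "p' \<in> S" "q \<in> S" "q' \<in> S" "u \<in> S"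
    and ne: "distinct [v, p, p', q, q', u]"
    and R: "fcoll v p" "fcoll v p'" "fcoll v q" "fcoll v q'" "fcoll p p'" "fcoll q q'" "fcoll u p" "fcoll u q"
    and nR: "\<not> fcoll p q" "\<not> fcoll p q'" "\<not> fcoll p' q" "\<not> fcoll p' q'" "\<not> fcoll u v" "\<not> fcoll u p'" "\<not> fcoll u q'"
    and nbhd: "\<And>y. y \<in> S \<Longrightarrow> fcoll v y \<Longrightarrow> y \<in> {v, p, p', q, q'}"
    and other: "\<And>y. y \<in> S \<Longrightarrow> \<not> fcoll v y \<Longrightarrow> (fcoll y p \<and> \<not> fcoll y p' \<or> fcoll y p' \<and> \<not> fcoll y p) \<and> (fcoll y q \<and> \<not> fcoll y q' \<or> fcoll y q' \<and> \<not> fcoll y q)"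
    and many: "card {y \<in> S. \<not> fcoll v y} \<ge> 3"
  shows "\<exists>a. grid G a \<and> fst ` S \<subseteq> grid_points a"
proof -
  note ch = mem[THEN S_chamber]
  have fd: "distinct [fst v, fst p, fst p', fst q, fst q', fst u]"
    using ne mem fst_ne by auto
  obtain m where m: "m \<in> lines G" "inc G (fst v) m" "inc G (fst p) m"
    using R(1) by (auto simp: collinear_points_def)
  have pm: "inc G (fst p') m"
    using no_triangle[of "fst p'" m "fst v" "fst p"] m ch fd R R_sym by simp
  obtain m2 where m2: "m2 \<in> lines G" "inc G (fst v) m2" "inc G (fst q) m2"
    using R(3) by (auto simp: collinear_points_def)
  have qm2: "inc G (fst q') m2"
    using no_triangle[of "fst q'" m2 "fst v" "fst q"] m2 ch fd R R_sym by simp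
  obtain n where n: "n \<in> lines G" "inc G (fst u) n" "inc G (fst q) n"
    using R(8) by (auto simp: collinear_points_def)
  obtain k where k: "k \<in> lines G" "inc G (fst u) k" "inc G (fst p) k"
    using R(7) by (auto simp: collinear_points_def)
  have um: "\<not> inc G (fst u) m" using nR(5) collinear_pointsI[OF m(1) _ m(2)] by blast
  have qm: "\<not> inc G (fst q) m" using nR(1) collinear_pointsI[OF m(1) m(3)] by blast
  have skew: "\<not> conc m n"
  proof
    assume "conc m n"
    then obtain X where X: "X \<in> points G" "inc G X m" "inc G X n" by (auto simp: concurrent_lines_def)
    have c: "coll (fst u) X" "coll (fst q) X"
      using collinear_pointsI[OF n(1) n(2) X(3)] collinear_pointsI[OF n(1) n(3) X(3)] by simp_all
    have c': "coll (fst q) (fst v)" using R(3) R_sym by simp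
    have "inc G (fst u) m" if "X \<noteq> fst p"
      by (rule no_triangle[of "fst u" m X "fst p"]) (use that X(1,2) c(1) m(1,3) ch(2,6) R(7) in simp_all)
    moreover have "inc G (fst q) m" if "X \<noteq> fst v"
      by (rule no_triangle[of "fst q" m X "fst v"]) (use that X(1,2) c(2) c' m(1,2) ch(1,4) in simp_all)
    ultimately have "X = fst p" "X = fst v" using um qm by blast+
    then show False using fd by simp
  qed
  \<comment> \<open>The third point of \<open>n\<close>, as \<open>p'\<close> is collinear with
    neither \<open>q\<close> nor \<open>u\<close>.\<close>
  obtain w where w: "w \<in> points G" "inc G w n" "coll (fst p') w"
    using projection[of "fst p'" n] n ch by blast
  have wne: "w \<noteq> fst q" "w \<noteq> fst u"
    using w nR(3,6) R_sym by auto
  define x where "x i = (case i of I0 \<Rightarrow> fst v | I1 \<Rightarrow> fst p | I2 \<Rightarrow> fst p')" for i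
  define y where "y i = (case i of I0 \<Rightarrow> fst q | I1 \<Rightarrow> fst u | I2 \<Rightarrow> w)" for i
  obtain a where a: "grid G a" "a I0 = x" "a I1 = y"
  proof (rule grid_of_skew_lines[OF m(1) n(1) skew, of x y])
    show "x i \<in> points G" "inc G (x i) m" for i
      using ch m pm by (cases i; simp add: x_def)+
    show "x i = x j \<longleftrightarrow> i = j" for i j
      using fd by (cases i; cases j) (auto simp: x_def)
    show "y i \<in> points G" "inc G (y i) n" for i
      using ch n w by (cases i; simp add: y_def)+
    show "y i = y j \<longleftrightarrow> i = j" for i j
      using fd wne by (cases i; cases j) (auto simp: y_def)
    show "coll (x i) (y i)" for i
      using R R_sym w by (cases i) (auto simp: x_def y_def)
  qed blast
  have g0: "x i \<in> grid_points a" "y i \<in> grid_points a" for i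
    using a grid_points_mem by metis+
  have g: "fst v \<in> grid_points a" "fst p \<in> grid_points a" "fst p' \<in> grid_points a"
    "fst q \<in> grid_points a" "fst u \<in> grid_points a"
    using g0(1)[of I0] g0(1)[of I1] g0(1)[of I2] g0(2)[of I0] g0(2)[of I1] by (simp_all add: x_def y_def)
  have step: "fst z \<in> grid_points a"
    if "l \<in> lines G" "inc G A l" "inc G B l" "A \<in> grid_points a" "B \<in> grid_points a" "A \<noteq> B"
      "z \<in> S" "inc G (fst z) l" for z l A B
    using grid_line_subset[OF a(1), of l A B] that S_chamber[of z] by blast
  have on_line: "inc G (fst z) l"
    if "l \<in> lines G" "c \<in> S" "d \<in> S" "c \<noteq> d" "inc G (fst c) l" "inc G (fst d) l" "z \<in> S" "fcoll z c" "fcoll z d"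
    for z c d l
    using no_triangle[of "fst z" l "fst c" "fst d"] that S_chamber fst_ne by simp
  have step2: "fst z \<in> grid_points a"
    if "c \<in> S" "d \<in> S" "c \<noteq> d" "fst c \<in> grid_points a" "fst d \<in> grid_points a" "z \<in> S"
      "fcoll z c" "fcoll z d" "fcoll c d" for z c d
  proof -
    obtain l where l: "l \<in> lines G" "inc G (fst c) l" "inc G (fst d) l"
      using \<open>fcoll c d\<close> by (auto simp: collinear_points_def)
    show ?thesis
      using step[of l "fst c" "fst d" z] on_line[of l c d z] l that fst_ne by blast
  qed
  have gq': "fst q' \<in> grid_points a"
    using step[of m2 "fst v" "fst q" q'] m2 qm2 g fd mem by simp
  define N where "N = {y \<in> S. \<not> fcoll v y}"
  have N: "z \<in> S" "z \<noteq> v" "z \<noteq> p" "z \<noteq> p'" "z \<noteq> q" "z \<noteq> q'" if "z \<in> N" for z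
    using that R ch coll_refl by (auto simp: N_def)
  have uN: "u \<in> N" using mem nR(5) R_sym by (simp add: N_def)
  have Rsym: "fcoll c d \<Longrightarrow> fcoll d c" for c d using R_sym by simp
  text \<open>The four positions of a point of \<open>N\<close> are given by its neighbours among \<open>p, p'\<close> and \<open>q, q'\<close>.\<close>
  have two: False if "z \<in> N" "z' \<in> N" "z \<noteq> z'" "fcoll z c" "fcoll z' c" "fcoll z d" "fcoll z' d"
      "(c, c') = (p, p') \<or> (c, c') = (p', p)" "(d, d') = (q, q') \<or> (d, d') = (q', q)" for z z' c c' d d'
  proof -
    note zN = N[OF that(1)] N[OF that(2)]
    have c1: "c \<in> S" "c' \<in> S" "fcoll c c'" "fcoll c v" "distinct [c, v, c']" "c \<in> {p, p'}" "c' \<in> {p, p'}"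
      using that(8) mem(1-3) ne R(1,2,5) Rsym[OF R(1)] Rsym[OF R(2)] Rsym[OF R(5)] by auto
    have d1: "d \<in> S" "d' \<in> S" "fcoll d d'" "fcoll d v" "distinct [d, v, d']" "d \<in> {q, q'}" "d' \<in> {q, q'}"
      using that(9) mem(1,4,5) ne R(3,4,6) Rsym[OF R(3)] Rsym[OF R(4)] Rsym[OF R(6)] by auto
    have cd: "\<not> fcoll c d" using c1(6) d1(6) nR(1-4) by blast
    have dist: "distinct [c, v, c', z, z']" using c1(5-7) zN that(3) by auto
    have zz: "fcoll z z'"
      by (rule R_edge[of c v c' z z'])
        (use c1 mem(1) zN dist Rsym[OF that(4)] Rsym[OF that(5)] Rsym[OF c1(4)] R(1,2) in auto)
    obtain l where l: "l \<in> lines G" "inc G (fst z) l" "inc G (fst z') l"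
      using zz by (auto simp: collinear_points_def)
    have "inc G (fst c) l" "inc G (fst d) l"
      using on_line[OF l(1) zN(1) zN(7) that(3) l(2,3) c1(1) Rsym[OF that(4)] Rsym[OF that(5)]]
        on_line[OF l(1) zN(1) zN(7) that(3) l(2,3) d1(1) Rsym[OF that(6)] Rsym[OF that(7)]] by simp_all
    then show False using cd collinear_pointsI[OF l(1)] by blast
  qed
  \<comment> \<open>In the neighbourhood of \<open>p\<close>, the edge from \<open>v\<close> to
    \<open>p'\<close> forces \<open>u\<close> and \<open>z\<close> to be collinear. Hence
    \<open>z\<close> is on the line joining \<open>u\<close> to \<open>p\<close>.\<close>
  have pq': "fst z \<in> grid_points a" if "z \<in> N" "fcoll z p" for z
  proof (cases "z = u")
    case False
    have "fcoll u z"
      by (rule R_edge[OF mem(2,1,3,6) N(1)[OF that(1)] Rsym[OF R(1)] R(5) Rsym[OF R(7)] Rsym[OF that(2)] R(2)])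
        (use ne N(2-6)[OF that(1)] False in auto)
    then show ?thesis
      using step2[OF mem(6,2) _ g(5,2) N(1)[OF that(1)] Rsym that(2) R(7)] ne by auto
  qed (use g in simp)
  have p'q: "fst z \<in> grid_points a" if "z \<in> N" "fcoll z q" for z
  proof (cases "z = u")
    case False
    have "fcoll u z"
      by (rule R_edge[OF mem(4,1,5,6) N(1)[OF that(1)] Rsym[OF R(3)] R(6) Rsym[OF R(8)] Rsym[OF that(2)] R(4)])
        (use ne N(2-6)[OF that(1)] False in auto)
    then show ?thesis
      using step2[OF mem(6,4) _ g(5,4) N(1)[OF that(1)] Rsym that(2) R(8)] ne by auto
  qed (use g in simp)
  \<comment> \<open>The position diagonally opposite to \<open>u\<close> shares no line with
    \<open>u\<close>. The hypothesis \<open>many\<close> supplies a third element \<open>z'\<close>,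
    which by \<open>two\<close> is at one of the mixed positions; it is already known to be in the
    grid and provides the line for \<open>z\<close>.\<close>
  have p'q': "fst z \<in> grid_points a" if z: "z \<in> N" "\<not> fcoll z p" "\<not> fcoll z q" for z
  proof -
    have zp': "fcoll z p'" "fcoll z q'" using z other[of z] by (auto simp: N_def)
    have "z \<noteq> u" using z R by auto
    then have "card (N - {u, z}) \<ge> 1"
      using many uN z finS by (subst card_Diff_subset) (auto simp: N_def)
    then obtain z' where z': "z' \<in> N" "z' \<noteq> u" "z' \<noteq> z" by (metis Diff_iff card.empty ex_in_conv insert_iff not_one_le_zero)
    have o: "(fcoll z' p \<and> \<not> fcoll z' p' \<or> fcoll z' p' \<and> \<not> fcoll z' p) \<and> (fcoll z' q \<and> \<not> fcoll z' q' \<or> fcoll z' q' \<and> \<not> fcoll z' q)"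
      using other[of z'] z' by (auto simp: N_def)
    have "\<not> (fcoll z' p \<and> fcoll z' q)"
      using two[of z' u p q p' q'] z' uN R by blast
    moreover have "\<not> (fcoll z' p' \<and> fcoll z' q')"
      using two[of z' z p' q' p q] z' z zp' by blast
    ultimately consider "fcoll z' p" "fcoll z' q'" | "fcoll z' p'" "fcoll z' q" using o by blast
    then show ?thesis
    proof cases
      case 1
      have "fcoll z z'"
        by (rule R_edge[OF mem(5,1,4) N(1)[OF z(1)] N(1)[OF z'(1)] Rsym[OF R(4)] Rsym[OF R(6)]
            Rsym[OF zp'(2)] Rsym[OF 1(2)] R(3)])
          (use ne N(2-6)[OF z(1)] N(2-6)[OF z'(1)] z'(3) in auto)
      then show ?thesis
        using step2[OF N(1)[OF z'(1)] mem(5) N(6)[OF z'(1)] pq'[OF z'(1) 1(1)] gq' N(1)[OF z(1)]]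
          zp'(2) 1(2) by blast
    next
      case 2
      have "fcoll z z'"
        by (rule R_edge[OF mem(3,1,2) N(1)[OF z(1)] N(1)[OF z'(1)] Rsym[OF R(2)] Rsym[OF R(5)]
            Rsym[OF zp'(1)] Rsym[OF 2(1)] R(1)])
          (use ne N(2-6)[OF z(1)] N(2-6)[OF z'(1)] z'(3) in auto)
      then show ?thesis
        using step2[OF N(1)[OF z'(1)] mem(3) N(4)[OF z'(1)] p'q[OF z'(1) 2(2)] g(3) N(1)[OF z(1)]]
          zp'(1) 2(1) by blast
    qed
  qed
  have "fst z \<in> grid_points a" if "z \<in> S" for z
  proof (cases "fcoll v z")
    case True
    then show ?thesis using nbhd[OF that True] g gq' by (elim insertE) simp_all
  next
    case False
    then have "z \<in> N" using that by (simp add: N_def)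
    then show ?thesis using pq'[of z] p'q[of z] p'q'[of z] by blast
  qed
  then show ?thesis using a(1) by blast
qed

lemma grid_if_four_neighbours:
  assumes v: "v \<in> S" and four: "card (neighbourhood S fcoll v) \<ge> 4"
  shows "\<exists>a. grid G a \<and> fst ` S \<subseteq> grid_points a"
proof -
  let ?N = "neighbourhood S fcoll v"
  have finN: "finite ?N" using finS by (simp add: neighbourhood_def)
  have Rsym: "fcoll c d \<Longrightarrow> fcoll d c" for c d using R_sym by simp
  have N4: "card ?N = 4" using card_neighbourhood_le_4[OF finS R_sym R_free N_free v] four by simp
  have partner: "\<exists>y. y \<in> ?N \<and> y \<noteq> x \<and> fcoll x y" if "x \<in> ?N" for x
    using neighbour_in_neighbourhood[OF finS R_sym R_free N_free v that four] by blast
  have one: "y = z" if "x \<in> ?N" "y \<in> ?N" "z \<in> ?N" "y \<noteq> x" "z \<noteq> x" "fcoll x y" "fcoll x z" for x y z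
  proof -
    have "finite {y \<in> ?N. y \<noteq> x \<and> fcoll x y}" using finN by simp
    moreover have "card {y \<in> ?N. y \<noteq> x \<and> fcoll x y} \<le> Suc 0"
      using card_neighbours_in_neighbourhood[OF finS R_sym R_free N_free v that(1)] by simp
    ultimately have "\<forall>y \<in> {y \<in> ?N. y \<noteq> x \<and> fcoll x y}. \<forall>z \<in> {y \<in> ?N. y \<noteq> x \<and> fcoll x y}. y = z"
      using card_le_Suc0_iff_eq by blast
    then show ?thesis using that by blast
  qed
  have "?N \<noteq> {}" using N4 by (metis card.empty zero_neq_numeral)
  then obtain p where p: "p \<in> ?N" by blast
  obtain p' where p': "p' \<in> ?N" "p' \<noteq> p" "fcoll p p'" using partner[OF p] by blast
  have "card (?N - {p, p'}) = 2"
    using N4 p p' finN by (subst card_Diff_subset) auto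
  then have "?N - {p, p'} \<noteq> {}" by (metis card.empty zero_neq_numeral)
  then obtain q where q: "q \<in> ?N" "q \<noteq> p" "q \<noteq> p'" by blast
  obtain q' where q': "q' \<in> ?N" "q' \<noteq> q" "fcoll q q'" using partner[OF q(1)] by blast
  have nR: "\<not> fcoll p q" "\<not> fcoll p' q" using one[of p p' q] one[of p' p q] p p' q Rsym by blast+
  then have q'ne: "q' \<noteq> p" "q' \<noteq> p'" using q'(3) Rsym by blast+
  have nR': "\<not> fcoll p q'" "\<not> fcoll p' q'" using one[of p p' q'] one[of p' p q'] p p' q'(1) q'ne Rsym by blast+
  have Neq: "?N = {p, p', q, q'}"
    by (rule card_subset_eq[symmetric]) (use finN p p' q q' q'ne N4 in auto)
  have mem: "p \<in> S" "p' \<in> S" "q \<in> S" "q' \<in> S" "fcoll v p" "fcoll v p'" "fcoll v q" "fcoll v q'"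
    "p \<noteq> v" "p' \<noteq> v" "q \<noteq> v" "q' \<noteq> v"
    using p p' q q' by (auto simp: neighbourhood_def)
  have ch: "fst c \<in> points G" if "c \<in> S" for c using S_chamber that by blast
  have nbhd: "y \<in> {v, p, p', q, q'}" if "y \<in> S" "fcoll v y" for y
    using Neq that by (auto simp: neighbourhood_def)
  have "card S \<le> 1 + card ?N + card (neighbourhood S (\<lambda>x y. \<not> fcoll x y) v)"
    by (rule card_le_neighbourhoods[OF finS v])
  moreover have "neighbourhood S (\<lambda>x y. \<not> fcoll x y) v = {y \<in> S. \<not> fcoll v y}"
    using coll_refl ch[OF v] by (auto simp: neighbourhood_def)
  \<comment> \<open>From \<open>8 \<le> 1 + 4 + x\<close>, where \<open>x\<close> counts the
    chambers with point not collinear with that of \<open>v\<close>.\<close>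
  ultimately have many: "card {y \<in> S. \<not> fcoll v y} \<ge> 3" using S8 N4 by simp
  \<comment> \<open>The points of \<open>v\<close>, \<open>c\<close>, \<open>d\<close> are all the
    points of a line, so the projection onto it selects exactly one of them, and \<open>v\<close> is
    excluded.\<close>
  have exactly: "(fcoll y c \<and> \<not> fcoll y d) \<or> (fcoll y d \<and> \<not> fcoll y c)"
    if y: "y \<in> S" "\<not> fcoll v y" "c \<in> S" "d \<in> S" "fcoll v c" "fcoll v d" "fcoll c d" "c \<noteq> d" "c \<noteq> v" "d \<noteq> v" for y c d
  proof -
    obtain m where m: "m \<in> lines G" "inc G (fst v) m" "inc G (fst c) m"
      using y(5) by (auto simp: collinear_points_def)
    have "inc G (fst d) m"
      using no_triangle[of "fst d" m "fst v" "fst c"] m y v ch fst_ne Rsym by metis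
    then have "pts m = {fst v, fst c, fst d}"
      using pts_eq[of m "fst v" "fst c" "fst d"] m y v ch fst_ne by auto
    moreover obtain X where X: "X \<in> points G" "inc G X m" "coll (fst y) X"
      using projection[of "fst y" m] ch y m by blast
    ultimately have "X \<in> {fst v, fst c, fst d}" by blast
    moreover have "\<not> coll (fst y) (fst v)" using y(2) collinear_points_sym by metis
    ultimately have "fcoll y c \<or> fcoll y d" using X(3) by auto
    moreover have "\<not> (fcoll y c \<and> fcoll y d)"
    proof
      assume "fcoll y c \<and> fcoll y d"
      then have "inc G (fst y) m"
        using no_triangle[of "fst y" m "fst c" "fst d"] m y ch fst_ne \<open>inc G (fst d) m\<close> by metis
      then show False using y(2) m collinear_pointsI by metis
    qed
    ultimately show ?thesis by blast
  qed
  have ex_p: "(fcoll y p \<and> \<not> fcoll y p') \<or> (fcoll y p' \<and> \<not> fcoll y p)" if "y \<in> S" "\<not> fcoll v y" for y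
    using exactly[of y p p'] that mem p' by simp
  have ex_q: "(fcoll y q \<and> \<not> fcoll y q') \<or> (fcoll y q' \<and> \<not> fcoll y q)" if "y \<in> S" "\<not> fcoll v y" for y
    using exactly[of y q q'] that mem q' by simp
  have ex_p': "(fcoll y p' \<and> \<not> fcoll y p) \<or> (fcoll y p \<and> \<not> fcoll y p')" if "y \<in> S" "\<not> fcoll v y" for y
    using ex_p[OF that] by blast
  have ex_q': "(fcoll y q' \<and> \<not> fcoll y q) \<or> (fcoll y q \<and> \<not> fcoll y q')" if "y \<in> S" "\<not> fcoll v y" for y
    using ex_q[OF that] by blast
  have "{y \<in> S. \<not> fcoll v y} \<noteq> {}" using many by (metis card.empty not_numeral_le_zero)
  then obtain u where u: "u \<in> S" "\<not> fcoll v u" by blast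
  have ud: "u \<noteq> v" "u \<noteq> p" "u \<noteq> p'" "u \<noteq> q" "u \<noteq> q'"
    using u mem coll_refl ch[OF v] by auto
  have ppq: "p' \<noteq> p" "q' \<noteq> q" "q \<noteq> p" "q \<noteq> p'" "q' \<noteq> p" "q' \<noteq> p'" "fcoll p' p" "fcoll q' q" "\<not> fcoll u v"
    using p' q q' q'ne Rsym u by blast+
  \<comment> \<open>After exchanging \<open>p\<close> with \<open>p'\<close> and \<open>q\<close>
    with \<open>q'\<close> where necessary, \<open>u\<close> is collinear with the first of each
    pair.\<close>
  consider "fcoll u p" "\<not> fcoll u p'" "fcoll u q" "\<not> fcoll u q'" | "fcoll u p" "\<not> fcoll u p'" "fcoll u q'" "\<not> fcoll u q"
    | "fcoll u p'" "\<not> fcoll u p" "fcoll u q" "\<not> fcoll u q'" | "fcoll u p'" "\<not> fcoll u p" "fcoll u q'" "\<not> fcoll u q"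
    using ex_p[OF u] ex_q[OF u] by blast
  then show ?thesis
  proof cases
    case 1
    show ?thesis
      by (rule grid_of_cross[of v p p' q q' u])
        (use 1 mem v u ud ppq p'(3) q'(3) nR nR' nbhd ex_p ex_q many in auto)
  next
    case 2
    show ?thesis
      by (rule grid_of_cross[of v p p' q' q u])
        (use 2 mem v u ud ppq p'(3) q'(3) nR nR' nbhd ex_p ex_q' many in auto)
  next
    case 3
    show ?thesis
      by (rule grid_of_cross[of v p' p q q' u])
        (use 3 mem v u ud ppq p'(3) q'(3) nR nR' nbhd ex_p' ex_q many in auto)
  next
    case 4
    show ?thesis
      by (rule grid_of_cross[of v p' p q' q u])
        (use 4 mem v u ud ppq p'(3) q'(3) nR nR' nbhd ex_p' ex_q' many in auto)
  qed
qed

text \<open>If the line of \<open>c\<close> is row \<open>i\<close>, then in each of the two columns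
  not through \<open>c\<close> one of the two points off row \<open>i\<close> is missing from
  \<open>S\<close>: the line of such a point has to meet row \<open>i\<close> and is therefore the
  column, and \<open>S\<close> uses each line at most once. This leaves at most
  \<open>9 - 2 = 7\<close> chambers.\<close>

lemma not_in_row:
  assumes grid: "grid G a" and sub: "fst ` S \<subseteq> grid_points a"
    and c: "c \<in> S" "fst c = a i j" "\<And>k. inc G (a i k) (snd c)"
  shows False
proof -
  have gp: "a i j \<in> points G" for i j by (rule grid_point[OF grid])
  have missing: "\<exists>i'. i' \<noteq> i \<and> a i' k \<notin> fst ` S" if "k \<noteq> j" for k
  proof (rule ccontr)
    assume n: "\<not> ?thesis"
    obtain col where col: "col \<in> lines G" "\<And>i. inc G (a i k) col" using column_obtain[OF grid] by blast
    have snd_col: "snd d = col" if d: "d \<in> S" "fst d = a i' k" "i' \<noteq> i" for d i'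
    proof -
      have "\<not> coll (fst c) (fst d)" using c d \<open>k \<noteq> j\<close> grid_coll[OF grid] by auto
      then have "conc (snd c) (snd d)" using S_not_opposite[OF c(1) d(1)] by blast
      then obtain Z where Z: "Z \<in> points G" "inc G Z (snd c)" "inc G Z (snd d)"
        by (auto simp: concurrent_lines_def)
      have "Z \<in> pts (snd c)" using Z by simp
      then obtain h where h: "Z = a i h" using row_pts[OF grid, of "snd c" i] c S_chamber by auto
      have "coll (a i' k) Z" using collinear_pointsI[of "snd d" G] S_chamber[OF d(1)] d Z by simp
      then have "h = k" using h grid_coll[OF grid] d by auto
      then show ?thesis
        using line_unique[of "a i' k" "a i k" "snd d" col] h Z d S_chamber[OF d(1)] gp col grid_inj[OF grid]
        by simp
    qed
    obtain i1 i2 where i12: "i1 \<noteq> i" "i2 \<noteq> i" "i1 \<noteq> i2" by (cases i) auto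
    have "a i1 k \<in> fst ` S" "a i2 k \<in> fst ` S" using n i12 by blast+
    then obtain d1 d2 where "d1 \<in> S" "fst d1 = a i1 k" "d2 \<in> S" "fst d2 = a i2 k" by auto
    moreover from this have "d1 = d2" using snd_col i12 injs by (auto simp: inj_on_def)
    ultimately show False using i12 grid_inj[OF grid] by auto
  qed
  obtain k1 k2 where k12: "k1 \<noteq> j" "k2 \<noteq> j" "k1 \<noteq> k2" by (cases j) auto
  obtain i1 i2 where i12: "a i1 k1 \<notin> fst ` S" "a i2 k2 \<notin> fst ` S" using missing k12 by blast
  have "fst ` S \<subseteq> grid_points a - {a i1 k1, a i2 k2}" using sub i12 by blast
  then have "card (fst ` S) \<le> card (grid_points a - {a i1 k1, a i2 k2})"
    using card_grid_points[OF grid] by (intro card_mono) auto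
  also have "\<dots> = 7"
    using card_grid_points[OF grid] k12 grid_points_mem grid_inj[OF grid]
    by (subst card_Diff_subset) auto
  finally show False using S8 injf by (simp add: card_image)
qed

text \<open>A line of \<open>S\<close> inside the grid would be a row or a column, which
  \<open>not_in_row\<close> excludes for the grid and its transpose. So all lines of
  \<open>S\<close> are tangent, and maximality of \<open>S\<close> gives equality.\<close>

lemma eq_grid_chambers:
  assumes grid: "grid G a" and sub: "fst ` S \<subseteq> grid_points a"
  shows "S = grid_chambers G a"
proof -
  have "S \<subseteq> grid_chambers G a"
  proof
    fix c assume c: "c \<in> S"
    have cg: "fst c \<in> grid_points a" using sub c by blast
    have "\<exists>Q\<in>points G. inc G Q (snd c) \<and> Q \<notin> grid_points a"
    proof (rule ccontr)
      assume n: "\<not> ?thesis"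
      have "card (pts (snd c) - {fst c}) = 2"
        using c card_pts S_chamber[OF c] by (subst card_Diff_singleton) auto
      then have "pts (snd c) - {fst c} \<noteq> {}" by (metis card.empty zero_neq_numeral)
      then obtain Q where Q: "Q \<in> points G" "inc G Q (snd c)" "Q \<noteq> fst c" by blast
      then have Qg: "Q \<in> grid_points a" using n by blast
      have "snd c \<in> lines G" "inc G (fst c) (snd c)" using S_chamber[OF c] by auto
      then consider (row) i where "\<And>k. inc G (a i k) (snd c)" | (column) j where "\<And>k. inc G (a k j) (snd c)"
        using grid_line_cases[OF grid _ cg Qg Q(3)[symmetric] _ Q(2)] by blast
      then show False
      proof cases
        case (row i)
        have "fst c \<in> pts (snd c)" using S_chamber[OF c] by simp
        then obtain j where "fst c = a i j" using row_pts[OF grid, of "snd c" i] row S_chamber[OF c] by auto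
        then show False using not_in_row[OF grid sub c _ row] by blast
      next
        case (column j)
        have "fst c \<in> pts (snd c)" using S_chamber[OF c] by simp
        then obtain i where "fst c = a i j"
          using row_pts[OF grid_transpose[OF grid], of "snd c" j] column S_chamber[OF c] by auto
        then show False
          using not_in_row[OF grid_transpose[OF grid] _ c _ column] sub grid_points_transpose[of a] by metis
      qed
    qed
    then show "c \<in> grid_chambers G a"
      using cg S_chamber[OF c] by (cases c) (auto simp: grid_chambers_def chambers_def)
  qed
  then show ?thesis
    using S ind_grid_chambers[OF grid] by (auto simp: maximal_independent_set_def)
qed

lemma grid_chambers_if_four_neighbours:
  assumes "v \<in> S" "card (neighbourhood S fcoll v) \<ge> 4"
  shows "\<exists>a. grid G a \<and> S = grid_chambers G a"
  using grid_if_four_neighbours[OF assms] eq_grid_chambers by blast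

end

lemma gq22_dual: "gq22 (dual_structure G)"
  using dual by (simp add: gq22_def)

text \<open>If \<open>v\<close> has at most three collinear neighbours, then it has at least
  \<open>8 - 1 - 3 = 4\<close> non-collinear ones, whose lines meet that of \<open>v\<close>. So the
  dual set consists of the chambers of a grid and has 9 elements, against the count
  \<open>1 + 3 + 4 = 8\<close>.\<close>

lemma large_matching_is_grid_chambers:
  assumes S: "max_ind_chambers G S" and inj: "inj_on fst S" "inj_on snd S" and S8: "card S \<ge> 8"
  shows "\<exists>a. grid G a \<and> S = grid_chambers G a"
proof -
  let ?R = "\<lambda>c d. coll (fst c) (fst d)" and ?N = "\<lambda>c d. \<not> coll (fst c) (fst d)"
  have fin: "finite S" by (rule finite_max_ind_chambers[OF S])
  have "S \<noteq> {}" using S8 by auto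
  then obtain v where v: "v \<in> S" by blast
  note grid_S = grid_chambers_if_four_neighbours[OF S inj S8 v]
  have le: "card S \<le> 1 + card (neighbourhood S ?R v) + card (neighbourhood S ?N v)"
    by (rule card_le_neighbourhoods[OF fin v])
  have free: "diamond_free S ?R" "diamond_free S ?N"
    using matching_bound[OF S inj] S8 by auto
  have N4: "card (neighbourhood S ?N v) \<le> 4"
    by (rule card_neighbourhood_le_4) (use fin v free collinear_points_sym[of G] in simp_all)
  show ?thesis
  proof (cases "card (neighbourhood S ?R v) \<ge> 4")
    case False
    let ?S' = "prod.swap ` S" and ?R' = "\<lambda>c d. collinear_points (dual_structure G) (fst c) (fst d)"
    have c': "card ?S' = card S" by (simp add: card_image)
    have "prod.swap ` neighbourhood S ?N v \<subseteq> neighbourhood ?S' ?R' (prod.swap v)"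
    proof
      fix d assume "d \<in> prod.swap ` neighbourhood S ?N v"
      then obtain c where c: "c \<in> S" "c \<noteq> v" "\<not> ?R v c" "d = prod.swap c" by (auto simp: neighbourhood_def)
      then have "conc (snd v) (snd c)" using S_not_opposite[OF S inj S8 v] by blast
      then show "d \<in> neighbourhood ?S' ?R' (prod.swap v)"
        using c by (simp add: neighbourhood_def inj_eq[OF inj_swap_prod])
    qed
    then have "card (prod.swap ` neighbourhood S ?N v) \<le> card (neighbourhood ?S' ?R' (prod.swap v))"
      using fin by (intro card_mono) (auto simp: neighbourhood_def)
    then have "card (neighbourhood ?S' ?R' (prod.swap v)) \<ge> 4"
      using False le S8 by (simp add: card_image)
    then obtain b where "grid (dual_structure G) b" "?S' = grid_chambers (dual_structure G) b"
      using gq22.grid_chambers_if_four_neighbours[OF gq22_dual max_ind_chambers_dual[OF S]] inj_swap inj S8 c' v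
      by (metis image_eqI)
    then have "card S = 9" using gq22.card_grid_chambers[OF gq22_dual] c' by metis
    then show ?thesis using False le N4 by simp
  qed (use grid_S in blast)
qed

end

section \<open>The quadric over GF(2)\<close>

lemma exhaust_5: "x = 0 \<or> x = 1 \<or> x = 2 \<or> x = 3 \<or> x = 4" for x :: 5
proof (induct x)
  case (of_int z)
  then have "0 \<le> z" and "z < 5" by simp_all
  then have "z = 0 \<or> z = 1 \<or> z = 2 \<or> z = 3 \<or> z = 4" by arith
  then show ?case by auto
qed

lemma exhaust_4_0: "x = 0 \<or> x = 1 \<or> x = 2 \<or> x = 3" for x :: 4
proof (induct x)
  case (of_int z)
  then have "0 \<le> z" and "z < 4" by simp_all
  then have "z = 0 \<or> z = 1 \<or> z = 2 \<or> z = 3" by arith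
  then show ?case by auto
qed

lemma distinct_5: "distinct [0, 1, 2, 3, 4 :: 5]" by simp

lemma distinct_4: "distinct [0, 1, 2, 3 :: 4]" by simp

definition vec5 :: "bit \<Rightarrow> bit \<Rightarrow> bit \<Rightarrow> bit \<Rightarrow> bit \<Rightarrow> bit ^ 5" where
  "vec5 a b c d e = (\<chi> i. if i = 0 then a else if i = 1 then b else if i = 2 then c else if i = 3 then d else e)"

lemma vec5_nth [simp]:
  "vec5 a b c d e $ 0 = a" "vec5 a b c d e $ 1 = b" "vec5 a b c d e $ 2 = c" "vec5 a b c d e $ 3 = d"
  "vec5 a b c d e $ 4 = e"
  using distinct_5 by (simp_all add: vec5_def)

lemma vec5_eq_iff: "x = y \<longleftrightarrow> x $ 0 = y $ 0 \<and> x $ 1 = y $ 1 \<and> x $ 2 = y $ 2 \<and> x $ 3 = y $ 3 \<and> x $ 4 = y $ 4"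
  for x y :: "bit ^ 5"
proof
  assume *: "x $ 0 = y $ 0 \<and> x $ 1 = y $ 1 \<and> x $ 2 = y $ 2 \<and> x $ 3 = y $ 3 \<and> x $ 4 = y $ 4"
  show "x = y"
    unfolding vec_eq_iff
  proof
    fix i :: 5
    show "x $ i = y $ i" using exhaust_5[of i] * by (elim disjE) simp_all
  qed
qed simp

definition vec4 :: "bit \<Rightarrow> bit \<Rightarrow> bit \<Rightarrow> bit \<Rightarrow> bit ^ 4" where
  "vec4 a b c d = (\<chi> i. if i = 0 then a else if i = 1 then b else if i = 2 then c else d)"

lemma vec4_nth [simp]:
  "vec4 a b c d $ 0 = a" "vec4 a b c d $ 1 = b" "vec4 a b c d $ 2 = c" "vec4 a b c d $ 3 = d"
  using distinct_4 by (simp_all add: vec4_def)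

lemma vec4_eq_iff: "x = y \<longleftrightarrow> x $ 0 = y $ 0 \<and> x $ 1 = y $ 1 \<and> x $ 2 = y $ 2 \<and> x $ 3 = y $ 3"
  for x y :: "bit ^ 4"
proof
  assume *: "x $ 0 = y $ 0 \<and> x $ 1 = y $ 1 \<and> x $ 2 = y $ 2 \<and> x $ 3 = y $ 3"
  show "x = y"
    unfolding vec_eq_iff
  proof
    fix i :: 4
    show "x $ i = y $ i" using exhaust_4_0[of i] * by (elim disjE) simp_all
  qed
qed simp

section \<open>Subspaces of dimension 1 and 2 over GF(2)\<close>

lemma bit_vec_add_self: "x + x = (0 :: bit ^ 'n)"
  by (simp add: vec_eq_iff)

lemma bit_vec_add_eq_0: "x + y = 0 \<longleftrightarrow> x = y" for x y :: "bit ^ 'n"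
  by (metis bit_vec_add_self add_left_cancel)

lemma bit_scale: "k *s x = (if k = 0 then 0 else x)" for x :: "bit ^ 'n"
  by (cases k) (auto simp: vec_eq_iff)

lemma bit_subspaceI: "0 \<in> U \<Longrightarrow> (\<And>x y. x \<in> U \<Longrightarrow> y \<in> U \<Longrightarrow> x + y \<in> U) \<Longrightarrow> vec.subspace U"
  for U :: "(bit ^ 'n) set"
  by (auto simp: vec.subspace_def bit_scale)

lemma bit_span_singleton: "vec.span {u} = {0, u}" for u :: "bit ^ 'n"
  unfolding vec.span_singleton by (auto simp: bit_scale intro: exI[of _ 0] exI[of _ 1])

lemma bit_span_pair: "vec.span {u, v} = {0, u, v, u + v}" for u v :: "bit ^ 'n"
proof -
  have "x - k *s u \<in> {0, v} \<longleftrightarrow> x = k *s u \<or> x = v + k *s u" for x k by (auto simp: algebra_simps)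
  moreover have "(\<exists>k. x = k *s u \<or> x = v + k *s u) \<longleftrightarrow> x \<in> {0, u, v, u + v}" for x
  proof
    assume "x \<in> {0, u, v, u + v}"
    then have "x = 0 *s u \<or> x = 1 *s u \<or> x = v + 0 *s u \<or> x = v + 1 *s u"
      by (auto simp: bit_scale)
    then show "\<exists>k. x = k *s u \<or> x = v + k *s u" by blast
  qed (auto simp: bit_scale split: if_splits)
  ultimately show ?thesis
    unfolding vec.span_insert[of u "{v}"] bit_span_singleton by blast
qed

lemma bit_subspace_dim_1: "vec.subspace U \<and> vec.dim U = 1 \<longleftrightarrow> (\<exists>v. v \<noteq> 0 \<and> U = {0, v})"
  for U :: "(bit ^ 'n) set"
proof
  assume U: "vec.subspace U \<and> vec.dim U = 1"
  obtain B where B: "B \<subseteq> U" "vec.independent B" "U \<subseteq> vec.span B" "card B = vec.dim U"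
    by (rule vec.basis_exists)
  then obtain b where b: "B = {b}" using U by (metis card_1_singletonE)
  have "b \<noteq> 0" using B(2) b vec.dependent_zero by auto
  moreover have "U = {0, b}"
    using B(1,3) b U vec.subspace_0[of U] by (auto simp: bit_span_singleton)
  ultimately show "\<exists>v. v \<noteq> 0 \<and> U = {0, v}" by blast
next
  assume "\<exists>v. v \<noteq> 0 \<and> U = {0, v}"
  then obtain v where v: "v \<noteq> 0" "U = vec.span {v}" by (auto simp: bit_span_singleton)
  have "vec.independent {v}" using v by simp
  then show "vec.subspace U \<and> vec.dim U = 1"
    using v vec.subspace_span vec.dim_span_eq_card_independent[of "{v}"] by simp
qed

lemma bit_subspace_dim_2:
  "vec.subspace U \<and> vec.dim U = 2 \<longleftrightarrow> (\<exists>u v. u \<noteq> 0 \<and> v \<noteq> 0 \<and> u \<noteq> v \<and> U = {0, u, v, u + v})"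
  for U :: "(bit ^ 'n) set"
proof
  assume U: "vec.subspace U \<and> vec.dim U = 2"
  obtain B where B: "B \<subseteq> U" "vec.independent B" "U \<subseteq> vec.span B" "card B = vec.dim U"
    by (rule vec.basis_exists)
  then obtain u v where uv: "B = {u, v}" "u \<noteq> v" using U by (auto simp: card_2_iff)
  have "u \<noteq> 0" "v \<noteq> 0" using B(2) uv vec.dependent_zero by auto
  moreover have "vec.span B \<subseteq> U" using B(1) U vec.span_minimal by blast
  then have "U = {0, u, v, u + v}"
    using B(3) uv by (auto simp: bit_span_pair)
  ultimately show "\<exists>u v. u \<noteq> 0 \<and> v \<noteq> 0 \<and> u \<noteq> v \<and> U = {0, u, v, u + v}" using uv by blast
next
  assume "\<exists>u v. u \<noteq> 0 \<and> v \<noteq> 0 \<and> u \<noteq> v \<and> U = {0, u, v, u + v}"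
  then obtain u v where uv: "u \<noteq> 0" "v \<noteq> 0" "u \<noteq> v" "U = vec.span {u, v}" by (auto simp: bit_span_pair)
  have "vec.independent {u, v}"
    using uv by (simp add: vec.independent_insert bit_span_singleton)
  then show "vec.subspace U \<and> vec.dim U = 2"
    using uv vec.subspace_span vec.dim_span_eq_card_independent[of "{u, v}"] by simp
qed

text \<open>The polar form of \<open>parabolic_form\<close>. Coordinate 0 is absent because squaring
  is additive in characteristic 2; the vector with only this coordinate nonzero spans the nucleus of
  the quadric.\<close>

definition parabolic_bilinear :: "bit ^ 5 \<Rightarrow> bit ^ 5 \<Rightarrow> bit" where
  "parabolic_bilinear x y = x $ 1 * y $ 2 + x $ 2 * y $ 1 + x $ 3 * y $ 4 + x $ 4 * y $ 3"

lemma parabolic_form_0 [simp]: "parabolic_form 0 = 0"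
  by (simp add: parabolic_form_def)

lemma parabolic_form_add:
  "parabolic_form (x + y) = parabolic_form x + parabolic_form y + parabolic_bilinear x y"
proof -
  have sq: "(a + b)\<^sup>2 = a\<^sup>2 + b\<^sup>2" for a b :: bit by (cases a; cases b) simp_all
  show ?thesis
    by (simp only: parabolic_form_def parabolic_bilinear_def vector_add_component sq distrib_left
        distrib_right ac_simps)
qed

lemma points_Q42: "points Q42 = {{0, v} | v. v \<noteq> 0 \<and> parabolic_form v = 0}"
proof -
  have "U \<in> points Q42 \<longleftrightarrow> (\<exists>v. v \<noteq> 0 \<and> U = {0, v}) \<and> (\<forall>x\<in>U. parabolic_form x = 0)" for U
    unfolding bit_subspace_dim_1[symmetric] by (simp add: Q42_def)
  moreover have "(\<exists>v. v \<noteq> 0 \<and> U = {0, v}) \<and> (\<forall>x\<in>U. parabolic_form x = 0) \<longleftrightarrow>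
    (\<exists>v. U = {0, v} \<and> v \<noteq> 0 \<and> parabolic_form v = 0)" for U by auto
  ultimately show ?thesis by (intro set_eqI) (simp only: mem_Collect_eq)
qed

lemma lines_Q42:
  "lines Q42 = {{0, u, v, u + v} | u v. u \<noteq> 0 \<and> v \<noteq> 0 \<and> u \<noteq> v \<and>
     parabolic_form u = 0 \<and> parabolic_form v = 0 \<and> parabolic_form (u + v) = 0}"
proof -
  have "U \<in> lines Q42 \<longleftrightarrow> (\<exists>u v. u \<noteq> 0 \<and> v \<noteq> 0 \<and> u \<noteq> v \<and> U = {0, u, v, u + v}) \<and>
    (\<forall>x\<in>U. parabolic_form x = 0)" for U
    unfolding bit_subspace_dim_2[symmetric] by (simp add: Q42_def)
  moreover have "(\<exists>u v. u \<noteq> 0 \<and> v \<noteq> 0 \<and> u \<noteq> v \<and> U = {0, u, v, u + v}) \<and> (\<forall>x\<in>U. parabolic_form x = 0) \<longleftrightarrow>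
    (\<exists>u v. U = {0, u, v, u + v} \<and> u \<noteq> 0 \<and> v \<noteq> 0 \<and> u \<noteq> v \<and>
     parabolic_form u = 0 \<and> parabolic_form v = 0 \<and> parabolic_form (u + v) = 0)" for U
  proof
    assume "(\<exists>u v. u \<noteq> 0 \<and> v \<noteq> 0 \<and> u \<noteq> v \<and> U = {0, u, v, u + v}) \<and> (\<forall>x\<in>U. parabolic_form x = 0)"
    then obtain u v where uv: "u \<noteq> 0" "v \<noteq> 0" "u \<noteq> v" "U = {0, u, v, u + v}"
      "\<And>x. x \<in> U \<Longrightarrow> parabolic_form x = 0" by blast
    show "\<exists>u v. U = {0, u, v, u + v} \<and> u \<noteq> 0 \<and> v \<noteq> 0 \<and> u \<noteq> v \<and>
     parabolic_form u = 0 \<and> parabolic_form v = 0 \<and> parabolic_form (u + v) = 0"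
      using uv(1-4) uv(5)[of u] uv(5)[of v] uv(5)[of "u + v"] by blast
  qed (auto intro: exI)
  ultimately show ?thesis by (intro set_eqI) (simp only: mem_Collect_eq)
qed

lemma inc_Q42 [simp]: "inc Q42 = (\<subseteq>)"
  by (simp add: Q42_def)

lemma hyperbolic_solid_coordinate: "hyperbolic_solid {x. x $ 0 = 0}"
  unfolding hyperbolic_solid_def
proof (intro conjI exI allI)
  let ?f = "\<lambda>x :: bit ^ 4. vec5 0 (x $ 0) (x $ 1) (x $ 2) (x $ 3)"
  show lin: "Vector_Spaces.linear (*s) (*s) ?f"
    by unfold_locales (auto simp: vec5_eq_iff)
  show bij: "bij_betw ?f UNIV {x. x $ 0 = 0}"
    by (rule bij_betwI[where g = "\<lambda>x. vec4 (x $ 1) (x $ 2) (x $ 3) (x $ 4)"])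
      (auto simp: vec5_eq_iff vec4_eq_iff)
  show "parabolic_form (?f x) = hyperbolic_form x" for x
    by (simp add: parabolic_form_def hyperbolic_form_def)
  show "vec.subspace {x :: bit ^ 5. x $ 0 = 0}"
    by (rule bit_subspaceI) auto
  have "vec.dim (?f ` UNIV) = vec.dim (UNIV :: (bit ^ 4) set)"
    by (rule vec.dim_image_eq[OF lin]) (use bij in \<open>auto simp: bij_betw_def\<close>)
  then show "vec.dim {x :: bit ^ 5. x $ 0 = 0} = 4"
    using bij by (simp add: bij_betw_def card_cart_basis)
qed

text \<open>The hyperplane \<open>x\<^sub>0 = x\<^sub>1 + x\<^sub>2\<close> meets the quadric in an elliptic quadric, which contains no line.\<close>

lemma elliptic_no_line:
  assumes "parabolic_form u = 0" "parabolic_form v = 0" "parabolic_form (u + v) = 0"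
    "u $ 0 = u $ 1 + u $ 2" "v $ 0 = v $ 1 + v $ 2" "u \<noteq> 0" "v \<noteq> 0"
  shows "u = v"
proof -
  have "w \<in> {vec5 0 0 0 0 1, vec5 0 0 0 1 0, vec5 1 1 0 1 1, vec5 1 0 1 1 1, vec5 0 1 1 1 1}"
    if "parabolic_form w = 0" "w $ 0 = w $ 1 + w $ 2" "w \<noteq> 0" for w
    using that
    by (cases "w $ 1"; cases "w $ 2"; cases "w $ 3"; cases "w $ 4")
      (auto simp: parabolic_form_def vec5_eq_iff)
  from this[of u] this[of v] have
    "u \<in> {vec5 0 0 0 0 1, vec5 0 0 0 1 0, vec5 1 1 0 1 1, vec5 1 0 1 1 1, vec5 0 1 1 1 1}"
    "v \<in> {vec5 0 0 0 0 1, vec5 0 0 0 1 0, vec5 1 1 0 1 1, vec5 1 0 1 1 1, vec5 0 1 1 1 1}"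
    using assms by blast+
  then show ?thesis
    using assms(3) by (elim insertE emptyE) (simp_all add: parabolic_form_def)
qed

text \<open>Squaring is the identity on GF(2), so coordinate 0 is determined by the other four,
  which cannot all vanish. The upper bound suffices, since 15 different vectors will come from the
  points of the quadrangle.\<close>

lemma card_singular_vectors: "card {v. v \<noteq> 0 \<and> parabolic_form v = 0} \<le> 15"
  "finite {v :: bit ^ 5. v \<noteq> 0 \<and> parabolic_form v = 0}"
proof -
  let ?f = "\<lambda>(a, b, c, d). vec5 (of_bool a * of_bool b + of_bool c * of_bool d) (of_bool a) (of_bool b) (of_bool c) (of_bool d)"
  let ?A = "UNIV - {(False, False, False, False)}"
  have "v \<in> ?f ` ?A" if "v \<noteq> 0" "parabolic_form v = 0" for v
  proof -
    have "v $ 0 = v $ 1 * v $ 2 + v $ 3 * v $ 4"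
      using that(2) by (cases "v $ 0") (auto simp: parabolic_form_def add.assoc add_eq_0_iff)
    moreover have ob: "x = of_bool (x = 1)" for x :: bit by (cases x) auto
    ultimately have "v = ?f (v $ 1 = 1, v $ 2 = 1, v $ 3 = 1, v $ 4 = 1)"
      unfolding vec5_eq_iff prod.case vec5_nth by (simp only: ob[symmetric])
    moreover have "(v $ 1 = 1, v $ 2 = 1, v $ 3 = 1, v $ 4 = 1) \<noteq> (False, False, False, False)"
    proof
      assume "(v $ 1 = 1, v $ 2 = 1, v $ 3 = 1, v $ 4 = 1) = (False, False, False, False)"
      then have "v = 0" using calculation by (simp add: vec5_eq_iff)
      then show False using that(1) by simp
    qed
    ultimately show ?thesis by blast
  qed
  then have sub: "{v. v \<noteq> 0 \<and> parabolic_form v = 0} \<subseteq> ?f ` ?A" by blast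
  show "finite {v :: bit ^ 5. v \<noteq> 0 \<and> parabolic_form v = 0}" by (rule finite_subset[OF sub]) simp
  have "card {v. v \<noteq> 0 \<and> parabolic_form v = 0} \<le> card (?f ` ?A)"
    by (rule card_mono[OF _ sub]) simp
  also have "\<dots> \<le> card ?A"
    by (rule card_image_le) simp
  also have "\<dots> = 15"
    by (subst card_Diff_singleton) (simp_all add: card_UNIV_bool)
  finally show "card {v. v \<noteq> 0 \<and> parabolic_form v = 0} \<le> 15" .
qed

section \<open>Quadrangles isomorphic to the quadric\<close>

lemma isomorphism_points_Q42:
  assumes "incidence_isomorphism G Q42 f g"
  shows "P \<in> points G \<Longrightarrow> \<exists>v. v \<noteq> 0 \<and> parabolic_form v = 0 \<and> f P = {0, v}"
    and "v \<noteq> 0 \<Longrightarrow> parabolic_form v = 0 \<Longrightarrow> \<exists>P\<in>points G. f P = {0, v}"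
    and "P \<in> points G \<Longrightarrow> Q \<in> points G \<Longrightarrow> f P = f Q \<longleftrightarrow> P = Q"
    and "P \<in> points G \<Longrightarrow> l \<in> lines G \<Longrightarrow> inc G P l \<longleftrightarrow> f P \<subseteq> g l"
proof -
  have bij: "bij_betw f (points G) {{0, v} | v. v \<noteq> 0 \<and> parabolic_form v = 0}"
    using assms by (simp add: incidence_isomorphism_def points_Q42)
  show "P \<in> points G \<Longrightarrow> \<exists>v. v \<noteq> 0 \<and> parabolic_form v = 0 \<and> f P = {0, v}"
    using bij_betwE[OF bij] by blast
  show "\<exists>P\<in>points G. f P = {0, v}" if "v \<noteq> 0" "parabolic_form v = 0"
  proof -
    have "{0, v} \<in> f ` points G" using bij that by (auto simp: bij_betw_def)
    then show ?thesis by (metis imageE)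
  qed
  show "P \<in> points G \<Longrightarrow> Q \<in> points G \<Longrightarrow> f P = f Q \<longleftrightarrow> P = Q"
    using bij by (auto simp: bij_betw_def inj_on_eq_iff)
  show "P \<in> points G \<Longrightarrow> l \<in> lines G \<Longrightarrow> inc G P l \<longleftrightarrow> f P \<subseteq> g l"
    using assms by (simp add: incidence_isomorphism_def)
qed

lemma isomorphism_lines_Q42:
  assumes "incidence_isomorphism G Q42 f g"
  shows "l \<in> lines G \<Longrightarrow> \<exists>u v. u \<noteq> 0 \<and> v \<noteq> 0 \<and> u \<noteq> v \<and> parabolic_form u = 0 \<and> parabolic_form v = 0 \<and>
      parabolic_form (u + v) = 0 \<and> g l = {0, u, v, u + v}"
    and "\<lbrakk>u \<noteq> 0; v \<noteq> 0; u \<noteq> v; parabolic_form u = 0; parabolic_form v = 0; parabolic_form (u + v) = 0\<rbrakk>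
      \<Longrightarrow> \<exists>l\<in>lines G. g l = {0, u, v, u + v}"
proof -
  have bij: "bij_betw g (lines G) (lines Q42)"
    using assms by (simp add: incidence_isomorphism_def)
  show "l \<in> lines G \<Longrightarrow> \<exists>u v. u \<noteq> 0 \<and> v \<noteq> 0 \<and> u \<noteq> v \<and> parabolic_form u = 0 \<and> parabolic_form v = 0 \<and>
      parabolic_form (u + v) = 0 \<and> g l = {0, u, v, u + v}"
    using bij_betwE[OF bij] unfolding lines_Q42 by blast
  assume "u \<noteq> 0" "v \<noteq> 0" "u \<noteq> v" "parabolic_form u = 0" "parabolic_form v = 0" "parabolic_form (u + v) = 0"
  then have "{0, u, v, u + v} \<in> lines Q42" unfolding lines_Q42 by blast
  then have "{0, u, v, u + v} \<in> g ` lines G" using bij by (simp add: bij_betw_def)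
  then show "\<exists>l\<in>lines G. g l = {0, u, v, u + v}" by (metis imageE)
qed

text \<open>The ovoid is the elliptic quadric cut out by the hyperplane \<open>h\<close>. A line
  meets a hyperplane in one point or is contained in it, and \<open>elliptic_no_line\<close>
  excludes the latter.\<close>

lemma ovoid_if_isomorphic_Q42:
  assumes iso: "incidence_isomorphism G Q42 f g"
  shows "\<exists>A. ovoid G A"
proof -
  note ip = isomorphism_points_Q42[OF iso]
  define h where "h w \<longleftrightarrow> w $ 0 = w $ 1 + w $ 2" for w :: "bit ^ 5"
  define A where "A = {P \<in> points G. \<forall>w\<in>f P. h w}"
  have "\<exists>!P. P \<in> A \<and> inc G P l" if l: "l \<in> lines G" for l
  proof -
    obtain u v where uv: "u \<noteq> 0" "v \<noteq> 0" "u \<noteq> v" "parabolic_form u = 0" "parabolic_form v = 0"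
      "parabolic_form (u + v) = 0" "g l = {0, u, v, u + v}"
      using isomorphism_lines_Q42(1)[OF iso l] by blast
    have h_add: "h (x + y) \<longleftrightarrow> (h x \<longleftrightarrow> h y)" for x y
      unfolding h_def
    proof -
      have "(x0 + y0 = x1 + y1 + (x2 + y2)) \<longleftrightarrow> ((x0 = x1 + x2) \<longleftrightarrow> (y0 = y1 + y2))"
        for x0 x1 x2 y0 y1 y2 :: bit
        by (cases x0; cases x1; cases x2; cases y0; cases y1; cases y2) simp_all
      then show "((x + y) $ 0 = (x + y) $ 1 + (x + y) $ 2) \<longleftrightarrow> ((x $ 0 = x $ 1 + x $ 2) \<longleftrightarrow> (y $ 0 = y $ 1 + y $ 2))"
        by (simp only: vector_add_component)
    qed
    have "\<not> (h u \<and> h v)"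
    proof
      assume "h u \<and> h v"
      then have "u $ 0 = u $ 1 + u $ 2" "v $ 0 = v $ 1 + v $ 2" by (simp_all only: h_def)
      from elliptic_no_line[OF uv(4-6) this uv(1,2)] show False using uv(3) by simp
    qed
    then have hs: "(h u \<and> \<not> h v \<and> \<not> h (u + v)) \<or> (\<not> h u \<and> h v \<and> \<not> h (u + v)) \<or> (\<not> h u \<and> \<not> h v \<and> h (u + v))"
      unfolding h_add by blast
    have "\<exists>w. w \<in> {u, v, u + v} \<and> h w \<and> (\<forall>x\<in>{u, v, u + v}. h x \<longrightarrow> x = w)"
      using hs by (elim disjE conjE) simp_all
    then obtain w where w: "w \<in> {u, v, u + v}" "h w" "\<And>x. x \<in> {u, v, u + v} \<Longrightarrow> h x \<Longrightarrow> x = w"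
      by blast
    have w0: "w \<noteq> 0 \<and> parabolic_form w = 0"
      using w(1) uv(1,2,3,4,5,6) bit_vec_add_eq_0[of u v] by auto
    obtain P where P: "P \<in> points G" "f P = {0, w}" using ip(2)[of w] w0 by blast
    have h0: "h 0" by (simp add: h_def)
    show ?thesis
    proof (intro ex1I[of _ P] conjI)
      show "P \<in> A" using P w(2) h0 by (simp add: A_def)
      show "inc G P l" using ip(4)[OF P(1) l] P w(1) uv(7) by auto
      fix Q assume Q: "Q \<in> A \<and> inc G Q l"
      then obtain x where x: "x \<noteq> 0" "f Q = {0, x}" using ip(1)[of Q] by (auto simp: A_def)
      have "x \<in> {u, v, u + v}" "h x" using Q x ip(4)[of Q l] l uv(7) by (auto simp: A_def)
      then have "x = w" by (rule w(3))
      then show "Q = P" using ip(3)[of Q P] Q P x by (auto simp: A_def)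
    qed
  qed
  then have "ovoid G A" by (auto simp: ovoid_def A_def)
  then show ?thesis by blast
qed

section \<open>Grids and the sets X\<close>

text \<open>The nine singular points of the hyperbolic form are the pure tensors in \<open>GF(2)\<^sup>2 \<otimes> GF(2)\<^sup>2\<close>.\<close>

fun idx_vec :: "idx \<Rightarrow> bit \<times> bit" where
  "idx_vec I0 = (1, 0)" | "idx_vec I1 = (0, 1)" | "idx_vec I2 = (1, 1)"

definition tensor :: "idx \<Rightarrow> idx \<Rightarrow> bit ^ 4" where
  "tensor i j = vec4 (fst (idx_vec i) * fst (idx_vec j)) (snd (idx_vec i) * snd (idx_vec j))
     (fst (idx_vec i) * snd (idx_vec j)) (snd (idx_vec i) * fst (idx_vec j))"

lemma hyperbolic_form_tensor: "hyperbolic_form (tensor i j) = 0"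
  by (cases i; cases j) (simp_all add: hyperbolic_form_def tensor_def)

lemma tensor_nonzero: "tensor i j \<noteq> 0"
  by (cases i; cases j) (simp_all add: vec4_eq_iff tensor_def)

lemma tensor_inj: "tensor i j = tensor i' j' \<longleftrightarrow> i = i' \<and> j = j'"
  by (cases i; cases j; cases i'; cases j') (simp_all add: vec4_eq_iff tensor_def)

lemma tensor_sum_row: "tensor i I0 + tensor i I1 = tensor i I2"
  by (cases i) (simp_all add: vec4_eq_iff tensor_def)

lemma tensor_sum_column: "tensor I0 j + tensor I1 j = tensor I2 j"
  by (cases j) (simp_all add: vec4_eq_iff tensor_def)

lemma singular_is_tensor:
  assumes "hyperbolic_form x = 0" "x \<noteq> 0"
  shows "\<exists>i j. x = tensor i j"
proof -
  have "x \<in> {tensor I0 I0, tensor I0 I1, tensor I0 I2, tensor I1 I0, tensor I1 I1, tensor I1 I2,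
      tensor I2 I0, tensor I2 I1, tensor I2 I2}"
    using assms
    by (cases "x $ 0"; cases "x $ 1"; cases "x $ 2"; cases "x $ 3")
      (simp_all add: vec4_eq_iff tensor_def hyperbolic_form_def)
  then show ?thesis by blast
qed

text \<open>The pure tensors, carried over by the linear map \<open>e\<close> and the isomorphism,
  form the grid. Every singular vector of \<open>H\<close> is such an image, so lying in
  \<open>H\<close> amounts to being a grid point, and a line outside \<open>H\<close> is a line with
  a point off the grid.\<close>

lemma X_set_grid:
  assumes "X_set G S"
  shows "\<exists>a. grid G a \<and> S = grid_chambers G a"
proof -
  obtain f g H where iso: "incidence_isomorphism G Q42 f g" and H: "hyperbolic_solid H"
    and S: "S = {(P, l) \<in> chambers G. (f P, g l) \<in> X_Q42 H}"
    using assms by (auto simp: X_set_def)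
  note ip = isomorphism_points_Q42[OF iso]
  obtain e where lin: "Vector_Spaces.linear (*s) (*s) e" and bij: "bij_betw e UNIV H"
    and form: "\<And>x :: bit ^ 4. parabolic_form (e x) = hyperbolic_form x"
    and sub: "vec.subspace H"
    using H by (auto simp: hyperbolic_solid_def)
  have e_add: "e (x + y) = e x + e y" for x y
    using lin by (rule vec.linear_add)
  have e_0: "e x = 0 \<longleftrightarrow> x = 0" for x
    using bij e_add[of 0 0] bit_vec_add_self[of "e 0"] by (metis add_0 bij_betw_def inj_eq)
  have e_inj: "e x = e y \<longleftrightarrow> x = y" for x y
    using bij by (auto simp: bij_betw_def inj_on_def)
  have eH: "e x \<in> H" for x using bij by (auto simp: bij_betw_def)
  have "\<forall>i j. \<exists>P. P \<in> points G \<and> f P = {0, e (tensor i j)}"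
  proof (intro allI)
    fix i j
    have "e (tensor i j) \<noteq> 0" using tensor_nonzero e_0 by simp
    moreover have "parabolic_form (e (tensor i j)) = 0" using form hyperbolic_form_tensor by simp
    ultimately have "\<exists>P\<in>points G. f P = {0, e (tensor i j)}" by (rule ip(2))
    then show "\<exists>P. P \<in> points G \<and> f P = {0, e (tensor i j)}" by blast
  qed
  then obtain a where a: "\<And>i j. a i j \<in> points G" "\<And>i j. f (a i j) = {0, e (tensor i j)}" by metis
  have line: "\<exists>l\<in>lines G. \<forall>j. inc G (b j) l"
    if b: "\<And>j. b j \<in> points G" "\<And>j. f (b j) = {0, e (c j)}" and c: "\<And>j. hyperbolic_form (c j) = 0"
      "\<And>j. c j \<noteq> 0" "c I0 \<noteq> c I1" "c I0 + c I1 = c I2" for b c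
  proof -
    have "e (c I0) \<noteq> 0" "e (c I1) \<noteq> 0" "e (c I0) \<noteq> e (c I1)" "e (c I0) + e (c I1) = e (c I2)"
      using c by (simp_all add: e_0 e_inj e_add[symmetric])
    moreover have "parabolic_form (e (c j)) = 0" for j using c form by simp
    ultimately obtain l where l: "l \<in> lines G" "g l = {0, e (c I0), e (c I1), e (c I2)}"
      using isomorphism_lines_Q42(2)[OF iso, of "e (c I0)" "e (c I1)"] by auto
    have "inc G (b j) l" for j
      using ip(4)[OF b(1) l(1)] b(2) l(2) by (cases j) auto
    then show ?thesis using l by blast
  qed
  have grid: "grid G a"
    unfolding grid_def
  proof (intro conjI allI impI)
    show "i = i'" "j = j'" if "a i j = a i' j'" for i j i' j'
    proof -
      have "{0, e (tensor i j)} = {0, e (tensor i' j')}" using a(2) that by metis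
      then have "e (tensor i j) = e (tensor i' j')"
        using e_0 tensor_nonzero by (metis insert_iff singletonD)
      then show "i = i'" "j = j'" using e_inj tensor_inj by auto
    qed
    show "\<exists>l\<in>lines G. \<forall>j. inc G (a i j) l" for i
      by (rule line[of "a i" "tensor i"])
        (use a hyperbolic_form_tensor tensor_nonzero tensor_inj tensor_sum_row in auto)
    show "\<exists>l\<in>lines G. \<forall>i. inc G (a i j) l" for j
      by (rule line[of "\<lambda>i. a i j" "\<lambda>i. tensor i j"])
        (use a hyperbolic_form_tensor tensor_nonzero tensor_inj tensor_sum_column in auto)
  qed (rule a)
  have in_grid: "P \<in> grid_points a \<longleftrightarrow> f P \<subseteq> H" if P: "P \<in> points G" for P
  proof
    assume "P \<in> grid_points a"
    then show "f P \<subseteq> H" using a eH vec.subspace_0[OF sub] by (auto simp: grid_points_def)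
  next
    assume fP: "f P \<subseteq> H"
    obtain v where v: "v \<noteq> 0" "parabolic_form v = 0" "f P = {0, v}" using ip(1)[OF P] by blast
    then obtain x where x: "v = e x" using fP bij by (auto simp: bij_betw_def)
    then obtain i j where "x = tensor i j"
      using singular_is_tensor[of x] v form e_0 by auto
    then have "f P = f (a i j)" using x v a by simp
    then show "P \<in> grid_points a" using ip(3) P a grid_points_mem by metis
  qed
  have "(f P, g l) \<in> X_Q42 H \<longleftrightarrow> P \<in> grid_points a \<and> (\<exists>Q\<in>points G. inc G Q l \<and> Q \<notin> grid_points a)"
    if c: "(P, l) \<in> chambers G" for P l
  proof -
    have Pl: "P \<in> points G" "l \<in> lines G" "inc G P l" using c by (auto simp: chambers_def)
    have "(f P, g l) \<in> chambers Q42"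
      using Pl iso ip(4)[OF Pl(1,2)] by (auto simp: chambers_def incidence_isomorphism_def bij_betw_def)
    then have X: "(f P, g l) \<in> X_Q42 H \<longleftrightarrow> f P \<subseteq> H \<and> \<not> g l \<subseteq> H" by (simp add: X_Q42_def)
    obtain u v where uv: "u \<noteq> 0" "v \<noteq> 0" "u \<noteq> v" "parabolic_form u = 0" "parabolic_form v = 0"
      "parabolic_form (u + v) = 0" "g l = {0, u, v, u + v}"
      using isomorphism_lines_Q42(1)[OF iso Pl(2)] by blast
    have "g l \<subseteq> H" if all: "\<And>Q. Q \<in> points G \<Longrightarrow> inc G Q l \<Longrightarrow> f Q \<subseteq> H"
    proof
      fix w assume w: "w \<in> g l"
      show "w \<in> H"
      proof (cases "w = 0")
        case False
        have "parabolic_form w = 0" using w uv by auto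
        then obtain Q where Q: "Q \<in> points G" "f Q = {0, w}" using ip(2) False by blast
        then have "inc G Q l" using ip(4)[OF Q(1) Pl(2)] w uv(7) by auto
        then show ?thesis using all Q by auto
      qed (use vec.subspace_0[OF sub] in simp)
    qed
    moreover have "f Q \<subseteq> H" if "g l \<subseteq> H" "Q \<in> points G" "inc G Q l" for Q
      using ip(4)[OF that(2) Pl(2)] that by blast
    ultimately have "g l \<subseteq> H \<longleftrightarrow> (\<forall>Q\<in>points G. inc G Q l \<longrightarrow> f Q \<subseteq> H)" by blast
    then show ?thesis unfolding X using in_grid Pl by auto
  qed
  then have "S = grid_chambers G a"
    unfolding S grid_chambers_def by auto
  then show ?thesis using grid by blast
qed

section \<open>Coordinates from non-collinearity\<close>

lemma bilinear_sym: "parabolic_bilinear x y = parabolic_bilinear y x"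
  by (simp only: parabolic_bilinear_def ac_simps)

lemma bilinear_self: "parabolic_bilinear x x = 0"
  by (cases "x $ 1"; cases "x $ 2"; cases "x $ 3"; cases "x $ 4") (simp_all add: parabolic_bilinear_def)

context gq22 begin

text \<open>A bit and not a truth value, because it turns out to be the polar form of the quadric;
  see \<open>bilinear_eq_noncoll\<close>.\<close>

definition noncoll :: "'p \<Rightarrow> 'p \<Rightarrow> bit" where
  "noncoll P Q = (if coll P Q then 0 else 1)"

lemma noncoll_sym: "noncoll P Q = noncoll Q P"
  by (simp add: noncoll_def collinear_points_sym)

lemma noncoll_eq_0: "noncoll P Q = 0 \<longleftrightarrow> coll P Q"
  by (simp add: noncoll_def)

text \<open>A point is collinear with exactly one or with all three points of a line, so the three
  values sum to 0. This makes \<open>noncoll X\<close> additive along lines and is the source of the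
  linear structure.\<close>

lemma noncoll_line:
  assumes "l \<in> lines G" "pts l = {P, Q, R}" "P \<noteq> Q" "P \<noteq> R" "Q \<noteq> R" "X \<in> points G"
  shows "noncoll X R = noncoll X P + noncoll X Q"
proof -
  have on: "P \<in> pts l" "Q \<in> pts l" "R \<in> pts l" using assms(2) by auto
  show ?thesis
  proof (cases "inc G X l")
    case True
    then have "coll X Y" if "Y \<in> pts l" for Y using that assms(1) by (auto intro: collinear_pointsI)
    then show ?thesis using on by (simp add: noncoll_def)
  next
    case False
    obtain Y where Y: "Y \<in> pts l" "coll X Y" using projection[OF assms(6,1)] by blast
    have "coll X Z \<longleftrightarrow> Z = Y" if "Z \<in> pts l" for Z
      using no_triangle[of X l Y Z] Y that assms(1,6) False by auto
    moreover have "Y \<in> {P, Q, R}" using Y assms(2) by simp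
    ultimately show ?thesis using on assms(3-5) by (auto simp: noncoll_def)
  qed
qed

context
  fixes a :: "idx \<Rightarrow> idx \<Rightarrow> 'p"
  assumes grid: "grid G a"
begin

lemma noncoll_grid: "noncoll (a i j) (a i' j') = (if i = i' \<or> j = j' then 0 else 1)"
  using grid_coll[OF grid] by (simp add: noncoll_def)

text \<open>Coordinates with respect to the two hyperbolic pairs \<open>a\<^sub>1\<^sub>1, a\<^sub>0\<^sub>0\<close> and \<open>a\<^sub>1\<^sub>0, a\<^sub>0\<^sub>1\<close> of the grid; the
  first coordinate is forced by the equation of the quadric.\<close>

definition coords :: "'p \<Rightarrow> bit ^ 5" where
  "coords P = (let n = \<lambda>i j. noncoll P (a i j) in
     vec5 (n I0 I0 * n I1 I1 + n I0 I1 * n I1 I0) (n I0 I0) (n I1 I1) (n I0 I1) (n I1 I0))"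

lemma coords_nth:
  "coords P $ 1 = noncoll P (a I0 I0)" "coords P $ 2 = noncoll P (a I1 I1)"
  "coords P $ 3 = noncoll P (a I0 I1)" "coords P $ 4 = noncoll P (a I1 I0)"
  "coords P $ 0 = coords P $ 1 * coords P $ 2 + coords P $ 3 * coords P $ 4"
  by (simp_all add: coords_def Let_def del: add_bit_eq_xor mult_bit_eq_and)

lemma parabolic_form_coords: "parabolic_form (coords P) = 0"
proof -
  have "(x + y)\<^sup>2 + x + y = 0" for x y :: bit by (cases x; cases y) simp_all
  then show ?thesis by (simp only: parabolic_form_def coords_nth(5))
qed

abbreviation (input) bil :: "'p \<Rightarrow> 'p \<Rightarrow> bit" where
  "bil P Q \<equiv> parabolic_bilinear (coords P) (coords Q)"

lemma noncoll_row:
  assumes "X \<in> points G"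
  shows "noncoll X (a i I2) = noncoll X (a i I0) + noncoll X (a i I1)"
    and "noncoll X (a I2 j) = noncoll X (a I0 j) + noncoll X (a I1 j)"
proof -
  have *: "noncoll X (b i I2) = noncoll X (b i I0) + noncoll X (b i I1)" if b: "grid G b" for b i
  proof -
    obtain l where l: "l \<in> lines G" "\<And>j. inc G (b i j) l" using row_obtain[OF b] by blast
    have "pts l = {b i I0, b i I1, b i I2}"
      using row_pts[OF b l] by (auto intro: idx.exhaust) (metis idx.exhaust)
    then show ?thesis using noncoll_line[OF l(1)] grid_inj[OF b] assms by simp
  qed
  show "noncoll X (a i I2) = noncoll X (a i I0) + noncoll X (a i I1)" by (rule *[OF grid])
  show "noncoll X (a I2 j) = noncoll X (a I0 j) + noncoll X (a I1 j)"
    by (rule *[OF grid_transpose[OF grid]])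
qed

lemma row_not_all:
  assumes "X \<in> points G"
  shows "\<exists>j. noncoll X (a i j) = 0" "\<exists>i. noncoll X (a i j) = 0"
proof -
  have *: "\<exists>j. coll X (b i j)" if b: "grid G b" for b i
  proof -
    obtain l where l: "l \<in> lines G" "\<And>j. inc G (b i j) l" using row_obtain[OF b] by blast
    obtain Y where "Y \<in> pts l" "coll X Y" using projection[OF assms l(1)] by blast
    then show ?thesis using row_pts[OF b l] by auto
  qed
  show "\<exists>j. noncoll X (a i j) = 0" using *[OF grid] by (simp add: noncoll_eq_0)
  show "\<exists>i. noncoll X (a i j) = 0" using *[OF grid_transpose[OF grid]] by (simp add: noncoll_eq_0)
qed

lemma row_at_most_one:
  assumes X: "X \<in> points G" "X \<notin> grid_points a"
  shows "noncoll X (a i j) = 0 \<Longrightarrow> noncoll X (a i j') = 0 \<Longrightarrow> j = j'"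
    and "noncoll X (a i j) = 0 \<Longrightarrow> noncoll X (a i' j) = 0 \<Longrightarrow> i = i'"
proof -
  have *: "j = j'" if b: "grid G b" "grid_points b = grid_points a" and c: "coll X (b i j)" "coll X (b i j')"
    for b i j j'
  proof (rule ccontr)
    assume n: "j \<noteq> j'"
    obtain l where l: "l \<in> lines G" "\<And>j. inc G (b i j) l" using row_obtain[OF b(1)] by blast
    have "inc G X l"
      using no_triangle[of X l "b i j" "b i j'"] X c l n grid_inj[OF b(1)] grid_point[OF b(1)] by simp
    then have "X \<in> pts l" using X by simp
    then have "X \<in> grid_points b" unfolding row_pts[OF b(1) l] by (auto simp: grid_points_def)
    then show False using X b by simp
  qed
  show "noncoll X (a i j) = 0 \<Longrightarrow> noncoll X (a i j') = 0 \<Longrightarrow> j = j'"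
    using *[OF grid refl] by (simp add: noncoll_eq_0)
  show "noncoll X (a i j) = 0 \<Longrightarrow> noncoll X (a i' j) = 0 \<Longrightarrow> i = i'"
    using *[OF grid_transpose[OF grid] grid_points_transpose] by (simp add: noncoll_eq_0)
qed

text \<open>Coordinate 0 is the determinant of the 2 by 2 corner of the array
  \<open>noncoll P (a i j)\<close>. For an off-grid \<open>P\<close> every row of the full array has
  at most one zero, so the two rows of the corner and their sum are nonzero and the determinant is
  1. For a grid point it is 0 by inspection.\<close>

lemma coords_0_iff:
  assumes P: "P \<in> points G"
  shows "coords P $ 0 = 0 \<longleftrightarrow> P \<in> grid_points a"
proof
  assume "P \<in> grid_points a"
  then obtain i j where "P = a i j" by (auto simp: grid_points_def)
  then show "coords P $ 0 = 0"
    by (cases i; cases j) (simp_all add: coords_nth noncoll_grid)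
next
  assume c: "coords P $ 0 = 0"
  show "P \<in> grid_points a"
  proof (rule ccontr)
    assume n: "P \<notin> grid_points a"
    note one = row_at_most_one[OF P n]
    have r: "\<not> (noncoll P (a i I0) = 0 \<and> noncoll P (a i I1) = 0)" for i
      using one(1)[of i I0 I1] idx.distinct(1) by blast
    have c': "\<not> (noncoll P (a I0 j) = 0 \<and> noncoll P (a I1 j) = 0)" for j
      using one(2)[of I0 j I1] idx.distinct(1) by blast
    show False
      using r[of I0] r[of I1] r[of I2, unfolded noncoll_row(2)[OF P]] c'[of I0] c'[of I1]
        c'[of I2, unfolded noncoll_row(1)[OF P]] c
      by (cases "noncoll P (a I0 I0)"; cases "noncoll P (a I0 I1)"; cases "noncoll P (a I1 I0)";
          cases "noncoll P (a I1 I1)") (simp_all add: coords_nth)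
  qed
qed

text \<open>In coordinates 1 to 4 the four corner points are the unit vectors, so pairing with one
  of them reads off a coordinate. The other five grid points follow by additivity along rows and
  columns.\<close>

lemma bilinear_grid:
  assumes P: "P \<in> points G"
  shows "bil P (a i j) = noncoll P (a i j)"
  by (cases i; cases j)
    (simp_all only: parabolic_bilinear_def coords_nth noncoll_grid noncoll_row[OF P] idx.distinct simp_thms
      if_True if_False mult_zero_right mult_zero_left mult_1_left mult_1_right add_0 add_0_right ac_simps)

lemma coords_line:
  assumes "l \<in> lines G" "pts l = {P, Q, R}" "P \<noteq> Q" "P \<noteq> R" "Q \<noteq> R"
  shows "coords R $ 1 = coords P $ 1 + coords Q $ 1" "coords R $ 2 = coords P $ 2 + coords Q $ 2"
    "coords R $ 3 = coords P $ 3 + coords Q $ 3" "coords R $ 4 = coords P $ 4 + coords Q $ 4"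
proof -
  have "noncoll R (a i j) = noncoll P (a i j) + noncoll Q (a i j)" for i j
    using noncoll_line[OF assms grid_point[OF grid], of i j]
    by (simp only: noncoll_sym[of "a i j" R] noncoll_sym[of "a i j" P] noncoll_sym[of "a i j" Q])
  then show "coords R $ 1 = coords P $ 1 + coords Q $ 1" "coords R $ 2 = coords P $ 2 + coords Q $ 2"
    "coords R $ 3 = coords P $ 3 + coords Q $ 3" "coords R $ 4 = coords P $ 4 + coords Q $ 4"
    unfolding coords_nth by blast+
qed

text \<open>An off-grid point is collinear with a point of each of the three rows. The joining lines
  are different, as a line with two grid points stays in the grid, so they are all
  \<open>t + 1 = 3\<close> lines through the point.\<close>

lemma grid_point_on_line:
  assumes l: "l \<in> lines G"
  shows "\<exists>R \<in> pts l. R \<in> grid_points a"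
proof -
  obtain P where P: "P \<in> points G" "inc G P l" using pts_nonempty[OF l] by blast
  show ?thesis
  proof (cases "P \<in> grid_points a")
    case False
    have "\<forall>i. \<exists>j k. k \<in> lines G \<and> inc G P k \<and> inc G (a i j) k"
      using row_not_all(1)[OF P(1)] unfolding noncoll_eq_0 collinear_points_def by blast
    then obtain j k where k: "\<And>i. k i \<in> lines G" "\<And>i. inc G P (k i)" "\<And>i. inc G (a i (j i)) (k i)"
      by metis
    have "inj k"
    proof (rule injI)
      fix i i' assume e: "k i = k i'"
      show "i = i'"
      proof (rule ccontr)
        assume "i \<noteq> i'"
        then have "a i (j i) \<noteq> a i' (j i')" using grid_inj[OF grid] by simp
        then have "pts (k i) \<subseteq> grid_points a"
          using grid_line_subset[OF grid, of "k i" "a i (j i)" "a i' (j i')"] k e grid_points_mem by metis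
        then show False using False P k by blast
      qed
    qed
    then have "card (range k) = 3" by (simp add: card_image card_idx)
    then have "range k = lns P"
      using k card_lns[OF P(1)] finite_lns[OF P(1)] by (intro card_subset_eq) auto
    then obtain i where "l = k i" using l P by blast
    then show ?thesis using k grid_point[OF grid] grid_points_mem by blast
  qed (use P in blast)
qed

text \<open>For off-grid points \<open>P\<close> and \<open>Q\<close> the third point
  \<open>R\<close> of their line is in the grid. Additivity gives
  \<open>bil P Q = bil P P + bil P R\<close>, and both terms vanish.\<close>

lemma bilinear_coll:
  assumes P: "P \<in> points G" and Q: "Q \<in> points G" and c: "coll P Q"
  shows "bil P Q = 0"
proof -
  consider "P = Q" | "P \<in> grid_points a" | "Q \<in> grid_points a"
    | "P \<noteq> Q" "P \<notin> grid_points a" "Q \<notin> grid_points a" by blast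
  then show ?thesis
  proof cases
    case 1
    then show ?thesis by (simp add: bilinear_self)
  next
    case 2
    then show ?thesis using bilinear_grid[OF Q] noncoll_eq_0[of Q P] c collinear_points_sym[of G]
        bilinear_sym by (auto simp: grid_points_def)
  next
    case 3
    then show ?thesis using bilinear_grid[OF P] noncoll_eq_0[of P Q] c by (auto simp: grid_points_def)
  next
    case 4
    obtain l where l: "l \<in> lines G" "inc G P l" "inc G Q l" using c by (auto simp: collinear_points_def)
    obtain R where R: "R \<in> pts l" "R \<in> grid_points a" using grid_point_on_line[OF l(1)] by blast
    have ne: "R \<noteq> P" "R \<noteq> Q" using R 4 by auto
    have pl: "pts l = {P, R, Q}" by (rule pts_eq) (use l P Q R ne 4 in auto)
    obtain i j where ij: "R = a i j" using R by (auto simp: grid_points_def)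
    have "coll P R" using collinear_pointsI[of l G P R] l R by simp
    then have "bil P R = 0" using bilinear_grid[OF P] ij noncoll_eq_0 by simp
    moreover have "bil P Q = bil P P + bil P R"
      using coords_line[OF l(1) pl ne(1)[symmetric] 4(1) ne(2)]
      by (simp only: parabolic_bilinear_def distrib_left distrib_right ac_simps)
    ultimately show ?thesis by (simp add: bilinear_self)
  qed
qed

text \<open>Coordinate 0 is quadratic in the others and fails to be additive by exactly
  \<open>bil P Q\<close>. This is why \<open>coords_line\<close> stops at four coordinates and
  \<open>bilinear_coll\<close> has to come first.\<close>

lemma coords_add_line:
  assumes "l \<in> lines G" "pts l = {P, Q, R}" "P \<noteq> Q" "P \<noteq> R" "Q \<noteq> R"
  shows "coords R = coords P + coords Q"
proof -
  have on: "P \<in> pts l" "Q \<in> pts l" using assms(2) by auto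
  then have "bil P Q = 0" using bilinear_coll collinear_pointsI[of l G P Q] assms(1) by simp
  moreover have "coords R $ 0 = coords P $ 0 + coords Q $ 0 + bil P Q"
    unfolding coords_nth(5) coords_line[OF assms]
    by (simp only: parabolic_bilinear_def distrib_left distrib_right ac_simps)
  ultimately show ?thesis
    using coords_line[OF assms] by (simp add: vec5_eq_iff del: add_bit_eq_xor)
qed

text \<open>Both points lie on the unique tangent line at \<open>R\<close>.\<close>

lemma common_grid_neighbour:
  assumes P: "P \<in> points G" "P \<notin> grid_points a" and Q: "Q \<in> points G" "Q \<notin> grid_points a"
    and R: "R \<in> grid_points a" "coll P R" "coll Q R"
  shows "coll P Q"
proof -
  have Rp: "R \<in> points G" using R grid_points_subset[OF grid] by blast
  obtain k where k: "k \<in> lines G" "inc G P k" "inc G R k" using R by (auto simp: collinear_points_def)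
  obtain m where m: "m \<in> lines G" "inc G Q m" "inc G R m" using R by (auto simp: collinear_points_def)
  have "(R, k) \<in> grid_chambers G a" "(R, m) \<in> grid_chambers G a"
    using k m P Q R Rp by (auto simp: grid_chambers_def chambers_def)
  moreover obtain n where "{l. (R, l) \<in> grid_chambers G a} = {n}"
    using tangent_lines[OF grid R(1)] by blast
  ultimately have "k = n" "m = n" by blast+
  then have "k = m" by simp
  then show ?thesis using k m collinear_pointsI by metis
qed

text \<open>In the remaining case \<open>P\<close> and \<open>Q\<close> are off the grid and not
  collinear. For a grid point \<open>?R\<close> collinear with \<open>Q\<close>, \<open>P\<close> is
  not collinear with \<open>?R\<close> by \<open>common_grid_neighbour\<close>, so it is collinear
  with the third point \<open>T\<close> of that line, and
  \<open>bil P Q = bil P T + bil P ?R = 0 + 1\<close>.\<close>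

lemma bilinear_eq_noncoll:
  assumes P: "P \<in> points G" and Q: "Q \<in> points G"
  shows "bil P Q = noncoll P Q"
proof -
  consider "coll P Q" | "P \<in> grid_points a" | "Q \<in> grid_points a"
    | "\<not> coll P Q" "P \<notin> grid_points a" "Q \<notin> grid_points a" by blast
  then show ?thesis
  proof cases
    case 1
    then show ?thesis using bilinear_coll[OF P Q] by (simp add: noncoll_def)
  next
    case 2
    then show ?thesis using bilinear_grid[OF Q] bilinear_sym noncoll_sym by (auto simp: grid_points_def)
  next
    case 3
    then show ?thesis using bilinear_grid[OF P] by (auto simp: grid_points_def)
  next
    case 4
    obtain j where j: "coll Q (a I0 j)" using row_not_all(1)[OF Q, of I0] by (auto simp: noncoll_eq_0)
    let ?R = "a I0 j"
    have R: "?R \<in> points G" "?R \<in> grid_points a" using grid_point[OF grid] grid_points_mem by auto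
    have nPR: "\<not> coll P ?R" using common_grid_neighbour[OF P 4(2) Q 4(3) R(2)] j 4(1) by blast
    obtain l where l: "l \<in> lines G" "inc G Q l" "inc G ?R l" using j by (auto simp: collinear_points_def)
    have "Q \<noteq> ?R" using R 4 by auto
    then obtain T where T: "T \<in> points G" "inc G T l" "T \<noteq> Q" "T \<noteq> ?R" "pts l = {Q, ?R, T}"
      using third_point[OF l(1) Q R(1) l(2,3)] by blast
    obtain Y where Y: "Y \<in> pts l" "coll P Y" using projection[OF P l(1)] by blast
    then have "coll P T" using T(5) nPR 4(1) by auto
    then have "bil P T = 0" by (rule bilinear_coll[OF P T(1)])
    moreover have "bil P ?R = 1" using bilinear_grid[OF P] nPR by (simp add: noncoll_def)
    moreover have "bil P Q = bil P T + bil P ?R"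
    proof -
      have "pts l = {T, ?R, Q}" using T(5) by auto
      from coords_line[OF l(1) this T(4) T(3) \<open>Q \<noteq> ?R\<close>[symmetric]]
      show ?thesis
        by (simp only: parabolic_bilinear_def distrib_left distrib_right ac_simps not_False_eq_True)
    qed
    ultimately show ?thesis using 4(1) by (simp add: noncoll_def)
  qed
qed

end
end

section \<open>The isomorphism with the quadric\<close>

context gq22 begin

context
  fixes a :: "idx \<Rightarrow> idx \<Rightarrow> 'p"
  assumes grid: "grid G a"
begin

abbreviation (input) crd :: "'p \<Rightarrow> bit ^ 5" where "crd \<equiv> coords a"

lemma coords_nonzero:
  assumes P: "P \<in> points G"
  shows "crd P \<noteq> 0"
proof
  assume 0: "crd P = 0"
  then have "P \<in> grid_points a" using coords_0_iff[OF grid P] by simp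
  then obtain i j where ij: "P = a i j" by (auto simp: grid_points_def)
  have "noncoll P (a I0 I0) = 0" "noncoll P (a I1 I1) = 0" "noncoll P (a I0 I1) = 0"
    "noncoll P (a I1 I0) = 0"
    using 0 coords_nth(1-4)[OF grid, of P] by simp_all
  then show False unfolding ij noncoll_grid[OF grid] by (cases i; cases j) simp_all
qed

text \<open>Points with equal coordinates are collinear because the polar form is alternating. If
  they were different, the third point of their line would have coordinate vector 0.\<close>

lemma coords_inj:
  assumes P: "P \<in> points G" and Q: "Q \<in> points G" and e: "crd P = crd Q"
  shows "P = Q"
proof (rule ccontr)
  assume ne: "P \<noteq> Q"
  have "noncoll P Q = 0" using bilinear_eq_noncoll[OF grid P Q] e bilinear_self by simp
  then have "coll P Q" by (simp add: noncoll_eq_0)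
  then obtain l where l: "l \<in> lines G" "inc G P l" "inc G Q l" by (auto simp: collinear_points_def)
  obtain R where R: "R \<in> points G" "R \<noteq> P" "R \<noteq> Q" "pts l = {P, Q, R}"
    using third_point[OF l(1) P Q l(2,3) ne] by blast
  have "crd R = crd P + crd Q"
    by (rule coords_add_line[OF grid l(1) R(4) ne R(2)[symmetric] R(3)[symmetric]])
  also have "\<dots> = 0" unfolding e by (rule bit_vec_add_self)
  finally show False using coords_nonzero[OF R(1)] by simp
qed

text \<open>Surjectivity is a count: there are \<open>(2 + 1) * (2 * 2 + 1) = 15\<close> points and
  at most 15 nonzero singular vectors.\<close>

lemma bij_betw_coords: "bij_betw crd (points G) {v. v \<noteq> 0 \<and> parabolic_form v = 0}"
  unfolding bij_betw_def
proof
  show inj: "inj_on crd (points G)" using coords_inj by (auto simp: inj_on_def)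
  show "crd ` points G = {v. v \<noteq> 0 \<and> parabolic_form v = 0}"
  proof (rule card_seteq)
    show "crd ` points G \<subseteq> {v. v \<noteq> 0 \<and> parabolic_form v = 0}"
      using coords_nonzero parabolic_form_coords[OF grid] by auto
    have "card (crd ` points G) = 15" using inj card_points by (simp add: card_image)
    then show "card {v. v \<noteq> 0 \<and> parabolic_form v = 0} \<le> card (crd ` points G)"
      using card_singular_vectors(1) by simp
  qed (rule card_singular_vectors(2))
qed

definition point_map :: "'p \<Rightarrow> (bit ^ 5) set" where
  "point_map P = {0, crd P}"

definition line_map :: "'l \<Rightarrow> (bit ^ 5) set" where
  "line_map l = insert 0 (crd ` pts l)"

lemma line_map_eq:
  assumes "l \<in> lines G" "pts l = {P, Q, R}" "P \<noteq> Q" "P \<noteq> R" "Q \<noteq> R"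
  shows "line_map l = {0, crd P, crd Q, crd P + crd Q}"
  using coords_add_line[OF grid assms] assms(2) by (auto simp: line_map_def)

text \<open>Lines go to lines because coordinates add along them. Conversely, two points of a line
  of the quadric are orthogonal, hence by \<open>bilinear_eq_noncoll\<close> represent collinear
  points.\<close>

lemma incidence_isomorphism_coords: "incidence_isomorphism G Q42 point_map line_map"
  unfolding incidence_isomorphism_def
proof (intro conjI ballI)
  have bij: "bij_betw (\<lambda>v. {0, v}) {v. v \<noteq> 0 \<and> parabolic_form v = 0} (points Q42)"
    unfolding points_Q42 by (rule bij_betwI') auto
  have "point_map = (\<lambda>v. {0, v}) \<circ> crd" by (auto simp: point_map_def)
  then show "bij_betw point_map (points G) (points Q42)"
    using bij_betw_trans[OF bij_betw_coords bij] by simp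
next
  show "inc G P l \<longleftrightarrow> inc Q42 (point_map P) (line_map l)" if "P \<in> points G" "l \<in> lines G" for P l
    using that coords_nonzero coords_inj by (auto simp: point_map_def line_map_def)
next
  have three: "\<exists>P Q R. pts l = {P, Q, R} \<and> P \<noteq> Q \<and> P \<noteq> R \<and> Q \<noteq> R" if "l \<in> lines G" for l
  proof -
    have "card (pts l) = 3" using card_pts[OF that] by simp
    then show ?thesis unfolding card_3_iff by blast
  qed
  show "bij_betw line_map (lines G) (lines Q42)"
  proof (rule bij_betwI')
    fix l m assume lm: "l \<in> lines G" "m \<in> lines G"
    show "line_map l = line_map m \<longleftrightarrow> l = m"
    proof
      assume e: "line_map l = line_map m"
      have "pts l \<subseteq> pts m"
      proof
        fix P assume P: "P \<in> pts l"
        then have "crd P \<in> line_map m" using e by (auto simp: line_map_def)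
        then obtain Q where "Q \<in> pts m" "crd P = crd Q"
          using coords_nonzero P by (auto simp: line_map_def)
        then show "P \<in> pts m" using coords_inj[of P Q] P by simp
      qed
      moreover obtain P Q R where "pts l = {P, Q, R}" "P \<noteq> Q" using three[OF lm(1)] by blast
      ultimately have "P \<in> pts l" "Q \<in> pts l" "P \<in> pts m" "Q \<in> pts m" "P \<noteq> Q" by blast+
      then show "l = m" using line_unique[of P Q l m] lm by simp
    qed simp
  next
    fix l assume l: "l \<in> lines G"
    obtain P Q R where PQR: "pts l = {P, Q, R}" "P \<noteq> Q" "P \<noteq> R" "Q \<noteq> R" using three[OF l] by blast
    then have pts: "P \<in> points G" "Q \<in> points G" "R \<in> points G" by blast+
    have "crd P + crd Q = crd R" using coords_add_line[OF grid l PQR] by simp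
    then have "parabolic_form (crd P + crd Q) = 0" using parabolic_form_coords[OF grid, of R] by simp
    moreover have "crd P \<noteq> crd Q" using coords_inj pts PQR by blast
    ultimately show "line_map l \<in> lines Q42"
      unfolding lines_Q42 line_map_eq[OF l PQR]
      using coords_nonzero pts parabolic_form_coords[OF grid] by blast
  next
    fix U assume "U \<in> lines Q42"
    then obtain u v where uv: "U = {0, u, v, u + v}" "u \<noteq> 0" "v \<noteq> 0" "u \<noteq> v" "parabolic_form u = 0"
      "parabolic_form v = 0" "parabolic_form (u + v) = 0"
      unfolding lines_Q42 by blast
    obtain P where P: "P \<in> points G" "crd P = u"
      using bij_betw_coords uv by (auto simp: bij_betw_def) (metis (mono_tags, lifting) imageE mem_Collect_eq)
    obtain Q where Q: "Q \<in> points G" "crd Q = v"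
      using bij_betw_coords uv by (auto simp: bij_betw_def) (metis (mono_tags, lifting) imageE mem_Collect_eq)
    have "parabolic_bilinear u v = 0" using uv(5-7) parabolic_form_add[of u v] by simp
    then have "coll P Q" using bilinear_eq_noncoll[OF grid P(1) Q(1)] P Q by (simp add: noncoll_eq_0)
    then obtain l where l: "l \<in> lines G" "inc G P l" "inc G Q l" by (auto simp: collinear_points_def)
    have ne: "P \<noteq> Q" using P Q uv by auto
    obtain R where R: "R \<in> points G" "R \<noteq> P" "R \<noteq> Q" "pts l = {P, Q, R}"
      using third_point[OF l(1) P(1) Q(1) l(2,3) ne] by blast
    have "line_map l = U"
      using line_map_eq[OF l(1) R(4) ne R(2)[symmetric] R(3)[symmetric]] P Q uv by simp
    then show "\<exists>l\<in>lines G. U = line_map l" using l by blast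
  qed
qed

text \<open>The solid is the hyperplane of vectors with coordinate 0 equal to 0, which by
  \<open>coords_0_iff\<close> contains precisely the grid.\<close>

lemma X_set_grid_chambers: "X_set G (grid_chambers G a)"
proof -
  let ?H = "{x :: bit ^ 5. x $ 0 = 0}"
  note ip = isomorphism_points_Q42[OF incidence_isomorphism_coords]
  have "(point_map P, line_map l) \<in> X_Q42 ?H \<longleftrightarrow> (P, l) \<in> grid_chambers G a"
    if c: "(P, l) \<in> chambers G" for P l
  proof -
    have Pl: "P \<in> points G" "l \<in> lines G" "inc G P l" using c by (auto simp: chambers_def)
    have "point_map P \<in> points Q42" "line_map l \<in> lines Q42" "point_map P \<subseteq> line_map l"
      using incidence_isomorphism_coords Pl by (auto simp: incidence_isomorphism_def dest: bij_betwE)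
    then have "(point_map P, line_map l) \<in> chambers Q42" by (simp add: chambers_def)
    moreover have "point_map P \<subseteq> ?H \<longleftrightarrow> P \<in> grid_points a"
      using coords_0_iff[OF grid Pl(1)] by (simp add: point_map_def)
    moreover have "line_map l \<subseteq> ?H \<longleftrightarrow> (\<forall>Q\<in>pts l. Q \<in> grid_points a)"
    proof -
      have "line_map l \<subseteq> ?H \<longleftrightarrow> (\<forall>Q\<in>pts l. crd Q $ 0 = 0)" by (auto simp: line_map_def)
      then show ?thesis using coords_0_iff[OF grid] by blast
    qed
    ultimately show ?thesis using c by (auto simp: X_Q42_def grid_chambers_def)
  qed
  then have "grid_chambers G a = {(P, l) \<in> chambers G. (point_map P, line_map l) \<in> X_Q42 ?H}"
    by (auto simp: grid_chambers_def)
  then show ?thesis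
    using incidence_isomorphism_coords hyperbolic_solid_coordinate unfolding X_set_def by blast
qed

end

lemma X_set_iff: "X_set G S \<longleftrightarrow> (\<exists>a. grid G a \<and> S = grid_chambers G a)"
  using X_set_grid X_set_grid_chambers by blast

end

section \<open>Independence number and maximum independent sets\<close>

context thick_gq begin

lemma gq22_if: "s = 2 \<Longrightarrow> t = 2 \<Longrightarrow> gq22 G"
  using thick_gq_axioms by (simp add: gq22_def)

lemma X_set_ind: "s = 2 \<Longrightarrow> t = 2 \<Longrightarrow> X_set G S \<Longrightarrow> ind_chambers G S \<and> card S = 9"
proof -
  assume "s = 2" "t = 2"
  then have q: "gq22 G" by (rule gq22_if)
  assume "X_set G S"
  then obtain a where a: "grid G a" "S = grid_chambers G a" using gq22.X_set_iff[OF q] by blast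
  then show ?thesis
    using gq22.ind_grid_chambers[OF q a(1)] gq22.card_grid_chambers[OF q a(1)] by simp
qed

text \<open>For \<open>s = t = 2\<close> the hypothesis says that \<open>S\<close> has at least 8
  elements, which is what the grid argument requires. All sets in the conclusion have
  \<open>(s + 1) * (t + 1)\<close> elements, so (a), (b) and (c) all follow from here.\<close>

lemma max_ind_chambers_large:
  assumes S: "max_ind_chambers G S" and large: "card S > max (1 + s + 2 * t) (1 + t + 2 * s)"
  shows "S \<in> F_point G ` points G \<union> F_line G ` lines G \<or> s = 2 \<and> t = 2 \<and> X_set G S"
proof -
  have "X_set G S" if "s = 2" "t = 2" "inj_on fst S" "inj_on snd S"
    using gq22.large_matching_is_grid_chambers[OF gq22_if[OF that(1,2)] S that(3,4)] large that(1,2)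
      gq22.X_set_iff[OF gq22_if[OF that(1,2)]] by simp
  then show ?thesis using max_ind_chambers_cases[OF S large] by blast
qed

lemma card_F:
  assumes "S \<in> F_point G ` points G \<union> F_line G ` lines G"
  shows "ind_chambers G S" "card S = (s + 1) * (t + 1)"
  using assms ind_F_point ind_F_line card_F_point card_F_line by blast+

lemma bound_less: "max (1 + s + 2 * t) (1 + t + 2 * s) < (s + 1) * (t + 1)"
proof -
  have "s * t \<ge> 2 * t" "s * t \<ge> s * 2" using s_ge_2 t_ge_2 mult_le_mono by blast+
  then show ?thesis using s_ge_2 t_ge_2 by simp
qed

lemma extend_to_maximal:
  assumes "ind_chambers G S"
  obtains T where "max_ind_chambers G T" "S \<subseteq> T"
proof -
  have fin: "finite {T. ind_chambers G T}"
    by (rule finite_subset[of _ "Pow (chambers G)"]) (auto simp: ind_chambers_iff finite_chambers)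
  obtain T where T: "S \<subseteq> T" "T \<in> {T. ind_chambers G T}"
    "\<And>U. U \<in> {T. ind_chambers G T} \<Longrightarrow> T \<subseteq> U \<Longrightarrow> T = U"
    using finite_has_maximal2[OF fin, of S] assms by auto
  then show ?thesis using that[of T] by (auto simp: maximal_independent_set_def)
qed

lemma card_max_ind_chambers_le:
  assumes "max_ind_chambers G S"
  shows "card S \<le> (s + 1) * (t + 1)"
proof (cases "card S > max (1 + s + 2 * t) (1 + t + 2 * s)")
  case True
  from max_ind_chambers_large[OF assms this] show ?thesis
    using card_F(2)[of S] X_set_ind[of S] by auto
next
  case False
  then show ?thesis using bound_less by linarith
qed

lemma card_ind_chambers_le:
  assumes "ind_chambers G S"
  shows "card S \<le> (s + 1) * (t + 1)"
proof -
  obtain T where T: "max_ind_chambers G T" "S \<subseteq> T" using extend_to_maximal[OF assms] by blast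
  have "card S \<le> card T" using T finite_max_ind_chambers by (intro card_mono) auto
  then show ?thesis using card_max_ind_chambers_le[OF T(1)] by simp
qed

lemma independence_number_eq: "independence_number (chambers G) (opposition_edges G) = (s + 1) * (t + 1)"
  unfolding independence_number_def
proof (rule Max_eqI)
  show "finite (card ` {S. ind_chambers G S})"
    by (rule finite_subset[of _ "{..(s + 1) * (t + 1)}"]) (use card_ind_chambers_le in auto)
  show "n \<le> (s + 1) * (t + 1)" if "n \<in> card ` {S. ind_chambers G S}" for n
    using that card_ind_chambers_le by blast
  obtain P where "P \<in> points G" using points_nonempty by blast
  then show "(s + 1) * (t + 1) \<in> card ` {S. ind_chambers G S}"
    using ind_F_point card_F_point by (metis imageI mem_Collect_eq)
qed

lemma ind_chambers_of_max_card:
  assumes S: "ind_chambers G S" "card S = (s + 1) * (t + 1)"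
  shows "S \<in> F_point G ` points G \<union> F_line G ` lines G \<or> s = 2 \<and> t = 2 \<and> X_set G S"
proof -
  obtain T where T: "max_ind_chambers G T" "S \<subseteq> T" using extend_to_maximal[OF S(1)] by blast
  have "S = T"
    by (rule card_seteq) (use T finite_max_ind_chambers card_max_ind_chambers_le[OF T(1)] S in auto)
  then show ?thesis using max_ind_chambers_large T(1) S(2) bound_less by simp
qed

lemma maximum_ind_chambers:
  "{S. ind_chambers G S \<and> card S = (s + 1) * (t + 1)}
    = F_point G ` points G \<union> F_line G ` lines G \<union> (if (s, t) = (2, 2) then {S. X_set G S} else {})"
proof (intro equalityI subsetI)
  fix S assume "S \<in> {S. ind_chambers G S \<and> card S = (s + 1) * (t + 1)}"
  then show "S \<in> F_point G ` points G \<union> F_line G ` lines G \<union> (if (s, t) = (2, 2) then {S. X_set G S} else {})"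
    using ind_chambers_of_max_card[of S] by auto
next
  fix S assume "S \<in> F_point G ` points G \<union> F_line G ` lines G \<union> (if (s, t) = (2, 2) then {S. X_set G S} else {})"
  then consider "S \<in> F_point G ` points G \<union> F_line G ` lines G" | "s = 2" "t = 2" "X_set G S"
    by (auto split: if_splits)
  then show "S \<in> {S. ind_chambers G S \<and> card S = (s + 1) * (t + 1)}"
    by cases (use card_F X_set_ind in auto)
qed

end

section \<open>The chromatic number\<close>

context thick_gq begin

definition colourable :: "nat \<Rightarrow> bool" where
  "colourable k \<longleftrightarrow> (\<exists>f. proper_colouring (chambers G) (opposition_edges G) k f)"

lemma colour_class_ind:
  assumes "proper_colouring (chambers G) (opposition_edges G) k f"
  shows "ind_chambers G {c \<in> chambers G. f c = i}"
  using assms opposition_edges_iff unfolding ind_chambers_iff proper_colouring_def by blast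

lemma sum_colour_classes:
  assumes "proper_colouring (chambers G) (opposition_edges G) k f"
  shows "card (chambers G) = (\<Sum>i<k. card {c \<in> chambers G. f c = i})"
proof -
  have "chambers G = (\<Union>i<k. {c \<in> chambers G. f c = i})"
    using assms by (auto simp: proper_colouring_def)
  then have "card (chambers G) = card (\<Union>i<k. {c \<in> chambers G. f c = i})" by simp
  also have "\<dots> = (\<Sum>i<k. card {c \<in> chambers G. f c = i})"
    by (rule card_UN_disjoint) (auto simp: finite_chambers)
  finally show ?thesis .
qed

text \<open>There are \<open>(s * t + 1) * ((s + 1) * (t + 1))\<close> chambers, and a colour class
  has at most \<open>(s + 1) * (t + 1)\<close> of them.\<close>

lemma colourable_ge:
  assumes "colourable k"
  shows "s * t + 1 \<le> k"
proof -
  obtain f where f: "proper_colouring (chambers G) (opposition_edges G) k f"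
    using assms by (auto simp: colourable_def)
  have "(s * t + 1) * ((s + 1) * (t + 1)) \<le> (\<Sum>i<k. (s + 1) * (t + 1))"
    unfolding card_chambers[symmetric] sum_colour_classes[OF f]
    by (intro sum_mono card_ind_chambers_le colour_class_ind[OF f])
  also have "\<dots> = k * ((s + 1) * (t + 1))" by simp
  finally show ?thesis by (subst (asm) mult_le_cancel2) simp
qed

text \<open>Giving every chamber its own colour shows that the least number in
  \<open>chromatic_number\<close> is attained.\<close>

lemma colourable_exists: "\<exists>k. colourable k"
proof -
  obtain f :: "'p \<times> 'l \<Rightarrow> nat" and k where f: "f ` chambers G = {i. i < k}" "inj_on f (chambers G)"
    using finite_imp_inj_to_nat_seg[OF finite_chambers] by metis
  have "proper_colouring (chambers G) (opposition_edges G) k f"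
    unfolding proper_colouring_def
  proof (intro conjI ballI impI notI)
    fix u v assume uv: "u \<in> chambers G" "v \<in> chambers G" "{u, v} \<in> opposition_edges G" "f u = f v"
    then have "u = v" using f(2) by (auto simp: inj_on_def)
    then show False using uv opposition_edges_iff not_opposite_self by blast
  qed (use f(1) in auto)
  then show ?thesis by (auto simp: colourable_def)
qed

lemma chromatic_number_Least: "chromatic_number (chambers G) (opposition_edges G) = (LEAST k. colourable k)"
  by (simp add: chromatic_number_def colourable_def)

lemma colourable_chromatic_number: "colourable (chromatic_number (chambers G) (opposition_edges G))"
  unfolding chromatic_number_Least using colourable_exists by (rule LeastI_ex)

section \<open>Colourings from ovoids and spreads\<close>

lemma card_ovoid:
  assumes "ovoid G A"
  shows "finite A" "card A = s * t + 1"
proof -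
  show fin: "finite A" using assms finite_points finite_subset by (auto simp: ovoid_def)
  have AP: "A \<subseteq> points G" using assms by (simp add: ovoid_def)
  have "lines G = (\<Union>P\<in>A. lns P)" using assms by (auto simp: ovoid_def)
  then have "card (lines G) = card (\<Union>P\<in>A. lns P)" by simp
  also have "\<dots> = (\<Sum>P\<in>A. card (lns P))"
  proof (rule card_UN_disjoint[OF fin])
    show "\<forall>P\<in>A. finite (lns P)" using AP finite_lns by auto
    show "\<forall>P\<in>A. \<forall>Q\<in>A. P \<noteq> Q \<longrightarrow> lns P \<inter> lns Q = {}"
      using assms unfolding ovoid_def by blast
  qed
  also have "\<dots> = (\<Sum>P\<in>A. t + 1)" using AP card_lns by (intro sum.cong) auto
  also have "\<dots> = card A * (t + 1)" by simp
  finally have "card A * (t + 1) = (s * t + 1) * (t + 1)"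
    unfolding card_lines by (simp only: mult.commute)
  then show "card A = s * t + 1" by (subst (asm) mult_cancel2) simp
qed

text \<open>A chamber is coloured by the ovoid point on its line. Chambers of the same colour have
  lines through a common point and are not opposite.\<close>

lemma colourable_if_ovoid:
  assumes A: "ovoid G A"
  shows "colourable (s * t + 1)"
proof -
  obtain e :: "'p \<Rightarrow> nat" where e: "bij_betw e A {..<s * t + 1}"
    using card_ovoid[OF A] finite_same_card_bij[of A "{..<s * t + 1}"] by auto
  define h where "h l = (THE P. P \<in> A \<and> inc G P l)" for l
  have h: "h l \<in> A \<and> inc G (h l) l" if "l \<in> lines G" for l
    unfolding h_def by (rule theI') (use A that in \<open>simp add: ovoid_def\<close>)
  have AP: "A \<subseteq> points G" using A by (simp add: ovoid_def)
  have "proper_colouring (chambers G) (opposition_edges G) (s * t + 1) (\<lambda>c. e (h (snd c)))"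
    unfolding proper_colouring_def
  proof (intro conjI ballI impI notI)
    show "(\<lambda>c. e (h (snd c))) ` chambers G \<subseteq> {..<s * t + 1}"
      using h bij_betwE[OF e] by (auto simp: chambers_def)
    fix c d assume cd: "c \<in> chambers G" "d \<in> chambers G" "{c, d} \<in> opposition_edges G"
      "e (h (snd c)) = e (h (snd d))"
    have sl: "snd c \<in> lines G" "snd d \<in> lines G" using cd by (auto simp: chambers_def)
    then have "h (snd c) = h (snd d)"
      using cd(4) e h by (auto simp: bij_betw_def inj_on_def)
    then have "conc (snd c) (snd d)"
      using concurrent_linesI[of "h (snd c)" G "snd c" "snd d"] h[OF sl(1)] h[OF sl(2)] AP by auto
    then show False using cd(3) opposition_edges_iff[OF cd(1,2)] by (simp add: opposite_def)
  qed
  then show ?thesis by (auto simp: colourable_def)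
qed

lemma colourable_dual: "thick_gq.colourable (dual_structure G) k \<Longrightarrow> colourable k"
proof -
  assume "thick_gq.colourable (dual_structure G) k"
  then obtain f where f: "proper_colouring (chambers (dual_structure G)) (opposition_edges (dual_structure G)) k f"
    using thick_gq.colourable_def[OF dual] by blast
  have "proper_colouring (chambers G) (opposition_edges G) k (f \<circ> prod.swap)"
    unfolding proper_colouring_def
  proof (intro conjI ballI impI)
    show "(f \<circ> prod.swap) ` chambers G \<subseteq> {..<k}"
      using f by (simp add: image_comp[symmetric] swap_chambers proper_colouring_def del: comp_apply)
    fix u v assume uv: "u \<in> chambers G" "v \<in> chambers G" "{u, v} \<in> opposition_edges G"
    then have "opposite (dual_structure G) (prod.swap u) (prod.swap v)"
      using opposition_edges_iff[OF uv(1,2)] by (simp only: opposite_dual)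
    then have "{prod.swap u, prod.swap v} \<in> opposition_edges (dual_structure G)"
      using uv by (simp only: opposition_edges_iff swap_in_chambers_dual)
    then show "(f \<circ> prod.swap) u \<noteq> (f \<circ> prod.swap) v"
      using f uv swap_in_chambers_dual unfolding proper_colouring_def comp_def by blast
  qed
  then show ?thesis by (auto simp: colourable_def)
qed

lemma ovoid_dual: "ovoid (dual_structure G) A \<longleftrightarrow> spread G A"
  by (simp add: ovoid_def spread_def)

lemma colourable_if_spread:
  assumes "spread G A"
  shows "colourable (s * t + 1)"
  using thick_gq.colourable_if_ovoid[OF dual] colourable_dual assms ovoid_dual by (metis mult.commute)

section \<open>Ovoids and spreads from colourings\<close>

lemma F_point_F_line_meet:
  assumes P: "P \<in> points G" and l: "l \<in> lines G"
  shows "F_point G P \<inter> F_line G l \<noteq> {}"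
proof -
  obtain Q where Q: "Q \<in> points G" "inc G Q l" "coll P Q" using projection[OF P l] by blast
  then obtain m where "m \<in> lines G" "inc G P m" "inc G Q m" by (auto simp: collinear_points_def)
  then have "(Q, m) \<in> F_point G P \<inter> F_line G l"
    using Q by (auto simp: F_point_def F_line_def chambers_def)
  then show ?thesis by blast
qed

text \<open>A chamber on \<open>l\<close> belongs to \<open>F(P)\<close> exactly if \<open>P\<close>
  is on \<open>l\<close>. Covering the chambers therefore puts some \<open>p i\<close> on every
  line, and disjointness makes it unique.\<close>

lemma ovoid_if_partition:
  assumes cover: "\<And>c. c \<in> chambers G \<Longrightarrow> \<exists>i\<in>I. c \<in> F_point G (p i)"
    and disjoint: "\<And>i j. i \<in> I \<Longrightarrow> j \<in> I \<Longrightarrow> F_point G (p i) \<inter> F_point G (p j) \<noteq> {} \<Longrightarrow> i = j"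
    and p: "\<And>i. i \<in> I \<Longrightarrow> p i \<in> points G"
  shows "ovoid G (p ` I)"
  unfolding ovoid_def
proof (intro conjI ballI)
  show "p ` I \<subseteq> points G" using p by blast
  fix l assume l: "l \<in> lines G"
  obtain Q where Q: "Q \<in> points G" "inc G Q l" using pts_nonempty[OF l] by blast
  then have Ql: "(Q, l) \<in> chambers G" using l by (simp add: chambers_def)
  then have mem: "(Q, l) \<in> F_point G P \<longleftrightarrow> inc G P l" for P by (simp add: F_point_def)
  obtain i where i: "i \<in> I" "inc G (p i) l" using cover[OF Ql] mem by blast
  show "\<exists>!P. P \<in> p ` I \<and> inc G P l"
  proof (intro ex1I[of _ "p i"] conjI)
    fix P assume "P \<in> p ` I \<and> inc G P l"
    then obtain j where j: "P = p j" "j \<in> I" "inc G (p j) l" by blast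
    then have "(Q, l) \<in> F_point G (p i) \<inter> F_point G (p j)" using mem i by blast
    then have "i = j" using disjoint[of i j] i j by blast
    then show "P = p i" using j by simp
  qed (use i in auto)
qed

text \<open>All colour classes of an \<open>(st + 1)\<close>-colouring are maximum independent sets. Since \<open>F(P)\<close> and
  \<open>F(l)\<close> always meet, they are all of the same kind, unless some class is an \<open>X\<close>; but \<open>Q(4,2)\<close> has ovoids.\<close>

lemma ovoid_or_spread_if_colourable:
  assumes "colourable (s * t + 1)"
  shows "(\<exists>A. ovoid G A) \<or> (\<exists>A. spread G A)"
proof -
  define k where "k = s * t + 1"
  obtain f where f: "proper_colouring (chambers G) (opposition_edges G) k f"
    using assms by (auto simp: colourable_def k_def)
  define C where "C i = {c \<in> chambers G. f c = i}" for i
  have ind: "ind_chambers G (C i)" for i unfolding C_def by (rule colour_class_ind[OF f])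
  have full: "card (C i) = (s + 1) * (t + 1)" if i: "i < k" for i
  proof (rule ccontr)
    assume "\<not> ?thesis"
    then have less: "card (C i) < (s + 1) * (t + 1)" using card_ind_chambers_le[OF ind[of i]] by simp
    \<comment> \<open>The classes have to add up to \<open>k * ((s + 1) * (t + 1))\<close>, so a
      single deficient class would make the total too small.\<close>
    have "(\<Sum>i<k. card (C i)) < (\<Sum>i<k. (s + 1) * (t + 1))"
      by (rule sum_strict_mono_ex1) (use card_ind_chambers_le[OF ind] less i in auto)
    then show False using sum_colour_classes[OF f] card_chambers by (simp add: C_def k_def)
  qed
  have kind: "C i \<in> F_point G ` points G \<union> F_line G ` lines G \<or> s = 2 \<and> t = 2 \<and> X_set G (C i)"
    if "i < k" for i
    using ind_chambers_of_max_card[OF ind full[OF that]] by blast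
  have disj: "i = j" if "C i \<inter> C j \<noteq> {}" for i j using that by (auto simp: C_def)
  have cover: "\<exists>i\<in>{..<k}. c \<in> C i" if "c \<in> chambers G" for c
    using f that by (auto simp: C_def proper_colouring_def)
  consider (X) i where "X_set G (C i)"
    | (points) "\<And>i. i < k \<Longrightarrow> \<exists>P\<in>points G. C i = F_point G P"
    | (lines) "\<And>i. i < k \<Longrightarrow> \<exists>l\<in>lines G. C i = F_line G l"
  proof -
    have "(\<exists>i. X_set G (C i)) \<or> (\<forall>i<k. (\<exists>P\<in>points G. C i = F_point G P) \<or> (\<exists>l\<in>lines G. C i = F_line G l))"
      using kind by blast
    \<comment> \<open>The last hypothesis excludes \<open>i = j\<close> without a separate proof
      that no \<open>F(P)\<close> equals an \<open>F(l)\<close>.\<close>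
    moreover have False if "i < k" "j < k" "C i \<in> F_point G ` points G" "C j \<in> F_line G ` lines G"
      "C j \<notin> F_point G ` points G" for i j
    proof -
      have "C i \<inter> C j \<noteq> {}" using that(3,4) F_point_F_line_meet by auto
      then show False using disj[of i j] that(3,5) by simp
    qed
    ultimately have "(\<exists>i. X_set G (C i)) \<or> (\<forall>i<k. C i \<in> F_point G ` points G) \<or> (\<forall>i<k. C i \<in> F_line G ` lines G)"
      unfolding image_iff by metis
    then show ?thesis using that by (auto simp: image_iff)
  qed
  then show ?thesis
  proof cases
    case X
    then show ?thesis using ovoid_if_isomorphic_Q42 unfolding X_set_def by blast
  next
    case points
    then obtain p where p: "\<And>i. i < k \<Longrightarrow> p i \<in> points G \<and> C i = F_point G (p i)" by metis
    have "ovoid G (p ` {..<k})"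
      by (rule ovoid_if_partition) (use p cover disj in auto)
    then show ?thesis by blast
  next
    case lines
    then obtain q where q: "\<And>i. i < k \<Longrightarrow> q i \<in> lines G \<and> C i = F_line G (q i)" by metis
    have "ovoid (dual_structure G) (q ` {..<k})"
    proof (rule thick_gq.ovoid_if_partition[OF dual])
      fix c assume "c \<in> chambers (dual_structure G)"
      then have "prod.swap c \<in> chambers G" by (metis swap_in_chambers_dual swap_swap)
      then obtain i where "i < k" "prod.swap c \<in> F_line G (q i)" using cover q by blast
      then show "\<exists>i\<in>{..<k}. c \<in> F_point (dual_structure G) (q i)"
        unfolding F_point_dual by (metis image_eqI lessThan_iff swap_swap)
    next
      fix i j assume ij: "i \<in> {..<k}" "j \<in> {..<k}"
        "F_point (dual_structure G) (q i) \<inter> F_point (dual_structure G) (q j) \<noteq> {}"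
      then have "F_line G (q i) \<inter> F_line G (q j) \<noteq> {}"
        unfolding F_point_dual by (simp add: image_Int[OF inj_swap_prod, symmetric])
      then show "i = j" using disj[of i j] q ij by auto
    qed (use q in auto)
    then show ?thesis using ovoid_dual by blast
  qed
qed

lemma chromatic_number_dichotomy:
  "if (\<exists>A. ovoid G A) \<or> (\<exists>A. spread G A)
   then chromatic_number (chambers G) (opposition_edges G) = s * t + 1
   else chromatic_number (chambers G) (opposition_edges G) \<ge> s * t + 2"
proof (cases "(\<exists>A. ovoid G A) \<or> (\<exists>A. spread G A)")
  case True
  then have "colourable (s * t + 1)" using colourable_if_ovoid colourable_if_spread by blast
  then have "chromatic_number (chambers G) (opposition_edges G) = s * t + 1"
    unfolding chromatic_number_Least by (rule Least_equality) (rule colourable_ge)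
  then show ?thesis using True by simp
next
  case False
  then have "\<not> colourable (s * t + 1)" using ovoid_or_spread_if_colourable by blast
  then have "chromatic_number (chambers G) (opposition_edges G) \<noteq> s * t + 1"
    using colourable_chromatic_number by metis
  then show ?thesis using False colourable_ge[OF colourable_chromatic_number] by simp
qed

end

theorem theorem1p3:
  fixes G :: "('p, 'l) incidence_structure" and s t :: nat
  assumes "thick_generalized_quadrangle G s t"
  shows "independence_number (chambers G) (opposition_edges G) = (s + 1) * (t + 1) \<and>
    {S. independent_set (chambers G) (opposition_edges G) S \<and>
        card S = independence_number (chambers G) (opposition_edges G)}
      = F_point G ` points G \<union> F_line G ` lines G \<union> (if (s, t) = (2, 2) then {S. X_set G S} else {}) \<and>
    (\<forall>S. maximal_independent_set (chambers G) (opposition_edges G) S \<and> card S < (s + 1) * (t + 1)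
       \<longrightarrow> card S \<le> max (1 + s + 2 * t) (1 + t + 2 * s)) \<and>
    (if (\<exists>A. ovoid G A) \<or> (\<exists>A. spread G A)
     then chromatic_number (chambers G) (opposition_edges G) = s * t + 1
     else chromatic_number (chambers G) (opposition_edges G) \<ge> s * t + 2)"
proof -
  interpret thick_gq G s t by unfold_locales (rule assms)
  \<comment> \<open>A set above the threshold has \<open>(s + 1) * (t + 1)\<close> elements by
    classification, so no cardinality strictly between the two values occurs.\<close>
  have "card S \<le> max (1 + s + 2 * t) (1 + t + 2 * s)"
    if S: "max_ind_chambers G S" and less: "card S < (s + 1) * (t + 1)" for S
  proof (rule ccontr)
    assume "\<not> ?thesis"
    then have "S \<in> F_point G ` points G \<union> F_line G ` lines G \<or> s = 2 \<and> t = 2 \<and> X_set G S"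
      using max_ind_chambers_large[OF S] by simp
    then show False using card_F(2)[of S] X_set_ind[of S] less by auto
  qed
  then show ?thesis
    unfolding independence_number_eq using maximum_ind_chambers chromatic_number_dichotomy by blast
qed

end
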